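(* Let $V$ be a $k$-vector space. There exists a connected Hopf algebra structure on the augmented free dendriform-Nijenhuis algebra $k1\oplus\mathcal{DN}(V)$ on $V$, as well as on the augmented free commutative dendriform-Nijenhuis algebra on $V$ (in both cases with the associative product given by $\bar\star$, extended so that $1$ is a unit).
   Context: Throughout, $k$ is a field of characteristic zero. A dendriform-Nijenhuis algebra is a $k$-vector space $D$ with nine bilinear operations $\nearrow,\searrow,\swarrow,\nwarrow,\uparrow,\downarrow,\tilde\prec,\tilde\succ,\tilde\bullet:D^{\otimes 2}\to D$ satisfying the 28 relations below, where sums of operations are pointwise and $\triangleleft:=\nwarrow+\swarrow+\tilde\prec$, $\triangleright:=\nearrow+\searrow+\tilde\succ$, $\bar\bullet:=\uparrow+\downarrow+\tilde\bullet$, $\wedge:=\nwarrow+\nearrow+\uparrow$, $\vee:=\searrow+\swarrow+\downarrow$, $\tilde\star:=\tilde\prec+\tilde\succ+\tilde\bullet$, and $\bar\star$ is the sum of all nine operations (an associative operation). For all $x,y,z$: (1) $(x\nwarrow y)\nwarrow z=x\nwarrow(y\bar\star z)$; $(x\nearrow y)\nwarrow z=x\nearrow(y\triangleleft z)$; $(x\wedge y)\nearrow z=x\nearrow(y\triangleright z)$; (2) $(x\swarrow y)\nwarrow z=x\swarrow(y\wedge z)$; $(x\searrow y)\nwarrow z=x\searrow(y\nwarrow z)$; $(x\vee y)\nearrow z=x\searrow(y\nearrow z)$; (3) $(x\triangleleft y)\swarrow z=x\swarrow(y\vee z)$; $(x\triangleright y)\swarrow z=x\searrow(y\swarrow z)$;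 $(x\bar\star y)\searrow z=x\searrow(y\searrow z)$; (4) $(x\swarrow y)\tilde\prec z=x\swarrow(y\tilde\star z)$; $(x\searrow y)\tilde\prec z=x\searrow(y\tilde\prec z)$; $(x\vee y)\tilde\succ z=x\searrow(y\tilde\succ z)$; (5) $(x\nwarrow y)\tilde\prec z=x\tilde\prec(y\vee z)$; $(x\nearrow y)\tilde\prec z=x\tilde\succ(y\swarrow z)$; $(x\wedge y)\tilde\succ z=x\tilde\succ(y\searrow z)$; (6) $(x\tilde\prec y)\nwarrow z=x\tilde\prec(y\wedge z)$; $(x\tilde\succ y)\nwarrow z=x\tilde\succ(y\nwarrow z)$; $(x\tilde\star y)\nearrow z=x\tilde\succ(y\nearrow z)$; (7) $(x\tilde\prec y)\tilde\prec z=x\tilde\prec(y\tilde\star z)$; $(x\tilde\succ y)\tilde\prec z=x\tilde\succ(y\tilde\prec z)$; $(x\tilde\star y)\tilde\succ z=x\tilde\succ(y\tilde\succ z)$; (8) $(x\wedge y)\uparrow z+(x\uparrow y)\nwarrow z=x\nearrow(y\bar\bullet z)+x\uparrow(y\bar\star z)$; (9) $(x\vee y)\uparrow z+(x\downarrow y)\nwarrow z=x\searrow(y\uparrow z)+x\downarrow(y\wedge z)$; (10) $(x\bar\star y)\downarrow z+(x\bar\bullet y)\swarrow z=x\searrow(y\downarrow z)+x\downarrow(y\vee z)$; (11) $(x\vee y)\tilde\bullet z+(x\downarrow y)\tilde\prec z=x\searrow(y\tilde\bullet z)+x\downarrow(y\tilde\star z)$; (12) $(x\wedge y)\tilde\bullet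 z+(x\uparrow y)\tilde\prec z=x\tilde\succ(y\downarrow z)+x\tilde\bullet(y\vee z)$; (13) $(x\tilde\star y)\uparrow z+(x\tilde\bullet y)\nwarrow z=x\tilde\succ(y\uparrow z)+x\tilde\bullet(y\wedge z)$; (14) $(x\tilde\star y)\tilde\bullet z+(x\tilde\bullet y)\tilde\prec z=x\tilde\succ(y\tilde\bullet z)+x\tilde\bullet(y\tilde\star z)$. It is commutative if it coincides with its opposite structure, i.e. for all $x,y$: $x\searrow y=y\nwarrow x$, $x\nearrow y=y\swarrow x$, $x\uparrow y=y\downarrow x$, $x\tilde\succ y=y\tilde\prec x$, $x\tilde\bullet y=y\tilde\bullet x$. Free (commutative) dendriform-Nijenhuis algebras on $V$ are characterized by the usual universal property; the augmentation of an algebra $P$ is $P_+:=k1\oplus P$. A bialgebra $(H,\mu,\Delta,\eta,\kappa)$ (unital associative algebra, counital coassociative coalgebra, with $\Delta,\kappa$ morphisms of unital algebras) is connected if $H=\bigcup_r F_rH$, where $F_0H:=k1_H$ and $F_rH:=\{x\in H:\Delta(x)-1_H\otimes x-x\otimes1_H\in F_{r-1}H\otimes F_{r-1}H\}$. A connected bialgebra admits an antipode and is called a connected Hopf algebra. *)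

theory Defs
  imports "HOL-Algebra.Module" "HOL.Hull"
begin

section \<open>Linear maps and bilinear operations\<close>

definition lin_hom ::
  "('k, 'm) ring_scheme \<Rightarrow> ('k, 'a, 'n) module_scheme \<Rightarrow> ('k, 'b, 'p) module_scheme \<Rightarrow> ('a \<Rightarrow> 'b) set"
  where "lin_hom K M N = {f \<in> carrier M \<rightarrow> carrier N.
     (\<forall>x\<in>carrier M. \<forall>y\<in>carrier M. f (x \<oplus>\<^bsub>M\<^esub> y) = f x \<oplus>\<^bsub>N\<^esub> f y) \<and>
     (\<forall>c\<in>carrier K. \<forall>x\<in>carrier M. f (c \<odot>\<^bsub>M\<^esub> x) = c \<odot>\<^bsub>N\<^esub> f x)}"

locale op_module = module K A
  for K :: "('k, 'm) ring_scheme" and \<Omega> :: "'o set"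
    and A :: "('k, 'a, 'n) module_scheme" and b :: "'o \<Rightarrow> 'a \<Rightarrow> 'a \<Rightarrow> 'a" +
  assumes op_closed: "\<lbrakk>p \<in> \<Omega>; x \<in> carrier A; y \<in> carrier A\<rbrakk> \<Longrightarrow> b p x y \<in> carrier A"
    and op_add_left: "\<lbrakk>p \<in> \<Omega>; x \<in> carrier A; x' \<in> carrier A; y \<in> carrier A\<rbrakk> \<Longrightarrow>
       b p (x \<oplus>\<^bsub>A\<^esub> x') y = b p x y \<oplus>\<^bsub>A\<^esub> b p x' y"
    and op_add_right: "\<lbrakk>p \<in> \<Omega>; x \<in> carrier A; y \<in> carrier A; y' \<in> carrier A\<rbrakk> \<Longrightarrow>
       b p x (y \<oplus>\<^bsub>A\<^esub> y') = b p x y \<oplus>\<^bsub>A\<^esub> b p x y'"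
    and op_smult_left: "\<lbrakk>p \<in> \<Omega>; c \<in> carrier K; x \<in> carrier A; y \<in> carrier A\<rbrakk> \<Longrightarrow>
       b p (c \<odot>\<^bsub>A\<^esub> x) y = c \<odot>\<^bsub>A\<^esub> b p x y"
    and op_smult_right: "\<lbrakk>p \<in> \<Omega>; c \<in> carrier K; x \<in> carrier A; y \<in> carrier A\<rbrakk> \<Longrightarrow>
       b p x (c \<odot>\<^bsub>A\<^esub> y) = c \<odot>\<^bsub>A\<^esub> b p x y"

definition op_hom ::
  "('k, 'm) ring_scheme \<Rightarrow> 'o set \<Rightarrow> ('k, 'a, 'n) module_scheme \<Rightarrow> ('o \<Rightarrow> 'a \<Rightarrow> 'a \<Rightarrow> 'a) \<Rightarrow>
   ('k, 'b, 'p) module_scheme \<Rightarrow> ('o \<Rightarrow> 'b \<Rightarrow> 'b \<Rightarrow> 'b) \<Rightarrow> ('a \<Rightarrow> 'b) set"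
  where "op_hom K \<Omega> A a B b = {f \<in> lin_hom K A B.
     \<forall>p\<in>\<Omega>. \<forall>x\<in>carrier A. \<forall>y\<in>carrier A. f (a p x y) = b p (f x) (f y)}"


section \<open>Modules with bilinear operations, presented by generators and relations\<close>

datatype ('k, 'o, 'g) lterm =
    Gen 'g
  | Zero
  | Add "('k, 'o, 'g) lterm" "('k, 'o, 'g) lterm"
  | Smul 'k "('k, 'o, 'g) lterm"
  | Op 'o "('k, 'o, 'g) lterm" "('k, 'o, 'g) lterm"

inductive_set lterms :: "('k, 'm) ring_scheme \<Rightarrow> 'o set \<Rightarrow> 'g set \<Rightarrow> ('k, 'o, 'g) lterm set"
  for K :: "('k, 'm) ring_scheme" and \<Omega> :: "'o set" and G :: "'g set"
  where
    Gen: "g \<in> G \<Longrightarrow> Gen g \<in> lterms K \<Omega> G"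
  | Zero: "Zero \<in> lterms K \<Omega> G"
  | Add: "\<lbrakk>s \<in> lterms K \<Omega> G; t \<in> lterms K \<Omega> G\<rbrakk> \<Longrightarrow> Add s t \<in> lterms K \<Omega> G"
  | Smul: "\<lbrakk>c \<in> carrier K; t \<in> lterms K \<Omega> G\<rbrakk> \<Longrightarrow> Smul c t \<in> lterms K \<Omega> G"
  | Op: "\<lbrakk>p \<in> \<Omega>; s \<in> lterms K \<Omega> G; t \<in> lterms K \<Omega> G\<rbrakk> \<Longrightarrow> Op p s t \<in> lterms K \<Omega> G"

text \<open>The least congruence on the terms that contains the relations \<open>E\<close>, the module axioms and
  the bilinearity of the operations in \<open>\<Omega>\<close>. Only those pairs in \<open>E\<close> count whose two sides are
  terms over \<open>K\<close>, \<open>\<Omega>\<close> and \<open>G\<close>, so that sets of relations can be written without carrier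
  conditions.\<close>

inductive lcong ::
  "('k, 'm) ring_scheme \<Rightarrow> 'o set \<Rightarrow> 'g set \<Rightarrow> (('k, 'o, 'g) lterm \<times> ('k, 'o, 'g) lterm) set \<Rightarrow>
   ('k, 'o, 'g) lterm \<Rightarrow> ('k, 'o, 'g) lterm \<Rightarrow> bool"
  for K :: "('k, 'm) ring_scheme" and \<Omega> :: "'o set" and G :: "'g set"
    and E :: "(('k, 'o, 'g) lterm \<times> ('k, 'o, 'g) lterm) set"
  where
    rel: "\<lbrakk>(s, t) \<in> E; s \<in> lterms K \<Omega> G; t \<in> lterms K \<Omega> G\<rbrakk> \<Longrightarrow> lcong K \<Omega> G E s t"
  | refl: "s \<in> lterms K \<Omega> G \<Longrightarrow> lcong K \<Omega> G E s s"
  | sym: "lcong K \<Omega> G E s t \<Longrightarrow> lcong K \<Omega> G E t s"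
  | trans: "\<lbrakk>lcong K \<Omega> G E s t; lcong K \<Omega> G E t u\<rbrakk> \<Longrightarrow> lcong K \<Omega> G E s u"
  | Add_cong: "\<lbrakk>lcong K \<Omega> G E s s'; lcong K \<Omega> G E t t'\<rbrakk> \<Longrightarrow> lcong K \<Omega> G E (Add s t) (Add s' t')"
  | Smul_cong: "\<lbrakk>c \<in> carrier K; lcong K \<Omega> G E t t'\<rbrakk> \<Longrightarrow> lcong K \<Omega> G E (Smul c t) (Smul c t')"
  | Op_cong: "\<lbrakk>p \<in> \<Omega>; lcong K \<Omega> G E s s'; lcong K \<Omega> G E t t'\<rbrakk> \<Longrightarrow>
      lcong K \<Omega> G E (Op p s t) (Op p s' t')"
  | Add_assoc: "\<lbrakk>s \<in> lterms K \<Omega> G; t \<in> lterms K \<Omega> G; u \<in> lterms K \<Omega> G\<rbrakk> \<Longrightarrow>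
      lcong K \<Omega> G E (Add (Add s t) u) (Add s (Add t u))"
  | Add_comm: "\<lbrakk>s \<in> lterms K \<Omega> G; t \<in> lterms K \<Omega> G\<rbrakk> \<Longrightarrow> lcong K \<Omega> G E (Add s t) (Add t s)"
  | Add_Zero: "t \<in> lterms K \<Omega> G \<Longrightarrow> lcong K \<Omega> G E (Add Zero t) t"
  | Add_neg: "t \<in> lterms K \<Omega> G \<Longrightarrow> lcong K \<Omega> G E (Add (Smul (\<ominus>\<^bsub>K\<^esub> \<one>\<^bsub>K\<^esub>) t) t) Zero"
  | Smul_add: "\<lbrakk>c \<in> carrier K; d \<in> carrier K; t \<in> lterms K \<Omega> G\<rbrakk> \<Longrightarrow>
      lcong K \<Omega> G E (Smul (c \<oplus>\<^bsub>K\<^esub> d) t) (Add (Smul c t) (Smul d t))"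
  | Smul_Add: "\<lbrakk>c \<in> carrier K; s \<in> lterms K \<Omega> G; t \<in> lterms K \<Omega> G\<rbrakk> \<Longrightarrow>
      lcong K \<Omega> G E (Smul c (Add s t)) (Add (Smul c s) (Smul c t))"
  | Smul_Smul: "\<lbrakk>c \<in> carrier K; d \<in> carrier K; t \<in> lterms K \<Omega> G\<rbrakk> \<Longrightarrow>
      lcong K \<Omega> G E (Smul (c \<otimes>\<^bsub>K\<^esub> d) t) (Smul c (Smul d t))"
  | Smul_one: "t \<in> lterms K \<Omega> G \<Longrightarrow> lcong K \<Omega> G E (Smul \<one>\<^bsub>K\<^esub> t) t"
  | Op_Add_left: "\<lbrakk>p \<in> \<Omega>; s \<in> lterms K \<Omega> G; s' \<in> lterms K \<Omega> G; t \<in> lterms K \<Omega> G\<rbrakk> \<Longrightarrow>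
      lcong K \<Omega> G E (Op p (Add s s') t) (Add (Op p s t) (Op p s' t))"
  | Op_Add_right: "\<lbrakk>p \<in> \<Omega>; s \<in> lterms K \<Omega> G; t \<in> lterms K \<Omega> G; t' \<in> lterms K \<Omega> G\<rbrakk> \<Longrightarrow>
      lcong K \<Omega> G E (Op p s (Add t t')) (Add (Op p s t) (Op p s t'))"
  | Op_Smul_left: "\<lbrakk>p \<in> \<Omega>; c \<in> carrier K; s \<in> lterms K \<Omega> G; t \<in> lterms K \<Omega> G\<rbrakk> \<Longrightarrow>
      lcong K \<Omega> G E (Op p (Smul c s) t) (Smul c (Op p s t))"
  | Op_Smul_right: "\<lbrakk>p \<in> \<Omega>; c \<in> carrier K; s \<in> lterms K \<Omega> G; t \<in> lterms K \<Omega> G\<rbrakk> \<Longrightarrow>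
      lcong K \<Omega> G E (Op p s (Smul c t)) (Smul c (Op p s t))"

definition lclass ::
  "('k, 'm) ring_scheme \<Rightarrow> 'o set \<Rightarrow> 'g set \<Rightarrow> (('k, 'o, 'g) lterm \<times> ('k, 'o, 'g) lterm) set \<Rightarrow>
   ('k, 'o, 'g) lterm \<Rightarrow> ('k, 'o, 'g) lterm set"
  where "lclass K \<Omega> G E t = {s. lcong K \<Omega> G E t s}"

text \<open>The ring part of a module record plays no role for a module, hence the undefined fields.\<close>

definition presented ::
  "('k, 'm) ring_scheme \<Rightarrow> 'o set \<Rightarrow> 'g set \<Rightarrow> (('k, 'o, 'g) lterm \<times> ('k, 'o, 'g) lterm) set \<Rightarrow>
   ('k, ('k, 'o, 'g) lterm set) module"
  where "presented K \<Omega> G E =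
    \<lparr>carrier = lclass K \<Omega> G E ` lterms K \<Omega> G,
     mult = undefined, one = undefined,
     zero = lclass K \<Omega> G E Zero,
     add = (\<lambda>X Y. \<Union>s\<in>X. \<Union>t\<in>Y. lclass K \<Omega> G E (Add s t)),
     smult = (\<lambda>c X. \<Union>t\<in>X. lclass K \<Omega> G E (Smul c t))\<rparr>"

definition presented_op ::
  "('k, 'm) ring_scheme \<Rightarrow> 'o set \<Rightarrow> 'g set \<Rightarrow> (('k, 'o, 'g) lterm \<times> ('k, 'o, 'g) lterm) set \<Rightarrow>
   'o \<Rightarrow> ('k, 'o, 'g) lterm set \<Rightarrow> ('k, 'o, 'g) lterm set \<Rightarrow> ('k, 'o, 'g) lterm set"
  where "presented_op K \<Omega> G E p X Y = (\<Union>s\<in>X. \<Union>t\<in>Y. lclass K \<Omega> G E (Op p s t))"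

primrec leval ::
  "('k, 'a, 'n) module_scheme \<Rightarrow> ('o \<Rightarrow> 'a \<Rightarrow> 'a \<Rightarrow> 'a) \<Rightarrow> ('g \<Rightarrow> 'a) \<Rightarrow> ('k, 'o, 'g) lterm \<Rightarrow> 'a"
  where
    "leval A b f (Gen g) = f g"
  | "leval A b f Zero = \<zero>\<^bsub>A\<^esub>"
  | "leval A b f (Add s t) = leval A b f s \<oplus>\<^bsub>A\<^esub> leval A b f t"
  | "leval A b f (Smul c t) = c \<odot>\<^bsub>A\<^esub> leval A b f t"
  | "leval A b f (Op p s t) = b p (leval A b f s) (leval A b f t)"

text \<open>The map induced on congruence classes: the common value of the terms in the class.\<close>

definition linduced ::
  "('k, 'a, 'n) module_scheme \<Rightarrow> ('o \<Rightarrow> 'a \<Rightarrow> 'a \<Rightarrow> 'a) \<Rightarrow> ('g \<Rightarrow> 'a) \<Rightarrow> ('k, 'o, 'g) lterm set \<Rightarrow> 'a"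
  where "linduced A b f X = the_elem (leval A b f ` X)"

lemma lterms_iff [simp]:
  "Gen g \<in> lterms K \<Omega> G \<longleftrightarrow> g \<in> G"
  "Zero \<in> lterms K \<Omega> G"
  "Add s t \<in> lterms K \<Omega> G \<longleftrightarrow> s \<in> lterms K \<Omega> G \<and> t \<in> lterms K \<Omega> G"
  "Smul c t \<in> lterms K \<Omega> G \<longleftrightarrow> c \<in> carrier K \<and> t \<in> lterms K \<Omega> G"
  "Op p s t \<in> lterms K \<Omega> G \<longleftrightarrow> p \<in> \<Omega> \<and> s \<in> lterms K \<Omega> G \<and> t \<in> lterms K \<Omega> G"
  by (subst lterms.simps, simp)+

lemma lclass_eqI: "lcong K \<Omega> G E s t \<Longrightarrow> lclass K \<Omega> G E s = lclass K \<Omega> G E t"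
proof -
  assume st: "lcong K \<Omega> G E s t"
  have "lcong K \<Omega> G E s u \<longleftrightarrow> lcong K \<Omega> G E t u" for u
    using lcong.trans[OF st, of u] lcong.trans[OF lcong.sym[OF st], of u] by iprover
  then show ?thesis by (simp add: lclass_def)
qed

lemma lcong_lterms:
  assumes "cring K" "lcong K \<Omega> G E s t"
  shows "s \<in> lterms K \<Omega> G \<and> t \<in> lterms K \<Omega> G"
proof -
  interpret cring K by fact
  from assms(2) show ?thesis
    by induction simp_all
qed

lemma UN_eq_const: "\<lbrakk>a \<in> X; \<And>x. x \<in> X \<Longrightarrow> f x = c\<rbrakk> \<Longrightarrow> (\<Union>x\<in>X. f x) = c"
  by blast

lemma lclass_self: "t \<in> lterms K \<Omega> G \<Longrightarrow> t \<in> lclass K \<Omega> G E t"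
  by (simp add: lclass_def lcong.refl)

lemma presented_add:
  assumes "s \<in> lterms K \<Omega> G" "t \<in> lterms K \<Omega> G"
  shows "lclass K \<Omega> G E s \<oplus>\<^bsub>presented K \<Omega> G E\<^esub> lclass K \<Omega> G E t = lclass K \<Omega> G E (Add s t)"
proof -
  have "lclass K \<Omega> G E (Add s' t') = lclass K \<Omega> G E (Add s t)"
    if "s' \<in> lclass K \<Omega> G E s" "t' \<in> lclass K \<Omega> G E t" for s' t'
    using that by (intro lclass_eqI[symmetric] lcong.Add_cong) (simp_all add: lclass_def)
  then have "(\<Union>s'\<in>lclass K \<Omega> G E s. \<Union>t'\<in>lclass K \<Omega> G E t. lclass K \<Omega> G E (Add s' t')) =
      lclass K \<Omega> G E (Add s t)"
    by (rule UN_eq_const[OF lclass_self[OF assms(1)] UN_eq_const[OF lclass_self[OF assms(2)]]])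
  then show ?thesis by (simp add: presented_def)
qed

lemma presented_smult:
  assumes "c \<in> carrier K" "t \<in> lterms K \<Omega> G"
  shows "c \<odot>\<^bsub>presented K \<Omega> G E\<^esub> lclass K \<Omega> G E t = lclass K \<Omega> G E (Smul c t)"
proof -
  have "lclass K \<Omega> G E (Smul c t') = lclass K \<Omega> G E (Smul c t)"
    if "t' \<in> lclass K \<Omega> G E t" for t'
    using that assms(1) by (intro lclass_eqI[symmetric] lcong.Smul_cong) (simp_all add: lclass_def)
  then have "(\<Union>t'\<in>lclass K \<Omega> G E t. lclass K \<Omega> G E (Smul c t')) = lclass K \<Omega> G E (Smul c t)"
    by (rule UN_eq_const[OF lclass_self[OF assms(2)]])
  then show ?thesis by (simp add: presented_def)
qed

lemma presented_op:
  assumes "p \<in> \<Omega>" "s \<in> lterms K \<Omega> G" "t \<in> lterms K \<Omega> G"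
  shows "presented_op K \<Omega> G E p (lclass K \<Omega> G E s) (lclass K \<Omega> G E t) = lclass K \<Omega> G E (Op p s t)"
proof -
  have "lclass K \<Omega> G E (Op p s' t') = lclass K \<Omega> G E (Op p s t)"
    if "s' \<in> lclass K \<Omega> G E s" "t' \<in> lclass K \<Omega> G E t" for s' t'
    using that assms(1) by (intro lclass_eqI[symmetric] lcong.Op_cong) (simp_all add: lclass_def)
  then show ?thesis
    unfolding presented_op_def by (rule UN_eq_const[OF lclass_self[OF assms(2)] UN_eq_const[OF lclass_self[OF assms(3)]]])
qed

lemma presented_carrier: "carrier (presented K \<Omega> G E) = lclass K \<Omega> G E ` lterms K \<Omega> G"
  and presented_zero: "\<zero>\<^bsub>presented K \<Omega> G E\<^esub> = lclass K \<Omega> G E Zero"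
  by (simp_all add: presented_def)

lemmas presented_simps =
  presented_carrier presented_zero presented_add presented_smult presented_op

lemmas lclass_axioms =
  lcong.Add_assoc [THEN lclass_eqI] lcong.Add_Zero [THEN lclass_eqI]
  lcong.Add_neg [THEN lclass_eqI] lcong.Smul_add [THEN lclass_eqI]
  lcong.Smul_Add [THEN lclass_eqI] lcong.Smul_Smul [THEN lclass_eqI]
  lcong.Smul_one [THEN lclass_eqI] lcong.Op_Add_left [THEN lclass_eqI]
  lcong.Op_Add_right [THEN lclass_eqI] lcong.Op_Smul_left [THEN lclass_eqI]
  lcong.Op_Smul_right [THEN lclass_eqI]

lemma op_module_presented:
  assumes "cring K"
  shows "op_module K \<Omega> (presented K \<Omega> G E) (presented_op K \<Omega> G E)"
proof -
  interpret cring K by fact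
  have "abelian_group (presented K \<Omega> G E)"
  proof (rule abelian_groupI)
    fix X assume "X \<in> carrier (presented K \<Omega> G E)"
    then obtain t where t: "t \<in> lterms K \<Omega> G" "X = lclass K \<Omega> G E t"
      by (auto simp: presented_simps)
    have "Smul (\<ominus>\<^bsub>K\<^esub> \<one>\<^bsub>K\<^esub>) t \<in> lterms K \<Omega> G"
      using t by auto
    with t show "\<exists>Y\<in>carrier (presented K \<Omega> G E).
        Y \<oplus>\<^bsub>presented K \<Omega> G E\<^esub> X = \<zero>\<^bsub>presented K \<Omega> G E\<^esub>"
      by (intro bexI[of _ "lclass K \<Omega> G E (Smul (\<ominus>\<^bsub>K\<^esub> \<one>\<^bsub>K\<^esub>) t)"])
        (auto simp: presented_simps lclass_axioms)
  next
    fix X Y assume "X \<in> carrier (presented K \<Omega> G E)" "Y \<in> carrier (presented K \<Omega> G E)"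
    then show "X \<oplus>\<^bsub>presented K \<Omega> G E\<^esub> Y = Y \<oplus>\<^bsub>presented K \<Omega> G E\<^esub> X"
      by (clarsimp simp: presented_simps) (rule lclass_eqI[OF lcong.Add_comm])
  qed (auto simp: presented_simps lclass_axioms)
  then show ?thesis
    by (intro op_module.intro moduleI op_module_axioms.intro assms)
      (auto simp: presented_simps lclass_axioms)
qed

context op_module
begin

lemma leval_closed:
  assumes "f \<in> G \<rightarrow> carrier A" "t \<in> lterms K \<Omega> G"
  shows "leval A b f t \<in> carrier A"
  using assms(2) by induction (use assms(1) in \<open>auto intro: op_closed\<close>)

lemma leval_cong:
  assumes f: "f \<in> G \<rightarrow> carrier A"
    and E: "\<And>s t. \<lbrakk>(s, t) \<in> E; s \<in> lterms K \<Omega> G; t \<in> lterms K \<Omega> G\<rbrakk> \<Longrightarrow> leval A b f s = leval A b f t"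
    and "lcong K \<Omega> G E s t"
  shows "leval A b f s = leval A b f t"
  using assms(3)
proof induction
  case (Add_neg t)
  then show ?case
    using leval_closed[OF f] by (simp add: smult_l_minus M.l_neg)
next
  case (Add_comm s t)
  then show ?case
    using leval_closed[OF f] by (simp add: M.a_comm)
qed (use leval_closed[OF f] in \<open>auto simp: E M.a_assoc smult_l_distr smult_r_distr
      smult_assoc1 op_add_left op_add_right op_smult_left op_smult_right\<close>)

lemma linduced_class:
  assumes f: "f \<in> G \<rightarrow> carrier A"
    and E: "\<And>s t. \<lbrakk>(s, t) \<in> E; s \<in> lterms K \<Omega> G; t \<in> lterms K \<Omega> G\<rbrakk> \<Longrightarrow> leval A b f s = leval A b f t"
    and t: "t \<in> lterms K \<Omega> G"
  shows "linduced A b f (lclass K \<Omega> G E t) = leval A b f t"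
proof -
  have "leval A b f ` lclass K \<Omega> G E t = {leval A b f t}"
  proof (intro equalityI subsetI)
    fix x assume "x \<in> leval A b f ` lclass K \<Omega> G E t"
    then obtain s where "x = leval A b f s" "lcong K \<Omega> G E t s"
      by (auto simp: lclass_def)
    then show "x \<in> {leval A b f t}"
      using leval_cong[OF f E, where s = t and t = s] by simp
  next
    fix x assume "x \<in> {leval A b f t}"
    then show "x \<in> leval A b f ` lclass K \<Omega> G E t"
      using lcong.refl[OF t, of E] by (auto simp: lclass_def)
  qed
  then show ?thesis by (simp add: linduced_def)
qed

lemma linduced_hom:
  assumes f: "f \<in> G \<rightarrow> carrier A"
    and E: "\<And>s t. \<lbrakk>(s, t) \<in> E; s \<in> lterms K \<Omega> G; t \<in> lterms K \<Omega> G\<rbrakk> \<Longrightarrow> leval A b f s = leval A b f t"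
  shows "linduced A b f \<in> op_hom K \<Omega> (presented K \<Omega> G E) (presented_op K \<Omega> G E) A b"
    and "\<And>g. g \<in> G \<Longrightarrow> linduced A b f (lclass K \<Omega> G E (Gen g)) = f g"
proof -
  note ind = linduced_class[OF f E]
  show "linduced A b f \<in> op_hom K \<Omega> (presented K \<Omega> G E) (presented_op K \<Omega> G E) A b"
    unfolding op_hom_def lin_hom_def
    by (auto simp: presented_simps ind leval_closed[OF f])
  show "linduced A b f (lclass K \<Omega> G E (Gen g)) = f g" if "g \<in> G" for g
    using that by (simp add: ind)
qed

lemma presented_hom_unique:
  assumes h: "h \<in> op_hom K \<Omega> (presented K \<Omega> G E) (presented_op K \<Omega> G E) A b"
    and h': "h' \<in> op_hom K \<Omega> (presented K \<Omega> G E) (presented_op K \<Omega> G E) A b"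
    and eq: "\<And>g. g \<in> G \<Longrightarrow> h (lclass K \<Omega> G E (Gen g)) = h' (lclass K \<Omega> G E (Gen g))"
    and X: "X \<in> carrier (presented K \<Omega> G E)"
  shows "h X = h' X"
proof -
  interpret P: op_module K \<Omega> "presented K \<Omega> G E" "presented_op K \<Omega> G E"
    by (rule op_module_presented) (rule R.is_cring)
  have zero: "k (lclass K \<Omega> G E Zero) = \<zero>\<^bsub>A\<^esub>"
    if k: "k \<in> op_hom K \<Omega> (presented K \<Omega> G E) (presented_op K \<Omega> G E) A b" for k
  proof -
    let ?z = "\<zero>\<^bsub>presented K \<Omega> G E\<^esub>"
    have c: "k ?z \<in> carrier A"
      using k by (auto simp: op_hom_def lin_hom_def)
    have "k (\<zero>\<^bsub>K\<^esub> \<odot>\<^bsub>presented K \<Omega> G E\<^esub> ?z) = \<zero>\<^bsub>K\<^esub> \<odot>\<^bsub>A\<^esub> k ?z"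
      using k P.M.zero_closed unfolding op_hom_def lin_hom_def by blast
    then show ?thesis
      using c P.smult_l_null[OF P.M.zero_closed] by (simp add: presented_zero)
  qed
  have "h (lclass K \<Omega> G E t) = h' (lclass K \<Omega> G E t)" if "t \<in> lterms K \<Omega> G" for t
    using that
  proof induction
    case (Add s t)
    have *: "k (lclass K \<Omega> G E (Add s t)) = k (lclass K \<Omega> G E s) \<oplus>\<^bsub>A\<^esub> k (lclass K \<Omega> G E t)"
      if "k \<in> op_hom K \<Omega> (presented K \<Omega> G E) (presented_op K \<Omega> G E) A b" for k
      using that Add by (auto simp: op_hom_def lin_hom_def presented_simps)
    show ?case using *[OF h] *[OF h'] Add.IH by simp
  next
    case (Smul c t)
    have *: "k (lclass K \<Omega> G E (Smul c t)) = c \<odot>\<^bsub>A\<^esub> k (lclass K \<Omega> G E t)"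
      if "k \<in> op_hom K \<Omega> (presented K \<Omega> G E) (presented_op K \<Omega> G E) A b" for k
      using that Smul by (auto simp: op_hom_def lin_hom_def presented_simps)
    show ?case using *[OF h] *[OF h'] Smul.IH by simp
  next
    case (Op p s t)
    have *: "k (lclass K \<Omega> G E (Op p s t)) = b p (k (lclass K \<Omega> G E s)) (k (lclass K \<Omega> G E t))"
      if "k \<in> op_hom K \<Omega> (presented K \<Omega> G E) (presented_op K \<Omega> G E) A b" for k
      using that Op by (auto simp: op_hom_def lin_hom_def presented_simps)
    show ?case using *[OF h] *[OF h'] Op.IH by simp
  qed (use h h' in \<open>auto simp: eq zero\<close>)
  with X show ?thesis by (auto simp: presented_carrier)
qed

end


section \<open>Tensor products\<close>

definition tensor_rels ::
  "('k, 'a, 'n) module_scheme \<Rightarrow> ('k, 'b, 'p) module_scheme \<Rightarrow>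
   (('k, unit, 'a \<times> 'b) lterm \<times> ('k, unit, 'a \<times> 'b) lterm) set"
  where "tensor_rels M N =
     (\<Union>x x' y. {(Gen (x \<oplus>\<^bsub>M\<^esub> x', y), Add (Gen (x, y)) (Gen (x', y)))}) \<union>
     (\<Union>x y y'. {(Gen (x, y \<oplus>\<^bsub>N\<^esub> y'), Add (Gen (x, y)) (Gen (x, y')))}) \<union>
     (\<Union>c x y. {(Gen (c \<odot>\<^bsub>M\<^esub> x, y), Smul c (Gen (x, y)))}) \<union>
     (\<Union>c x y. {(Gen (x, c \<odot>\<^bsub>N\<^esub> y), Smul c (Gen (x, y)))})"

text \<open>The set of operations is empty here, so the type \<open>unit\<close> of operation names is a dummy.\<close>

definition tensor ::
  "('k, 'm) ring_scheme \<Rightarrow> ('k, 'a, 'n) module_scheme \<Rightarrow> ('k, 'b, 'p) module_scheme \<Rightarrow>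
   ('k, ('k, unit, 'a \<times> 'b) lterm set) module"
  where "tensor K M N = presented K {} (carrier M \<times> carrier N) (tensor_rels M N)"

definition tens ::
  "('k, 'm) ring_scheme \<Rightarrow> ('k, 'a, 'n) module_scheme \<Rightarrow> ('k, 'b, 'p) module_scheme \<Rightarrow>
   'a \<Rightarrow> 'b \<Rightarrow> ('k, unit, 'a \<times> 'b) lterm set"
  where "tens K M N x y = lclass K {} (carrier M \<times> carrier N) (tensor_rels M N) (Gen (x, y))"

text \<open>The linear map on a tensor product given by a bilinear map \<open>f\<close> into \<open>P\<close>.\<close>

definition tensor_lift ::
  "('k, 'c, 'p) module_scheme \<Rightarrow> ('a \<Rightarrow> 'b \<Rightarrow> 'c) \<Rightarrow> ('k, unit, 'a \<times> 'b) lterm set \<Rightarrow> 'c"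
  where "tensor_lift P f = linduced P undefined (case_prod f)"

lemma tensor_lift:
  assumes "module K P"
    and closed: "\<And>x y. \<lbrakk>x \<in> carrier M; y \<in> carrier N\<rbrakk> \<Longrightarrow> f x y \<in> carrier P"
    and "\<And>x x' y. \<lbrakk>x \<in> carrier M; x' \<in> carrier M; y \<in> carrier N\<rbrakk> \<Longrightarrow>
      f (x \<oplus>\<^bsub>M\<^esub> x') y = f x y \<oplus>\<^bsub>P\<^esub> f x' y"
    and "\<And>x y y'. \<lbrakk>x \<in> carrier M; y \<in> carrier N; y' \<in> carrier N\<rbrakk> \<Longrightarrow>
      f x (y \<oplus>\<^bsub>N\<^esub> y') = f x y \<oplus>\<^bsub>P\<^esub> f x y'"
    and "\<And>c x y. \<lbrakk>c \<in> carrier K; x \<in> carrier M; y \<in> carrier N\<rbrakk> \<Longrightarrow>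
      f (c \<odot>\<^bsub>M\<^esub> x) y = c \<odot>\<^bsub>P\<^esub> f x y"
    and "\<And>c x y. \<lbrakk>c \<in> carrier K; x \<in> carrier M; y \<in> carrier N\<rbrakk> \<Longrightarrow>
      f x (c \<odot>\<^bsub>N\<^esub> y) = c \<odot>\<^bsub>P\<^esub> f x y"
  shows "tensor_lift P f \<in> lin_hom K (tensor K M N) P"
    and "\<And>x y. \<lbrakk>x \<in> carrier M; y \<in> carrier N\<rbrakk> \<Longrightarrow> tensor_lift P f (tens K M N x y) = f x y"
proof -
  interpret op_module K "{} :: unit set" P undefined
    by (intro op_module.intro op_module_axioms.intro assms) auto
  have f: "case_prod f \<in> carrier M \<times> carrier N \<rightarrow> carrier P"
    using closed by auto
  have E: "leval P undefined (case_prod f) s = leval P undefined (case_prod f) t"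
    if "(s, t) \<in> tensor_rels M N" "s \<in> lterms K {} (carrier M \<times> carrier N)"
      "t \<in> lterms K {} (carrier M \<times> carrier N)" for s t
    using that assms(3-) by (auto simp: tensor_rels_def)
  show "tensor_lift P f \<in> lin_hom K (tensor K M N) P"
    using linduced_hom(1)[OF f E] by (simp add: tensor_lift_def tensor_def op_hom_def)
  show "tensor_lift P f (tens K M N x y) = f x y" if "x \<in> carrier M" "y \<in> carrier N" for x y
    using linduced_hom(2)[OF f E, where g = "(x, y)"] that by (simp add: tensor_lift_def tens_def)
qed

definition tensor_map ::
  "('k, 'm) ring_scheme \<Rightarrow> ('k, 'c, 'n) module_scheme \<Rightarrow> ('k, 'd, 'p) module_scheme \<Rightarrow>
   ('a \<Rightarrow> 'c) \<Rightarrow> ('b \<Rightarrow> 'd) \<Rightarrow> ('k, unit, 'a \<times> 'b) lterm set \<Rightarrow> ('k, unit, 'c \<times> 'd) lterm set"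
  where "tensor_map K M' N' f g = tensor_lift (tensor K M' N') (\<lambda>x y. tens K M' N' (f x) (g y))"

text \<open>The isomorphism from \<open>(L \<otimes> M) \<otimes> N\<close> to \<open>L \<otimes> (M \<otimes> N)\<close>.\<close>

definition tensor_assoc ::
  "('k, 'm) ring_scheme \<Rightarrow> ('k, 'a, 'n) module_scheme \<Rightarrow> ('k, 'b, 'p) module_scheme \<Rightarrow>
   ('k, 'c, 'q) module_scheme \<Rightarrow>
   ('k, unit, ('k, unit, 'a \<times> 'b) lterm set \<times> 'c) lterm set \<Rightarrow>
   ('k, unit, 'a \<times> ('k, unit, 'b \<times> 'c) lterm set) lterm set"
  where "tensor_assoc K L M N =
    tensor_lift (tensor K L (tensor K M N))
      (\<lambda>w z. tensor_lift (tensor K L (tensor K M N))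
        (\<lambda>x y. tens K L (tensor K M N) x (tens K M N y z)) w)"

text \<open>The image of \<open>A \<otimes> A\<close> in \<open>H \<otimes> H\<close>, for a subspace \<open>A\<close> of \<open>H\<close>.\<close>

definition tensor_square ::
  "('k, 'm) ring_scheme \<Rightarrow> ('k, 'h, 'n) module_scheme \<Rightarrow> 'h set \<Rightarrow> ('k, unit, 'h \<times> 'h) lterm set set"
  where "tensor_square K H A =
    (\<lambda>W. submodule W K (tensor K H H)) hull {tens K H H x y | x y. x \<in> A \<and> y \<in> A}"


section \<open>Connected Hopf algebras\<close>

locale unital_algebra = module K H + ring H
  for K :: "('k, 'm) ring_scheme" and H :: "('k, 'h, 'n) module_scheme" (structure) +
  assumes smult_mult_left: "\<lbrakk>c \<in> carrier K; x \<in> carrier H; y \<in> carrier H\<rbrakk> \<Longrightarrow>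
      (c \<odot> x) \<otimes> y = c \<odot> (x \<otimes> y)"
    and smult_mult_right: "\<lbrakk>c \<in> carrier K; x \<in> carrier H; y \<in> carrier H\<rbrakk> \<Longrightarrow>
      x \<otimes> (c \<odot> y) = c \<odot> (x \<otimes> y)"

definition algebra_hom ::
  "('k, 'm) ring_scheme \<Rightarrow> ('k, 'a, 'n) module_scheme \<Rightarrow> ('k, 'b, 'p) module_scheme \<Rightarrow> ('a \<Rightarrow> 'b) set"
  where "algebra_hom K A B = ring_hom A B \<inter> lin_hom K A B"

definition ground_algebra :: "('k, 'm) ring_scheme \<Rightarrow> ('k, 'k) module"
  where "ground_algebra K =
    \<lparr>carrier = carrier K, mult = mult K, one = one K, zero = zero K, add = add K, smult = mult K\<rparr>"

text \<open>The algebra \<open>H \<otimes> H\<close>, with product \<open>(x \<otimes> y)(x' \<otimes> y') = xx' \<otimes> yy'\<close>.\<close>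

definition tensor_algebra ::
  "('k, 'm) ring_scheme \<Rightarrow> ('k, 'h, 'n) module_scheme \<Rightarrow> ('k, ('k, unit, 'h \<times> 'h) lterm set) module"
  where "tensor_algebra K H = (tensor K H H)
    \<lparr>mult := (\<lambda>s t. tensor_lift (tensor K H H)
        (\<lambda>x y. tensor_lift (tensor K H H) (\<lambda>x' y'. tens K H H (x \<otimes>\<^bsub>H\<^esub> x') (y \<otimes>\<^bsub>H\<^esub> y')) t) s),
     one := tens K H H \<one>\<^bsub>H\<^esub> \<one>\<^bsub>H\<^esub>\<rparr>"

locale bialgebra = unital_algebra K H
  for K :: "('k, 'm) ring_scheme" and H :: "('k, 'h, 'n) module_scheme" (structure)
    and \<Delta> :: "'h \<Rightarrow> ('k, unit, 'h \<times> 'h) lterm set" and \<kappa> :: "'h \<Rightarrow> 'k" +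
  assumes comult_hom: "\<Delta> \<in> algebra_hom K H (tensor_algebra K H)"
    and counit_hom: "\<kappa> \<in> algebra_hom K H (ground_algebra K)"
    and coassoc: "x \<in> carrier H \<Longrightarrow>
      tensor_assoc K H H H (tensor_map K (tensor K H H) H \<Delta> id (\<Delta> x)) =
      tensor_map K H (tensor K H H) id \<Delta> (\<Delta> x)"
    and counit_left: "x \<in> carrier H \<Longrightarrow> tensor_lift H (\<lambda>y z. \<kappa> y \<odot> z) (\<Delta> x) = x"
    and counit_right: "x \<in> carrier H \<Longrightarrow> tensor_lift H (\<lambda>y z. \<kappa> z \<odot> y) (\<Delta> x) = x"

primrec conn_filt ::
  "('k, 'm) ring_scheme \<Rightarrow> ('k, 'h, 'n) module_scheme \<Rightarrow>
   ('h \<Rightarrow> ('k, unit, 'h \<times> 'h) lterm set) \<Rightarrow> nat \<Rightarrow> 'h set"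
  where
    "conn_filt K H \<Delta> 0 = {c \<odot>\<^bsub>H\<^esub> \<one>\<^bsub>H\<^esub> | c. c \<in> carrier K}"
  | "conn_filt K H \<Delta> (Suc r) = {x \<in> carrier H.
       \<Delta> x \<ominus>\<^bsub>tensor K H H\<^esub> tens K H H \<one>\<^bsub>H\<^esub> x \<ominus>\<^bsub>tensor K H H\<^esub> tens K H H x \<one>\<^bsub>H\<^esub>
         \<in> tensor_square K H (conn_filt K H \<Delta> r)}"

locale connected_bialgebra = bialgebra +
  assumes connected: "carrier H = (\<Union>r. conn_filt K H \<Delta> r)"

text \<open>Every connected bialgebra has an antipode; it is made explicit nevertheless.\<close>

locale connected_hopf_algebra = connected_bialgebra +
  assumes antipode: "\<exists>S \<in> lin_hom K H H. \<forall>x\<in>carrier H.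
      tensor_lift H (\<lambda>y z. S y \<otimes> z) (\<Delta> x) = \<kappa> x \<odot> \<one> \<and>
      tensor_lift H (\<lambda>y z. y \<otimes> S z) (\<Delta> x) = \<kappa> x \<odot> \<one>"


section \<open>Dendriform-Nijenhuis algebras\<close>

text \<open>The last three names stand for the operations written with a tilde.\<close>

datatype dn_op = NE | SE | SW | NW | Up | Down | Prec | Succ | Bullet

text \<open>Identities are sets of pairs of a left and a right hand side. They are stated for an arbitrary
  sum and arbitrary operations, so that they apply both to elements of an algebra and to terms.
  In the notation, \<open>\<triangle>\<close> and \<open>\<nabla>\<close> replace the wedge and the vee, which denote connectives in HOL,
  the tilde is omitted, and a subscript minus stands for a bar.\<close>

context
  fixes plus :: "'a \<Rightarrow> 'a \<Rightarrow> 'a"  (infixl \<open>\<boxplus>\<close> 65)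
    and b :: "dn_op \<Rightarrow> 'a \<Rightarrow> 'a \<Rightarrow> 'a"
begin

private abbreviation (input) ne (infixl \<open>\<nearrow>\<close> 70) where "x \<nearrow> y \<equiv> b NE x y"
private abbreviation (input) se (infixl \<open>\<searrow>\<close> 70) where "x \<searrow> y \<equiv> b SE x y"
private abbreviation (input) sw (infixl \<open>\<swarrow>\<close> 70) where "x \<swarrow> y \<equiv> b SW x y"
private abbreviation (input) nw (infixl \<open>\<nwarrow>\<close> 70) where "x \<nwarrow> y \<equiv> b NW x y"
private abbreviation (input) up (infixl \<open>\<up>\<close> 70) where "x \<up> y \<equiv> b Up x y"
private abbreviation (input) down (infixl \<open>\<down>\<close> 70) where "x \<down> y \<equiv> b Down x y"
private abbreviation (input) prec (infixl \<open>\<prec>\<close> 70) where "x \<prec> y \<equiv> b Prec x y"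
private abbreviation (input) succ (infixl \<open>\<succ>\<close> 70) where "x \<succ> y \<equiv> b Succ x y"
private abbreviation (input) bullet (infixl \<open>\<bullet>\<close> 70) where "x \<bullet> y \<equiv> b Bullet x y"

private abbreviation (input) left (infixl \<open>\<triangleleft>\<close> 70) where "x \<triangleleft> y \<equiv> x \<nwarrow> y \<boxplus> x \<swarrow> y \<boxplus> x \<prec> y"
private abbreviation (input) right (infixl \<open>\<triangleright>\<close> 70) where "x \<triangleright> y \<equiv> x \<nearrow> y \<boxplus> x \<searrow> y \<boxplus> x \<succ> y"
private abbreviation (input) bar_bullet (infixl \<open>\<bullet>\<^sub>-\<close> 70) where "x \<bullet>\<^sub>- y \<equiv> x \<up> y \<boxplus> x \<down> y \<boxplus> x \<bullet> y"
private abbreviation (input) wedge (infixl \<open>\<triangle>\<close> 70) where "x \<triangle> y \<equiv> x \<nwarrow> y \<boxplus> x \<nearrow> y \<boxplus> x \<up> y"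
private abbreviation (input) vee (infixl \<open>\<nabla>\<close> 70) where "x \<nabla> y \<equiv> x \<searrow> y \<boxplus> x \<swarrow> y \<boxplus> x \<down> y"
private abbreviation (input) tilde_star (infixl \<open>\<star>\<close> 70) where "x \<star> y \<equiv> x \<prec> y \<boxplus> x \<succ> y \<boxplus> x \<bullet> y"

definition dn_star :: "'a \<Rightarrow> 'a \<Rightarrow> 'a"  (infixl \<open>\<star>\<^sub>-\<close> 70)
  where "x \<star>\<^sub>- y =
    x \<nearrow> y \<boxplus> x \<searrow> y \<boxplus> x \<swarrow> y \<boxplus> x \<nwarrow> y \<boxplus> x \<up> y \<boxplus> x \<down> y \<boxplus> x \<prec> y \<boxplus> x \<succ> y \<boxplus> x \<bullet> y"

definition dn_identities :: "'a \<Rightarrow> 'a \<Rightarrow> 'a \<Rightarrow> ('a \<times> 'a) set"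
  where "dn_identities x y z =
   {((x \<nwarrow> y) \<nwarrow> z, x \<nwarrow> (y \<star>\<^sub>- z)),
    ((x \<nearrow> y) \<nwarrow> z, x \<nearrow> (y \<triangleleft> z)),
    ((x \<triangle> y) \<nearrow> z, x \<nearrow> (y \<triangleright> z)),

    ((x \<swarrow> y) \<nwarrow> z, x \<swarrow> (y \<triangle> z)),
    ((x \<searrow> y) \<nwarrow> z, x \<searrow> (y \<nwarrow> z)),
    ((x \<nabla> y) \<nearrow> z, x \<searrow> (y \<nearrow> z)),

    ((x \<triangleleft> y) \<swarrow> z, x \<swarrow> (y \<nabla> z)),
    ((x \<triangleright> y) \<swarrow> z, x \<searrow> (y \<swarrow> z)),
    ((x \<star>\<^sub>- y) \<searrow> z, x \<searrow> (y \<searrow> z)),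

    ((x \<swarrow> y) \<prec> z, x \<swarrow> (y \<star> z)),
    ((x \<searrow> y) \<prec> z, x \<searrow> (y \<prec> z)),
    ((x \<nabla> y) \<succ> z, x \<searrow> (y \<succ> z)),

    ((x \<nwarrow> y) \<prec> z, x \<prec> (y \<nabla> z)),
    ((x \<nearrow> y) \<prec> z, x \<succ> (y \<swarrow> z)),
    ((x \<triangle> y) \<succ> z, x \<succ> (y \<searrow> z)),

    ((x \<prec> y) \<nwarrow> z, x \<prec> (y \<triangle> z)),
    ((x \<succ> y) \<nwarrow> z, x \<succ> (y \<nwarrow> z)),
    ((x \<star> y) \<nearrow> z, x \<succ> (y \<nearrow> z)),

    ((x \<prec> y) \<prec> z, x \<prec> (y \<star> z)),
    ((x \<succ> y) \<prec> z, x \<succ> (y \<prec> z)),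
    ((x \<star> y) \<succ> z, x \<succ> (y \<succ> z)),

    ((x \<triangle> y) \<up> z \<boxplus> (x \<up> y) \<nwarrow> z, x \<nearrow> (y \<bullet>\<^sub>- z) \<boxplus> x \<up> (y \<star>\<^sub>- z)),
    ((x \<nabla> y) \<up> z \<boxplus> (x \<down> y) \<nwarrow> z, x \<searrow> (y \<up> z) \<boxplus> x \<down> (y \<triangle> z)),
    ((x \<star>\<^sub>- y) \<down> z \<boxplus> (x \<bullet>\<^sub>- y) \<swarrow> z, x \<searrow> (y \<down> z) \<boxplus> x \<down> (y \<nabla> z)),
    ((x \<nabla> y) \<bullet> z \<boxplus> (x \<down> y) \<prec> z, x \<searrow> (y \<bullet> z) \<boxplus> x \<down> (y \<star> z)),
    ((x \<triangle> y) \<bullet> z \<boxplus> (x \<up> y) \<prec> z, x \<succ> (y \<down> z) \<boxplus> x \<bullet> (y \<nabla> z)),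
    ((x \<star> y) \<up> z \<boxplus> (x \<bullet> y) \<nwarrow> z, x \<succ> (y \<up> z) \<boxplus> x \<bullet> (y \<triangle> z)),
    ((x \<star> y) \<bullet> z \<boxplus> (x \<bullet> y) \<prec> z, x \<succ> (y \<bullet> z) \<boxplus> x \<bullet> (y \<star> z))}"

definition dn_comm_identities :: "'a \<Rightarrow> 'a \<Rightarrow> ('a \<times> 'a) set"
  where "dn_comm_identities x y =
   {(x \<searrow> y, y \<nwarrow> x), (x \<nearrow> y, y \<swarrow> x), (x \<up> y, y \<down> x), (x \<succ> y, y \<prec> x), (x \<bullet> y, y \<bullet> x)}"

end

locale dn_algebra = op_module K "UNIV :: dn_op set" D b
  for K :: "('k, 'm) ring_scheme" and D :: "('k, 'd, 'n) module_scheme"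
    and b :: "dn_op \<Rightarrow> 'd \<Rightarrow> 'd \<Rightarrow> 'd" +
  assumes dn_identities: "\<lbrakk>x \<in> carrier D; y \<in> carrier D; z \<in> carrier D;
      (l, r) \<in> dn_identities (add D) b x y z\<rbrakk> \<Longrightarrow> l = r"

locale comm_dn_algebra = dn_algebra +
  assumes dn_comm_identities: "\<lbrakk>x \<in> carrier D; y \<in> carrier D;
      (l, r) \<in> dn_comm_identities b x y\<rbrakk> \<Longrightarrow> l = r"

text \<open>The relations that make the inclusion of the generators linear.\<close>

definition gen_rels ::
  "('k, 'v, 'n) module_scheme \<Rightarrow> (('k, 'o, 'v) lterm \<times> ('k, 'o, 'v) lterm) set"
  where "gen_rels V =
     (\<Union>v w. {(Gen (v \<oplus>\<^bsub>V\<^esub> w), Add (Gen v) (Gen w))}) \<union>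
     (\<Union>c v. {(Gen (c \<odot>\<^bsub>V\<^esub> v), Smul c (Gen v))})"

definition dn_rels ::
  "('k, 'v, 'n) module_scheme \<Rightarrow> (('k, dn_op, 'v) lterm \<times> ('k, dn_op, 'v) lterm) set"
  where "dn_rels V = gen_rels V \<union> (\<Union>x y z. dn_identities Add Op x y z)"

definition comm_dn_rels ::
  "('k, 'v, 'n) module_scheme \<Rightarrow> (('k, dn_op, 'v) lterm \<times> ('k, dn_op, 'v) lterm) set"
  where "comm_dn_rels V = dn_rels V \<union> (\<Union>x y. dn_comm_identities Op x y)"

text \<open>The free algebras, their operations and the maps from \<open>V\<close> into them. That they have the
  universal property is proved below.\<close>

definition free_dn ::
  "('k, 'm) ring_scheme \<Rightarrow> ('k, 'v, 'n) module_scheme \<Rightarrow> ('k, ('k, dn_op, 'v) lterm set) module"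
  where "free_dn K V = presented K UNIV (carrier V) (dn_rels V)"

definition free_dn_op ::
  "('k, 'm) ring_scheme \<Rightarrow> ('k, 'v, 'n) module_scheme \<Rightarrow> dn_op \<Rightarrow>
   ('k, dn_op, 'v) lterm set \<Rightarrow> ('k, dn_op, 'v) lterm set \<Rightarrow> ('k, dn_op, 'v) lterm set"
  where "free_dn_op K V = presented_op K UNIV (carrier V) (dn_rels V)"

definition free_dn_gen ::
  "('k, 'm) ring_scheme \<Rightarrow> ('k, 'v, 'n) module_scheme \<Rightarrow> 'v \<Rightarrow> ('k, dn_op, 'v) lterm set"
  where "free_dn_gen K V v = lclass K UNIV (carrier V) (dn_rels V) (Gen v)"

definition free_comm_dn ::
  "('k, 'm) ring_scheme \<Rightarrow> ('k, 'v, 'n) module_scheme \<Rightarrow> ('k, ('k, dn_op, 'v) lterm set) module"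
  where "free_comm_dn K V = presented K UNIV (carrier V) (comm_dn_rels V)"

definition free_comm_dn_op ::
  "('k, 'm) ring_scheme \<Rightarrow> ('k, 'v, 'n) module_scheme \<Rightarrow> dn_op \<Rightarrow>
   ('k, dn_op, 'v) lterm set \<Rightarrow> ('k, dn_op, 'v) lterm set \<Rightarrow> ('k, dn_op, 'v) lterm set"
  where "free_comm_dn_op K V = presented_op K UNIV (carrier V) (comm_dn_rels V)"

definition free_comm_dn_gen ::
  "('k, 'm) ring_scheme \<Rightarrow> ('k, 'v, 'n) module_scheme \<Rightarrow> 'v \<Rightarrow> ('k, dn_op, 'v) lterm set"
  where "free_comm_dn_gen K V v = lclass K UNIV (carrier V) (comm_dn_rels V) (Gen v)"

definition augmentation ::
  "('k, 'm) ring_scheme \<Rightarrow> ('k, 'd, 'n) module_scheme \<Rightarrow> (dn_op \<Rightarrow> 'd \<Rightarrow> 'd \<Rightarrow> 'd) \<Rightarrow>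
   ('k, 'k \<times> 'd) module"
  where "augmentation K D b =
    \<lparr>carrier = carrier K \<times> carrier D,
     mult = (\<lambda>(c, x) (d, y). (c \<otimes>\<^bsub>K\<^esub> d, c \<odot>\<^bsub>D\<^esub> y \<oplus>\<^bsub>D\<^esub> d \<odot>\<^bsub>D\<^esub> x \<oplus>\<^bsub>D\<^esub> dn_star (add D) b x y)),
     one = (\<one>\<^bsub>K\<^esub>, \<zero>\<^bsub>D\<^esub>),
     zero = (\<zero>\<^bsub>K\<^esub>, \<zero>\<^bsub>D\<^esub>),
     add = (\<lambda>(c, x) (d, y). (c \<oplus>\<^bsub>K\<^esub> d, x \<oplus>\<^bsub>D\<^esub> y)),
     smult = (\<lambda>c (d, y). (c \<otimes>\<^bsub>K\<^esub> d, c \<odot>\<^bsub>D\<^esub> y))\<rparr>"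


subsection \<open>The universal properties\<close>

lemma dn_identities_lterms:
  assumes "(s, t) \<in> dn_identities Add Op x y z" "s \<in> lterms K \<Omega> G"
  shows "x \<in> lterms K \<Omega> G" "y \<in> lterms K \<Omega> G" "z \<in> lterms K \<Omega> G"
  using assms by (auto simp: dn_identities_def dn_star_def)

lemma dn_comm_identities_lterms:
  assumes "(s, t) \<in> dn_comm_identities Op x y" "s \<in> lterms K \<Omega> G"
  shows "x \<in> lterms K \<Omega> G" "y \<in> lterms K \<Omega> G"
  using assms by (auto simp: dn_comm_identities_def)

lemma leval_dn_identities:
  assumes "(s, t) \<in> dn_identities Add Op x y z"
  shows "(leval A b f s, leval A b f t) \<in>
    dn_identities (add A) b (leval A b f x) (leval A b f y) (leval A b f z)"
  using assms unfolding dn_identities_def dn_star_def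
  by (elim insertE) simp_all

lemma leval_dn_comm_identities:
  assumes "(s, t) \<in> dn_comm_identities Op x y"
  shows "(leval A b f s, leval A b f t) \<in> dn_comm_identities b (leval A b f x) (leval A b f y)"
  using assms unfolding dn_comm_identities_def
  by (elim insertE) simp_all

lemma dn_identities_lclass:
  assumes "(\<Union>x y z. dn_identities Add Op x y z) \<subseteq> E"
    and "x \<in> lterms K UNIV G" "y \<in> lterms K UNIV G" "z \<in> lterms K UNIV G"
    and "(l, r) \<in> dn_identities (add (presented K UNIV G E)) (presented_op K UNIV G E)
       (lclass K UNIV G E x) (lclass K UNIV G E y) (lclass K UNIV G E z)"
  shows "l = r"
proof -
  have *: "lclass K UNIV G E s = lclass K UNIV G E t"
    if "(s, t) \<in> dn_identities Add Op x y z" "s \<in> lterms K UNIV G" "t \<in> lterms K UNIV G" for s t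
    using that assms(1) by (intro lclass_eqI lcong.rel) blast+
  show ?thesis
    using assms(5) unfolding dn_identities_def dn_star_def
    by (elim insertE)
      (simp_all add: presented_simps assms(2-4),
       (rule *; simp add: dn_identities_def dn_star_def assms(2-4))+)
qed

lemma dn_comm_identities_lclass:
  assumes "(\<Union>x y. dn_comm_identities Op x y) \<subseteq> E"
    and "x \<in> lterms K UNIV G" "y \<in> lterms K UNIV G"
    and "(l, r) \<in> dn_comm_identities (presented_op K UNIV G E)
       (lclass K UNIV G E x) (lclass K UNIV G E y)"
  shows "l = r"
proof -
  have *: "lclass K UNIV G E s = lclass K UNIV G E t"
    if "(s, t) \<in> dn_comm_identities Op x y" "s \<in> lterms K UNIV G" "t \<in> lterms K UNIV G" for s t
    using that assms(1) by (intro lclass_eqI lcong.rel) blast+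
  show ?thesis
    using assms(4) unfolding dn_comm_identities_def
    by (elim insertE)
      (simp_all add: presented_simps assms(2-3),
       (rule *; simp add: dn_comm_identities_def assms(2-3))+)
qed

lemma dn_identities_presented:
  assumes "(\<Union>x y z. dn_identities Add Op x y z) \<subseteq> E"
    and "X \<in> carrier (presented K UNIV G E)" "Y \<in> carrier (presented K UNIV G E)"
      "Z \<in> carrier (presented K UNIV G E)"
    and "(l, r) \<in> dn_identities (add (presented K UNIV G E)) (presented_op K UNIV G E) X Y Z"
  shows "l = r"
proof -
  obtain x y z where "x \<in> lterms K UNIV G" "X = lclass K UNIV G E x"
    "y \<in> lterms K UNIV G" "Y = lclass K UNIV G E y"
    "z \<in> lterms K UNIV G" "Z = lclass K UNIV G E z"
    using assms(2-4) unfolding presented_carrier by (elim imageE)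
  then show ?thesis
    using dn_identities_lclass[OF assms(1)] assms(5) by simp
qed

lemma dn_comm_identities_presented:
  assumes "(\<Union>x y. dn_comm_identities Op x y) \<subseteq> E"
    and "X \<in> carrier (presented K UNIV G E)" "Y \<in> carrier (presented K UNIV G E)"
    and "(l, r) \<in> dn_comm_identities (presented_op K UNIV G E) X Y"
  shows "l = r"
proof -
  obtain x y where "x \<in> lterms K UNIV G" "X = lclass K UNIV G E x"
    "y \<in> lterms K UNIV G" "Y = lclass K UNIV G E y"
    using assms(2-3) unfolding presented_carrier by (elim imageE)
  then show ?thesis
    using dn_comm_identities_lclass[OF assms(1)] assms(4) by simp
qed

lemma gen_lin_hom:
  assumes "module K V" "gen_rels V \<subseteq> E"
  shows "(\<lambda>v. lclass K \<Omega> (carrier V) E (Gen v)) \<in> lin_hom K V (presented K \<Omega> (carrier V) E)"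
proof -
  interpret module K V by fact
  show ?thesis
    using assms(2) unfolding lin_hom_def
    by (auto simp: presented_simps gen_rels_def intro!: lclass_eqI lcong.rel)
qed

lemma leval_gen_rels:
  assumes "f \<in> lin_hom K V A" "(s, t) \<in> gen_rels V" "t \<in> lterms K \<Omega> (carrier V)"
  shows "leval A b f s = leval A b f t"
  using assms by (auto simp: gen_rels_def lin_hom_def)

lemma dn_rels_subset:
  "(\<Union>x y z. dn_identities Add Op x y z) \<subseteq> dn_rels V"
  "(\<Union>x y z. dn_identities Add Op x y z) \<subseteq> comm_dn_rels V"
  "(\<Union>x y. dn_comm_identities Op x y) \<subseteq> comm_dn_rels V"
  unfolding comm_dn_rels_def dn_rels_def by (rule Un_upper2 | rule le_supI1)+

theorem dn_algebra_free_dn: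
  assumes "module K V"
  shows "dn_algebra K (free_dn K V) (free_dn_op K V)"
    and "free_dn_gen K V \<in> lin_hom K V (free_dn K V)"
proof -
  interpret module K V by fact
  show "dn_algebra K (free_dn K V) (free_dn_op K V)"
    unfolding free_dn_def free_dn_op_def
    by (intro dn_algebra.intro dn_algebra_axioms.intro op_module_presented R.is_cring)
      (rule dn_identities_presented[OF dn_rels_subset(1)])
  show "free_dn_gen K V \<in> lin_hom K V (free_dn K V)"
    using gen_lin_hom[OF assms, of "dn_rels V" UNIV]
    by (auto simp: free_dn_def free_dn_gen_def [abs_def] dn_rels_def)
qed

theorem free_dn_universal:
  assumes "module K V" "dn_algebra K A b" "f \<in> lin_hom K V A"
  shows "\<exists>h \<in> op_hom K UNIV (free_dn K V) (free_dn_op K V) A b.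
    \<forall>v\<in>carrier V. h (free_dn_gen K V v) = f v"
    and "\<lbrakk>h \<in> op_hom K UNIV (free_dn K V) (free_dn_op K V) A b;
      h' \<in> op_hom K UNIV (free_dn K V) (free_dn_op K V) A b;
      \<And>v. v \<in> carrier V \<Longrightarrow> h (free_dn_gen K V v) = h' (free_dn_gen K V v);
      x \<in> carrier (free_dn K V)\<rbrakk> \<Longrightarrow> h x = h' x"
proof -
  interpret dn_algebra K A b by fact
  have f: "f \<in> carrier V \<rightarrow> carrier A"
    using assms(3) by (simp add: lin_hom_def)
  have E: "leval A b f s = leval A b f t"
    if "(s, t) \<in> dn_rels V" "s \<in> lterms K UNIV (carrier V)" "t \<in> lterms K UNIV (carrier V)" for s t
    using that(1) unfolding dn_rels_def
  proof (elim UnE UN_E)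
    fix x y z assume st: "(s, t) \<in> dn_identities Add Op x y z"
    then show ?thesis
      using dn_identities_lterms[OF st that(2)] leval_closed[OF f]
      by (intro dn_identities[OF _ _ _ leval_dn_identities[OF st]])
  qed (use leval_gen_rels[OF assms(3) _ that(3)] in blast)
  show "\<exists>h \<in> op_hom K UNIV (free_dn K V) (free_dn_op K V) A b.
    \<forall>v\<in>carrier V. h (free_dn_gen K V v) = f v"
    using linduced_hom[OF f E] unfolding free_dn_def free_dn_op_def free_dn_gen_def by blast
  show "h x = h' x" if "h \<in> op_hom K UNIV (free_dn K V) (free_dn_op K V) A b"
    "h' \<in> op_hom K UNIV (free_dn K V) (free_dn_op K V) A b"
    "\<And>v. v \<in> carrier V \<Longrightarrow> h (free_dn_gen K V v) = h' (free_dn_gen K V v)"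
    "x \<in> carrier (free_dn K V)"
    using presented_hom_unique that unfolding free_dn_def free_dn_op_def free_dn_gen_def by blast
qed

theorem comm_dn_algebra_free_comm_dn:
  assumes "module K V"
  shows "comm_dn_algebra K (free_comm_dn K V) (free_comm_dn_op K V)"
    and "free_comm_dn_gen K V \<in> lin_hom K V (free_comm_dn K V)"
proof -
  interpret module K V by fact
  show "comm_dn_algebra K (free_comm_dn K V) (free_comm_dn_op K V)"
    unfolding free_comm_dn_def free_comm_dn_op_def
    by (intro comm_dn_algebra.intro dn_algebra.intro dn_algebra_axioms.intro
        comm_dn_algebra_axioms.intro op_module_presented R.is_cring)
      (rule dn_identities_presented[OF dn_rels_subset(2), rotated 3], assumption+,
       rule dn_comm_identities_presented[OF dn_rels_subset(3), rotated 2], assumption+)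
  show "free_comm_dn_gen K V \<in> lin_hom K V (free_comm_dn K V)"
    using gen_lin_hom[OF assms, of "comm_dn_rels V" UNIV]
    by (auto simp: free_comm_dn_def free_comm_dn_gen_def [abs_def] comm_dn_rels_def dn_rels_def)
qed

theorem free_comm_dn_universal:
  assumes "module K V" "comm_dn_algebra K A b" "f \<in> lin_hom K V A"
  shows "\<exists>h \<in> op_hom K UNIV (free_comm_dn K V) (free_comm_dn_op K V) A b.
    \<forall>v\<in>carrier V. h (free_comm_dn_gen K V v) = f v"
    and "\<lbrakk>h \<in> op_hom K UNIV (free_comm_dn K V) (free_comm_dn_op K V) A b;
      h' \<in> op_hom K UNIV (free_comm_dn K V) (free_comm_dn_op K V) A b;
      \<And>v. v \<in> carrier V \<Longrightarrow> h (free_comm_dn_gen K V v) = h' (free_comm_dn_gen K V v);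
      x \<in> carrier (free_comm_dn K V)\<rbrakk> \<Longrightarrow> h x = h' x"
proof -
  interpret comm_dn_algebra K A b by fact
  have f: "f \<in> carrier V \<rightarrow> carrier A"
    using assms(3) by (simp add: lin_hom_def)
  have E: "leval A b f s = leval A b f t"
    if "(s, t) \<in> comm_dn_rels V" "s \<in> lterms K UNIV (carrier V)" "t \<in> lterms K UNIV (carrier V)"
    for s t
    using that(1) unfolding comm_dn_rels_def dn_rels_def
  proof (elim UnE UN_E)
    fix x y z assume st: "(s, t) \<in> dn_identities Add Op x y z"
    then show ?thesis
      using dn_identities_lterms[OF st that(2)] leval_closed[OF f]
      by (intro dn_identities[OF _ _ _ leval_dn_identities[OF st]])
  next
    fix x y assume st: "(s, t) \<in> dn_comm_identities Op x y"
    then show ?thesis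
      using dn_comm_identities_lterms[OF st that(2)] leval_closed[OF f]
      by (intro dn_comm_identities[OF _ _ leval_dn_comm_identities[OF st]])
  qed (use leval_gen_rels[OF assms(3) _ that(3)] in blast)
  show "\<exists>h \<in> op_hom K UNIV (free_comm_dn K V) (free_comm_dn_op K V) A b.
    \<forall>v\<in>carrier V. h (free_comm_dn_gen K V v) = f v"
    using linduced_hom[OF f E]
    unfolding free_comm_dn_def free_comm_dn_op_def free_comm_dn_gen_def by blast
  show "h x = h' x" if "h \<in> op_hom K UNIV (free_comm_dn K V) (free_comm_dn_op K V) A b"
    "h' \<in> op_hom K UNIV (free_comm_dn K V) (free_comm_dn_op K V) A b"
    "\<And>v. v \<in> carrier V \<Longrightarrow> h (free_comm_dn_gen K V v) = h' (free_comm_dn_gen K V v)"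
    "x \<in> carrier (free_comm_dn K V)"
    using presented_hom_unique that
    unfolding free_comm_dn_def free_comm_dn_op_def free_comm_dn_gen_def by blast
qed

end

theory Submission
  imports Defs "HOL-Library.Multiset"
begin

text \<open>Let \<open>D\<close> be free and \<open>H\<close> its augmentation. With the unit action \<open>x \<nwarrow> 1 = x = 1 \<searrow> x\<close>
  (and \<open>0\<close> for all other operations), the rule \<open>(h \<otimes> h') p (k \<otimes> k') = hk \<otimes> (h' p k')\<close>, read as
  \<open>(u p u') \<otimes> 1\<close> on \<open>D \<otimes> 1\<close>, makes the augmentation ideal of \<open>H \<otimes> H\<close> a dendriform-Nijenhuis
  algebra, commutative if \<open>D\<close> is. By freeness, \<open>v \<mapsto> v \<otimes> 1 + 1 \<otimes> v\<close> extends to a homomorphism on \<open>D\<close>,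
  which is the coproduct. It satisfies \<open>\<Delta>(x p y) = (x p y) \<otimes> 1 + \<Delta> x p \<Delta> y\<close> for the operations
  extended by \<open>1 p 1 = 0\<close>. Multiplicativity, coassociativity, the counit laws and connectedness
  follow from this formula by induction along the generation of \<open>D\<close>.\<close>

section \<open>Linear and bilinear maps\<close>

text \<open>The obstacle is the pair of units: at \<open>x = 1\<close> the rules
  \<open>1 \<searrow> x = x\<close> and \<open>x \<searrow> 1 = 0\<close> contradict each other.
  This is why the operations live on the augmentation ideal only, and why
  \<open>D \<otimes> 1\<close>, where two units meet in the right factor, is split off and handled
  by hand. Elsewhere the left factors multiply associatively, so a relation in
  \<open>H \<otimes> H\<close> becomes the same relation between right factors with \<open>1\<close>
  in place of some arguments. Such a specialised relation either holds term by term or is one of the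
  two relations with the full sum of operations, in which the left factors of
  \<open>D \<otimes> 1\<close> add up to their product.

  The free algebra is a quotient of terms; neither a basis nor a grading is at hand. Statements
  about \<open>D\<close> are therefore proved by showing that the elements satisfying them form a
  subspace that contains the generators and is closed under the operations. For connectedness this
  requires the filtration to be compatible with each single operation, not only with the product.
  The antipode is obtained for an arbitrary connected bialgebra.\<close>

lemma lin_homI:
  assumes "\<And>x. x \<in> carrier M \<Longrightarrow> f x \<in> carrier N"
    and "\<And>x y. \<lbrakk>x \<in> carrier M; y \<in> carrier M\<rbrakk> \<Longrightarrow> f (x \<oplus>\<^bsub>M\<^esub> y) = f x \<oplus>\<^bsub>N\<^esub> f y"
    and "\<And>c x. \<lbrakk>c \<in> carrier K; x \<in> carrier M\<rbrakk> \<Longrightarrow> f (c \<odot>\<^bsub>M\<^esub> x) = c \<odot>\<^bsub>N\<^esub> f x"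
  shows "f \<in> lin_hom K M N"
  using assms by (auto simp: lin_hom_def)

lemma lin_homD:
  assumes "f \<in> lin_hom K M N"
  shows lin_hom_closed: "x \<in> carrier M \<Longrightarrow> f x \<in> carrier N"
    and lin_hom_add: "\<lbrakk>x \<in> carrier M; y \<in> carrier M\<rbrakk> \<Longrightarrow> f (x \<oplus>\<^bsub>M\<^esub> y) = f x \<oplus>\<^bsub>N\<^esub> f y"
    and lin_hom_smult: "\<lbrakk>c \<in> carrier K; x \<in> carrier M\<rbrakk> \<Longrightarrow> f (c \<odot>\<^bsub>M\<^esub> x) = c \<odot>\<^bsub>N\<^esub> f x"
  using assms by (auto simp: lin_hom_def)

lemma lin_hom_zero:
  assumes "module K M" "module K N" "f \<in> lin_hom K M N"
  shows "f \<zero>\<^bsub>M\<^esub> = \<zero>\<^bsub>N\<^esub>"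
proof -
  interpret M: module K M by fact
  interpret N: module K N by fact
  have "f (\<zero>\<^bsub>K\<^esub> \<odot>\<^bsub>M\<^esub> \<zero>\<^bsub>M\<^esub>) = \<zero>\<^bsub>K\<^esub> \<odot>\<^bsub>N\<^esub> f \<zero>\<^bsub>M\<^esub>"
    by (rule lin_hom_smult[OF assms(3)]) simp_all
  then show ?thesis
    using lin_hom_closed[OF assms(3) M.M.zero_closed] by simp
qed

lemma lin_hom_id: "(\<lambda>x. x) \<in> lin_hom K M M"
  by (rule lin_homI) simp_all

lemma lin_hom_comp:
  "\<lbrakk>g \<in> lin_hom K N P; f \<in> lin_hom K M N\<rbrakk> \<Longrightarrow> (\<lambda>x. g (f x)) \<in> lin_hom K M P"
  by (rule lin_homI) (simp_all add: lin_homD)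

lemma lin_hom_plus:
  assumes "module K N" "f \<in> lin_hom K M N" "g \<in> lin_hom K M N"
  shows "(\<lambda>x. f x \<oplus>\<^bsub>N\<^esub> g x) \<in> lin_hom K M N"
proof -
  interpret N: module K N by fact
  show ?thesis
    by (rule lin_homI)
      (simp_all add: assms(2,3)[THEN lin_hom_closed] assms(2,3)[THEN lin_hom_add]
        assms(2,3)[THEN lin_hom_smult] N.M.a_ac N.smult_r_distr)
qed

lemma lin_hom_scale:
  assumes "module K N" "f \<in> lin_hom K M N" "c \<in> carrier K"
  shows "(\<lambda>x. c \<odot>\<^bsub>N\<^esub> f x) \<in> lin_hom K M N"
proof -
  interpret N: module K N by fact
  show ?thesis
  proof (rule lin_homI)
    fix d x assume *: "d \<in> carrier K" "x \<in> carrier M"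
    then have "c \<odot>\<^bsub>N\<^esub> f (d \<odot>\<^bsub>M\<^esub> x) = (d \<otimes>\<^bsub>K\<^esub> c) \<odot>\<^bsub>N\<^esub> f x"
      using assms by (simp add: lin_homD N.R.m_comm flip: N.smult_assoc1)
    then show "c \<odot>\<^bsub>N\<^esub> f (d \<odot>\<^bsub>M\<^esub> x) = d \<odot>\<^bsub>N\<^esub> (c \<odot>\<^bsub>N\<^esub> f x)"
      using * assms by (simp add: lin_homD N.smult_assoc1)
  qed (use assms in \<open>simp_all add: lin_homD N.smult_r_distr\<close>)
qed

lemma lin_hom_smult_left:
  assumes "module K N" "x \<in> carrier N" "f \<in> lin_hom K M (ground_algebra K)"
  shows "(\<lambda>z. f z \<odot>\<^bsub>N\<^esub> x) \<in> lin_hom K M N"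
proof -
  interpret N: module K N by fact
  show ?thesis
    using assms(2) lin_homD[OF assms(3)]
    by (intro lin_homI) (simp_all add: ground_algebra_def N.smult_l_distr N.smult_assoc1)
qed

lemma lin_hom_zero_map:
  assumes "module K N"
  shows "(\<lambda>x. \<zero>\<^bsub>N\<^esub>) \<in> lin_hom K M N"
proof -
  interpret N: module K N by fact
  show ?thesis by (rule lin_homI) simp_all
qed

lemma lin_hom_uminus:
  assumes "module K N" "f \<in> lin_hom K M N"
  shows "(\<lambda>x. \<ominus>\<^bsub>N\<^esub> f x) \<in> lin_hom K M N"
proof -
  interpret N: module K N by fact
  show ?thesis
    by (rule lin_homI)
      (use assms in \<open>simp_all add: lin_homD N.M.minus_add N.smult_r_minus\<close>)
qed

lemma lin_hom_minus:
  assumes "module K N" "f \<in> lin_hom K M N" "g \<in> lin_hom K M N"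
  shows "(\<lambda>x. f x \<ominus>\<^bsub>N\<^esub> g x) \<in> lin_hom K M N"
  unfolding a_minus_def by (intro lin_hom_plus lin_hom_uminus assms)

text \<open>The curried form lets an identity between bilinear maps be tested on spanning elements
  one argument at a time: with the other argument fixed, both sides are members of
  \<open>lin_hom\<close>.\<close>

definition bilin ::
  "('k, 'm) ring_scheme \<Rightarrow> ('k, 'a, 'n) module_scheme \<Rightarrow> ('k, 'b, 'p) module_scheme \<Rightarrow>
   ('k, 'c, 'q) module_scheme \<Rightarrow> ('a \<Rightarrow> 'b \<Rightarrow> 'c) \<Rightarrow> bool"
  where "bilin K M N P f \<longleftrightarrow> (\<forall>x\<in>carrier M. f x \<in> lin_hom K N P) \<and>
    (\<forall>y\<in>carrier N. (\<lambda>x. f x y) \<in> lin_hom K M P)"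

lemma bilinI:
  assumes "\<And>x. x \<in> carrier M \<Longrightarrow> f x \<in> lin_hom K N P"
    and "\<And>y. y \<in> carrier N \<Longrightarrow> (\<lambda>x. f x y) \<in> lin_hom K M P"
  shows "bilin K M N P f"
  using assms by (simp add: bilin_def)

lemma bilinD:
  assumes "bilin K M N P f"
  shows "x \<in> carrier M \<Longrightarrow> f x \<in> lin_hom K N P"
    and "y \<in> carrier N \<Longrightarrow> (\<lambda>x. f x y) \<in> lin_hom K M P"
  using assms by (simp_all add: bilin_def)

lemma bilin_right: "\<lbrakk>bilin K M N P f; x \<in> carrier M; g \<in> lin_hom K X N\<rbrakk> \<Longrightarrow>
    (\<lambda>y. f x (g y)) \<in> lin_hom K X P"
  and bilin_left: "\<lbrakk>bilin K M N P f; y \<in> carrier N; h \<in> lin_hom K X M\<rbrakk> \<Longrightarrow>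
    (\<lambda>x. f (h x) y) \<in> lin_hom K X P"
  using lin_hom_comp[OF bilinD(1)] lin_hom_comp[OF bilinD(2)] by fast+

lemma bilin_comp:
  assumes "bilin K M N P f" "g \<in> lin_hom K M' M" "h \<in> lin_hom K N' N"
  shows "bilin K M' N' P (\<lambda>x y. f (g x) (h y))"
  using assms by (intro bilinI bilin_right[OF assms(1)] bilin_left[OF assms(1)]) (auto intro: lin_hom_closed)

lemma bilin_post:
  assumes "bilin K M N P f" "g \<in> lin_hom K P Q"
  shows "bilin K M N Q (\<lambda>x y. g (f x y))"
  using assms by (intro bilinI lin_hom_comp[OF assms(2)]) (auto intro: bilinD)

lemma bilin_simps:
  assumes "bilin K M N P f"
  shows bilin_closed: "\<lbrakk>x \<in> carrier M; y \<in> carrier N\<rbrakk> \<Longrightarrow> f x y \<in> carrier P"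
    and bilin_add_left: "\<lbrakk>x \<in> carrier M; x' \<in> carrier M; y \<in> carrier N\<rbrakk> \<Longrightarrow>
      f (x \<oplus>\<^bsub>M\<^esub> x') y = f x y \<oplus>\<^bsub>P\<^esub> f x' y"
    and bilin_add_right: "\<lbrakk>x \<in> carrier M; y \<in> carrier N; y' \<in> carrier N\<rbrakk> \<Longrightarrow>
      f x (y \<oplus>\<^bsub>N\<^esub> y') = f x y \<oplus>\<^bsub>P\<^esub> f x y'"
    and bilin_smult_left: "\<lbrakk>c \<in> carrier K; x \<in> carrier M; y \<in> carrier N\<rbrakk> \<Longrightarrow>
      f (c \<odot>\<^bsub>M\<^esub> x) y = c \<odot>\<^bsub>P\<^esub> f x y"
    and bilin_smult_right: "\<lbrakk>c \<in> carrier K; x \<in> carrier M; y \<in> carrier N\<rbrakk> \<Longrightarrow>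
      f x (c \<odot>\<^bsub>N\<^esub> y) = c \<odot>\<^bsub>P\<^esub> f x y"
  using assms by (auto simp: bilin_def lin_hom_def)

lemma bilin_zero:
  assumes "bilin K M N P f" "module K M" "module K N" "module K P"
  shows bilin_zero_left: "y \<in> carrier N \<Longrightarrow> f \<zero>\<^bsub>M\<^esub> y = \<zero>\<^bsub>P\<^esub>"
    and bilin_zero_right: "x \<in> carrier M \<Longrightarrow> f x \<zero>\<^bsub>N\<^esub> = \<zero>\<^bsub>P\<^esub>"
  using lin_hom_zero[OF assms(2,4) bilinD(2)[OF assms(1)]]
    lin_hom_zero[OF assms(3,4) bilinD(1)[OF assms(1)]] by auto

lemma bilin_plus:
  assumes "module K P" "bilin K M N P f" "bilin K M N P g"
  shows "bilin K M N P (\<lambda>x y. f x y \<oplus>\<^bsub>P\<^esub> g x y)"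
  using assms by (intro bilinI lin_hom_plus) (auto intro: bilinD)

lemma bilin_smult:
  assumes "module K P"
  shows "bilin K (ground_algebra K) P P (\<lambda>c x. c \<odot>\<^bsub>P\<^esub> x)"
proof (intro bilinI)
  show "(\<odot>\<^bsub>P\<^esub>) c \<in> lin_hom K P P" if "c \<in> carrier (ground_algebra K)" for c
    using lin_hom_scale[OF assms lin_hom_id] that by (simp add: ground_algebra_def)
qed (intro lin_hom_smult_left assms lin_hom_id)

lemma submoduleD:
  assumes "submodule W K M"
  shows "W \<subseteq> carrier M" "\<zero>\<^bsub>M\<^esub> \<in> W"
    and "\<lbrakk>x \<in> W; y \<in> W\<rbrakk> \<Longrightarrow> x \<oplus>\<^bsub>M\<^esub> y \<in> W" "\<lbrakk>c \<in> carrier K; x \<in> W\<rbrakk> \<Longrightarrow> c \<odot>\<^bsub>M\<^esub> x \<in> W"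
    and "x \<in> W \<Longrightarrow> \<ominus>\<^bsub>M\<^esub> x \<in> W"
proof -
  interpret submodule W K M by fact
  show "W \<subseteq> carrier M" "\<zero>\<^bsub>M\<^esub> \<in> W"
    "\<lbrakk>x \<in> W; y \<in> W\<rbrakk> \<Longrightarrow> x \<oplus>\<^bsub>M\<^esub> y \<in> W" "\<lbrakk>c \<in> carrier K; x \<in> W\<rbrakk> \<Longrightarrow> c \<odot>\<^bsub>M\<^esub> x \<in> W"
    using subset one_closed m_closed by auto
  show "x \<in> W \<Longrightarrow> \<ominus>\<^bsub>M\<^esub> x \<in> W"
    using m_inv_closed by (simp add: a_inv_def)
qed

lemma submoduleI':
  assumes "module K M" "W \<subseteq> carrier M" "\<zero>\<^bsub>M\<^esub> \<in> W"
    and "\<And>x y. \<lbrakk>x \<in> W; y \<in> W\<rbrakk> \<Longrightarrow> x \<oplus>\<^bsub>M\<^esub> y \<in> W"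
    and smult: "\<And>c x. \<lbrakk>c \<in> carrier K; x \<in> W\<rbrakk> \<Longrightarrow> c \<odot>\<^bsub>M\<^esub> x \<in> W"
  shows "submodule W K M"
proof -
  interpret module K M by fact
  have "\<ominus>\<^bsub>M\<^esub> x \<in> W" if "x \<in> W" for x
    using smult[of "\<ominus>\<^bsub>K\<^esub> \<one>\<^bsub>K\<^esub>" x] that assms(2) by (simp add: smult_l_minus subsetD)
  then show ?thesis
    by (intro submoduleI assms)
qed


section \<open>Tensor products\<close>

lemma module_tensor:
  assumes "cring K"
  shows "module K (tensor K M N)"
  using op_module_presented[OF assms] unfolding tensor_def op_module_def by blast

lemma bilin_tens:
  assumes "module K M" "module K N"
  shows "bilin K M N (tensor K M N) (tens K M N)"
proof -
  interpret M: module K M by fact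
  interpret N: module K N by fact
  show ?thesis
    unfolding bilin_def lin_hom_def tens_def tensor_def
    by (auto simp: presented_simps intro!: lclass_eqI lcong.rel) (auto simp: tensor_rels_def)
qed

text \<open>There is no case for scalar multiples, because a scalar can be moved into the left
  factor of each pure tensor.\<close>

lemma tensor_induct [consumes 3, case_names tens add]:
  assumes "module K M" "module K N" "w \<in> carrier (tensor K M N)"
    and tens: "\<And>x y. \<lbrakk>x \<in> carrier M; y \<in> carrier N\<rbrakk> \<Longrightarrow> P (tens K M N x y)"
    and add: "\<And>w w'. \<lbrakk>w \<in> carrier (tensor K M N); w' \<in> carrier (tensor K M N); P w; P w'\<rbrakk> \<Longrightarrow>
      P (w \<oplus>\<^bsub>tensor K M N\<^esub> w')"
  shows "P w"
proof -
  interpret M: module K M by fact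
  interpret N: module K N by fact
  interpret T: module K "tensor K M N"
    by (rule module_tensor) (rule M.R.is_cring)
  note bt = bilin_tens[OF assms(1,2)]
  let ?cl = "lclass K {} (carrier M \<times> carrier N) (tensor_rels M N)"
  have eq: "?cl Zero = \<zero>\<^bsub>tensor K M N\<^esub>"
      "\<lbrakk>s \<in> lterms K {} (carrier M \<times> carrier N); t \<in> lterms K {} (carrier M \<times> carrier N)\<rbrakk> \<Longrightarrow>
         ?cl (Add s t) = ?cl s \<oplus>\<^bsub>tensor K M N\<^esub> ?cl t"
      "\<lbrakk>c \<in> carrier K; t \<in> lterms K {} (carrier M \<times> carrier N)\<rbrakk> \<Longrightarrow>
         ?cl (Smul c t) = c \<odot>\<^bsub>tensor K M N\<^esub> ?cl t"
      "t \<in> lterms K {} (carrier M \<times> carrier N) \<Longrightarrow> ?cl t \<in> carrier (tensor K M N)" for s t c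
    unfolding tensor_def by (simp_all add: presented_simps)
  have zero: "P \<zero>\<^bsub>tensor K M N\<^esub>"
    using tens[of "\<zero>\<^bsub>M\<^esub>" "\<zero>\<^bsub>N\<^esub>"] bilin_zero_left[OF bt] assms(1,2) T.module_axioms by simp
  \<comment> \<open>The quantified scalar absorbs \<open>Smul\<close>: it is passed down to the
    generators and swallowed there by bilinearity.\<close>
  have "\<forall>c\<in>carrier K. P (c \<odot>\<^bsub>tensor K M N\<^esub> ?cl t)"
    if "t \<in> lterms K {} (carrier M \<times> carrier N)" for t
    using that
  proof induction
    case (Gen g)
    then obtain x y where g: "g = (x, y)" "x \<in> carrier M" "y \<in> carrier N" by auto
    have "c \<odot>\<^bsub>tensor K M N\<^esub> ?cl (Gen g) = tens K M N (c \<odot>\<^bsub>M\<^esub> x) y" if "c \<in> carrier K" for c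
      using bilin_smult_left[OF bt that g(2,3)] by (simp add: g tens_def)
    then show ?case using tens g by simp
  next
    case Zero
    then show ?case by (simp add: eq zero)
  next
    case (Add s t)
    then show ?case by (auto simp: eq T.smult_r_distr intro!: add)
  next
    case (Smul c t)
    show ?case
    proof
      fix d assume d: "d \<in> carrier K"
      then have "d \<odot>\<^bsub>tensor K M N\<^esub> ?cl (Smul c t) = (d \<otimes>\<^bsub>K\<^esub> c) \<odot>\<^bsub>tensor K M N\<^esub> ?cl t"
        using Smul.hyps by (simp add: eq T.smult_assoc1)
      then show "P (d \<odot>\<^bsub>tensor K M N\<^esub> ?cl (Smul c t))"
        using Smul d by simp
    qed
  qed auto
  moreover obtain t where t: "t \<in> lterms K {} (carrier M \<times> carrier N)" "w = ?cl t"
    using assms(3) by (auto simp: tensor_def presented_carrier)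
  ultimately have "P (\<one>\<^bsub>K\<^esub> \<odot>\<^bsub>tensor K M N\<^esub> w)" by simp
  then show ?thesis using assms(3) by simp
qed

lemma tensor_ext:
  assumes "module K M" "module K N"
    and f: "f \<in> lin_hom K (tensor K M N) P" and g: "g \<in> lin_hom K (tensor K M N) P"
    and eq: "\<And>x y. \<lbrakk>x \<in> carrier M; y \<in> carrier N\<rbrakk> \<Longrightarrow> f (tens K M N x y) = g (tens K M N x y)"
    and "w \<in> carrier (tensor K M N)"
  shows "f w = g w"
  using assms(1,2,6)
  by (induction rule: tensor_induct) (simp_all add: eq lin_hom_add[OF f] lin_hom_add[OF g])

lemma
  assumes "module K P" "bilin K M N P f"
  shows tensor_lift_lin: "tensor_lift P f \<in> lin_hom K (tensor K M N) P"
    and tensor_lift_tens: "\<lbrakk>x \<in> carrier M; y \<in> carrier N\<rbrakk> \<Longrightarrow> tensor_lift P f (tens K M N x y) = f x y"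
  by (rule tensor_lift(1)[OF assms(1)]; simp add: bilin_simps[OF assms(2)])
    (rule tensor_lift(2)[OF assms(1)]; simp add: bilin_simps[OF assms(2)])

text \<open>Two linear maps on a tensor product agree once they agree on pure tensors, so the lift
  inherits linearity in the parameter from its values there. This makes nested lifts
  bilinear.\<close>

lemma tensor_lift_param:
  assumes mods: "module K M" "module K N" "module K P" "module K Z"
    and F: "\<And>z. z \<in> carrier Z \<Longrightarrow> bilin K M N P (F z)"
    and Z: "\<And>x y. \<lbrakk>x \<in> carrier M; y \<in> carrier N\<rbrakk> \<Longrightarrow> (\<lambda>z. F z x y) \<in> lin_hom K Z P"
    and t: "t \<in> carrier (tensor K M N)"
  shows "(\<lambda>z. tensor_lift P (F z) t) \<in> lin_hom K Z P"
proof (rule lin_homI)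
  interpret Z: module K Z by fact
  note lift = tensor_lift_lin[OF mods(3) F] tensor_lift_tens[OF mods(3) F]
  show "tensor_lift P (F z) t \<in> carrier P" if "z \<in> carrier Z" for z
    using lin_hom_closed[OF lift(1)] that t by simp
  show "tensor_lift P (F (z \<oplus>\<^bsub>Z\<^esub> z')) t = tensor_lift P (F z) t \<oplus>\<^bsub>P\<^esub> tensor_lift P (F z') t"
    if "z \<in> carrier Z" "z' \<in> carrier Z" for z z'
    by (rule tensor_ext[OF mods(1,2) _ _ _ t])
      (use that in \<open>auto simp: lift lin_hom_add[OF Z] intro!: lin_hom_plus mods lift\<close>)
  show "tensor_lift P (F (c \<odot>\<^bsub>Z\<^esub> z)) t = c \<odot>\<^bsub>P\<^esub> tensor_lift P (F z) t"
    if "c \<in> carrier K" "z \<in> carrier Z" for c z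
    by (rule tensor_ext[OF mods(1,2) _ _ _ t])
      (use that in \<open>auto simp: lift lin_hom_smult[OF Z] intro!: lin_hom_scale mods lift\<close>)
qed

text \<open>The order of nesting is that of the product of \<open>tensor_algebra\<close>, which
  thereby becomes an instance, as do the operations \<open>opT\<close> and
  \<open>op3\<close>.\<close>

definition tensor_lift2 ::
  "('k, 'c, 'p) module_scheme \<Rightarrow> ('a \<Rightarrow> 'b \<Rightarrow> 'd \<Rightarrow> 'e \<Rightarrow> 'c) \<Rightarrow>
   ('k, unit, 'a \<times> 'b) lterm set \<Rightarrow> ('k, unit, 'd \<times> 'e) lterm set \<Rightarrow> 'c"
  where "tensor_lift2 P F s t = tensor_lift P (\<lambda>x y. tensor_lift P (\<lambda>x' y'. F x y x' y') t) s"

lemma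
  assumes mods: "module K M" "module K N" "module K M'" "module K N'" "module K P"
    and F: "\<And>x y. \<lbrakk>x \<in> carrier M; y \<in> carrier N\<rbrakk> \<Longrightarrow> bilin K M' N' P (F x y)"
    and F': "\<And>x' y'. \<lbrakk>x' \<in> carrier M'; y' \<in> carrier N'\<rbrakk> \<Longrightarrow> bilin K M N P (\<lambda>x y. F x y x' y')"
  shows bilin_tensor_lift2: "bilin K (tensor K M N) (tensor K M' N') P (tensor_lift2 P F)"
    and tensor_lift2_tens: "\<lbrakk>x \<in> carrier M; y \<in> carrier N; x' \<in> carrier M'; y' \<in> carrier N'\<rbrakk> \<Longrightarrow>
      tensor_lift2 P F (tens K M N x y) (tens K M' N' x' y') = F x y x' y'"
proof -
  interpret module K P by fact
  have G: "bilin K M N P (\<lambda>x y. tensor_lift P (F x y) t)" if "t \<in> carrier (tensor K M' N')" for t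
  proof (rule bilinI)
    show "(\<lambda>y. tensor_lift P (F x y) t) \<in> lin_hom K N P" if "x \<in> carrier M" for x
      using that by (intro tensor_lift_param[OF mods(3-5,2) _ _ \<open>t \<in> _\<close>] F bilinD(1)[OF F'])
    show "(\<lambda>x. tensor_lift P (F x y) t) \<in> lin_hom K M P" if "y \<in> carrier N" for y
      using that by (intro tensor_lift_param[OF mods(3-5,1) _ _ \<open>t \<in> _\<close>] F bilinD(2)[OF F'])
  qed
  note G' = tensor_lift_lin[OF mods(5) G] tensor_lift_tens[OF mods(5) G]
    tensor_lift_lin[OF mods(5) F] tensor_lift_tens[OF mods(5) F]
  show "bilin K (tensor K M N) (tensor K M' N') P (tensor_lift2 P F)"
    unfolding tensor_lift2_def
    by (rule bilinI)
      (intro G' tensor_lift_param[OF mods(1,2,5) module_tensor[OF R.is_cring]] G | assumption)+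
  show "tensor_lift2 P F (tens K M N x y) (tens K M' N' x' y') = F x y x' y'"
    if "x \<in> carrier M" "y \<in> carrier N" "x' \<in> carrier M'" "y' \<in> carrier N'"
    using that bilin_closed[OF bilin_tens[OF mods(3,4)]] by (simp add: tensor_lift2_def G')
qed

lemma
  assumes "module K M" "module K N" "module K M'" "module K N'"
    and f: "f \<in> lin_hom K M M'" and g: "g \<in> lin_hom K N N'"
  shows tensor_map_lin: "tensor_map K M' N' f g \<in> lin_hom K (tensor K M N) (tensor K M' N')"
    and tensor_map_tens: "\<lbrakk>x \<in> carrier M; y \<in> carrier N\<rbrakk> \<Longrightarrow>
      tensor_map K M' N' f g (tens K M N x y) = tens K M' N' (f x) (g y)"
proof -
  interpret module K M by fact
  note * = module_tensor[OF R.is_cring] bilin_comp[OF bilin_tens[OF assms(3,4)] f g]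
  show "tensor_map K M' N' f g \<in> lin_hom K (tensor K M N) (tensor K M' N')"
    unfolding tensor_map_def by (rule tensor_lift_lin[OF *])
  show "\<lbrakk>x \<in> carrier M; y \<in> carrier N\<rbrakk> \<Longrightarrow>
      tensor_map K M' N' f g (tens K M N x y) = tens K M' N' (f x) (g y)"
    unfolding tensor_map_def by (rule tensor_lift_tens[OF *])
qed

lemma
  assumes mods: "module K L" "module K M" "module K N"
  shows tensor_assoc_lin: "tensor_assoc K L M N \<in>
      lin_hom K (tensor K (tensor K L M) N) (tensor K L (tensor K M N))"
    and tensor_assoc_tens: "\<lbrakk>x \<in> carrier L; y \<in> carrier M; z \<in> carrier N\<rbrakk> \<Longrightarrow>
      tensor_assoc K L M N (tens K (tensor K L M) N (tens K L M x y) z) =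
      tens K L (tensor K M N) x (tens K M N y z)"
proof -
  interpret module K L by fact
  note mt = module_tensor[OF R.is_cring]
  note bt = bilin_tens[OF mods(1) mt] bilin_tens[OF mods(2,3)]
  have 1: "bilin K L M (tensor K L (tensor K M N))
    (\<lambda>x y. tens K L (tensor K M N) x (tens K M N y z))" if "z \<in> carrier N" for z
    using that by (intro bilin_comp[OF bt(1)] lin_hom_id bilinD[OF bt(2)])
  have 2: "(\<lambda>z. tens K L (tensor K M N) x (tens K M N y z)) \<in> lin_hom K N (tensor K L (tensor K M N))"
    if "x \<in> carrier L" "y \<in> carrier M" for x y
    using that by (intro bilin_right[OF bt(1)] bilinD[OF bt(2)])
  have 3: "bilin K (tensor K L M) N (tensor K L (tensor K M N))
      (\<lambda>w z. tensor_lift (tensor K L (tensor K M N))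
        (\<lambda>x y. tens K L (tensor K M N) x (tens K M N y z)) w)"
    by (rule bilinI) (intro tensor_lift_param[OF mods(1,2) mt mods(3)] tensor_lift_lin[OF mt] 1 2 | assumption)+
  show "tensor_assoc K L M N \<in>
      lin_hom K (tensor K (tensor K L M) N) (tensor K L (tensor K M N))"
    unfolding tensor_assoc_def by (intro tensor_lift_lin mt 3)
  show "tensor_assoc K L M N (tens K (tensor K L M) N (tens K L M x y) z) =
      tens K L (tensor K M N) x (tens K M N y z)"
    if "x \<in> carrier L" "y \<in> carrier M" "z \<in> carrier N"
    unfolding tensor_assoc_def
    using that bilin_closed[OF bilin_tens[OF mods(1,2)] that(1,2)]
    by (simp add: tensor_lift_tens[OF mt 3] tensor_lift_tens[OF mt 1])
qed

lemma
  assumes "module K H" "A \<subseteq> carrier H"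
  shows tensor_square_submodule: "submodule (tensor_square K H A) K (tensor K H H)"
    and tens_in_tensor_square: "\<lbrakk>x \<in> A; y \<in> A\<rbrakk> \<Longrightarrow> tens K H H x y \<in> tensor_square K H A"
    and tensor_square_least: "\<lbrakk>submodule W K (tensor K H H);
      \<And>x y. \<lbrakk>x \<in> A; y \<in> A\<rbrakk> \<Longrightarrow> tens K H H x y \<in> W\<rbrakk> \<Longrightarrow> tensor_square K H A \<subseteq> W"
proof -
  interpret module K H by fact
  interpret T: module K "tensor K H H" by (rule module_tensor) (rule R.is_cring)
  let ?\<F> = "{W. submodule W K (tensor K H H) \<and> {tens K H H x y | x y. x \<in> A \<and> y \<in> A} \<subseteq> W}"
  have sq: "tensor_square K H A = \<Inter>?\<F>"
    by (simp add: tensor_square_def hull_def)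
  have "tens K H H x y \<in> carrier (tensor K H H)" if "x \<in> A" "y \<in> A" for x y
    using that assms by (intro bilin_closed[OF bilin_tens]) auto
  \<comment> \<open>The family is nonempty, so its intersection stays inside the carrier.\<close>
  then have "carrier (tensor K H H) \<in> ?\<F>"
    using T.carrier_is_submodule by auto
  then have sub: "\<Inter>?\<F> \<subseteq> carrier (tensor K H H)"
    by (rule Inter_lower)
  show "submodule (tensor_square K H A) K (tensor K H H)"
    unfolding sq by (intro submoduleI' T.module_axioms sub InterI) (auto intro: submoduleD)
  show "\<lbrakk>x \<in> A; y \<in> A\<rbrakk> \<Longrightarrow> tens K H H x y \<in> tensor_square K H A"
    unfolding sq by blast
  show "\<lbrakk>submodule W K (tensor K H H); \<And>x y. \<lbrakk>x \<in> A; y \<in> A\<rbrakk> \<Longrightarrow> tens K H H x y \<in> W\<rbrakk> \<Longrightarrow>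
      tensor_square K H A \<subseteq> W"
    unfolding sq by (intro Inter_lower) auto
qed

lemma lin_hom_preimage_submodule:
  assumes "module K M" "module K N" "f \<in> lin_hom K M N" "submodule W K N"
  shows "submodule {x \<in> carrier M. f x \<in> W} K M"
proof -
  interpret M: module K M by fact
  show ?thesis
    by (intro submoduleI' assms(1))
      (auto simp: lin_hom_zero[OF assms(1-3)] lin_homD[OF assms(3)] submoduleD[OF assms(4)])
qed

section \<open>Antipodes of connected bialgebras\<close>

lemma (in abelian_group)
  assumes "a \<in> carrier G" "b \<in> carrier G" "d \<in> carrier G"
  shows add_diff_diff: "a \<oplus> b \<oplus> (d \<ominus> a \<ominus> b) = d"
    and diff_diff_add: "a \<oplus> b \<oplus> d \<ominus> a \<ominus> b = d"
proof -
  have *: "x \<ominus> a \<ominus> b = \<ominus> (a \<oplus> b) \<oplus> x" if "x \<in> carrier G" for x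
    using assms that by (simp add: a_minus_def minus_add a_ac)
  show "a \<oplus> b \<oplus> (d \<ominus> a \<ominus> b) = d" "a \<oplus> b \<oplus> d \<ominus> a \<ominus> b = d"
    using assms by (simp_all add: * r_neg1 r_neg2)
qed

lemma (in unital_algebra) bilin_mult: "bilin K H H H (\<otimes>)"
  by (intro bilinI lin_homI) (simp_all add: l_distr r_distr smult_mult_left smult_mult_right)

lemma tensor_algebra_simps [simp]:
  "carrier (tensor_algebra K H) = carrier (tensor K H H)"
  "\<one>\<^bsub>tensor_algebra K H\<^esub> = tens K H H \<one>\<^bsub>H\<^esub> \<one>\<^bsub>H\<^esub>"
  "s \<otimes>\<^bsub>tensor_algebra K H\<^esub> t =
    tensor_lift2 (tensor K H H) (\<lambda>x y x' y'. tens K H H (x \<otimes>\<^bsub>H\<^esub> x') (y \<otimes>\<^bsub>H\<^esub> y')) s t"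
  "s \<oplus>\<^bsub>tensor_algebra K H\<^esub> t = s \<oplus>\<^bsub>tensor K H H\<^esub> t"
  "\<zero>\<^bsub>tensor_algebra K H\<^esub> = \<zero>\<^bsub>tensor K H H\<^esub>"
  "c \<odot>\<^bsub>tensor_algebra K H\<^esub> s = c \<odot>\<^bsub>tensor K H H\<^esub> s"
  by (simp_all add: tensor_algebra_def tensor_lift2_def)

lemma ground_algebra_simps [simp]:
  "carrier (ground_algebra K) = carrier K"
  "\<one>\<^bsub>ground_algebra K\<^esub> = \<one>\<^bsub>K\<^esub>"
  "c \<otimes>\<^bsub>ground_algebra K\<^esub> d = c \<otimes>\<^bsub>K\<^esub> d"
  "c \<oplus>\<^bsub>ground_algebra K\<^esub> d = c \<oplus>\<^bsub>K\<^esub> d"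
  "c \<odot>\<^bsub>ground_algebra K\<^esub> d = c \<otimes>\<^bsub>K\<^esub> d"
  by (simp_all add: ground_algebra_def)

context bialgebra
begin

lemma module_H: "module K H" ..

lemma module_HH: "module K (tensor K H H)"
  by (rule module_tensor) (rule R.is_cring)

sublocale T: module K "tensor K H H"
  by (rule module_HH)

lemmas bilin_tens_HH = bilin_tens[OF module_H module_H]

lemma comult_lin: "\<Delta> \<in> lin_hom K H (tensor K H H)"
  using comult_hom by (simp add: algebra_hom_def lin_hom_def)

lemma counit_lin: "\<kappa> \<in> lin_hom K H (ground_algebra K)"
  using counit_hom by (simp add: algebra_hom_def)

lemma comult_one: "\<Delta> \<one> = tens K H H \<one> \<one>"
  using comult_hom by (simp add: algebra_hom_def ring_hom_def)

lemma counit_one: "\<kappa> \<one> = \<one>\<^bsub>K\<^esub>"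
  using counit_hom by (simp add: algebra_hom_def ring_hom_def)

lemma counit_closed: "x \<in> carrier H \<Longrightarrow> \<kappa> x \<in> carrier K"
  using lin_hom_closed[OF counit_lin] by simp

definition unit_counit :: "'h \<Rightarrow> 'h"
  where "unit_counit x = \<kappa> x \<odot> \<one>"

definition pairing :: "('h \<Rightarrow> 'h) \<Rightarrow> ('h \<Rightarrow> 'h) \<Rightarrow> ('k, unit, 'h \<times> 'h) lterm set \<Rightarrow> 'h"
  where "pairing f g = tensor_lift H (\<lambda>y z. f y \<otimes> g z)"

definition conv :: "('h \<Rightarrow> 'h) \<Rightarrow> ('h \<Rightarrow> 'h) \<Rightarrow> 'h \<Rightarrow> 'h"
  where "conv f g x = pairing f g (\<Delta> x)"

lemma unit_counit_lin: "unit_counit \<in> lin_hom K H H"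
  using lin_hom_smult_left[OF module_H one_closed counit_lin] by (simp add: unit_counit_def [abs_def])

context
  fixes f g assumes f: "f \<in> lin_hom K H H" and g: "g \<in> lin_hom K H H"
begin

lemma bilin_pair: "bilin K H H H (\<lambda>y z. f y \<otimes> g z)"
  by (rule bilin_comp[OF bilin_mult f g])

lemma pair_lin: "pairing f g \<in> lin_hom K (tensor K H H) H"
  unfolding pairing_def by (rule tensor_lift_lin[OF module_H bilin_pair])

lemma pair_tens: "\<lbrakk>x \<in> carrier H; y \<in> carrier H\<rbrakk> \<Longrightarrow>
    pairing f g (tens K H H x y) = f x \<otimes> g y"
  unfolding pairing_def by (rule tensor_lift_tens[OF module_H bilin_pair])

lemma conv_lin: "conv f g \<in> lin_hom K H H"
  unfolding conv_def [abs_def] by (rule lin_hom_comp[OF pair_lin comult_lin])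

end

lemmas comult_closed = lin_hom_closed[OF comult_lin]

lemma conv_cong:
  assumes "f \<in> lin_hom K H H" "f' \<in> lin_hom K H H" "g \<in> lin_hom K H H" "g' \<in> lin_hom K H H"
    and "\<And>x. x \<in> carrier H \<Longrightarrow> f x = f' x" "\<And>x. x \<in> carrier H \<Longrightarrow> g x = g' x"
    and "x \<in> carrier H"
  shows "conv f g x = conv f' g' x"
  unfolding conv_def
  by (rule tensor_ext[where P = H, OF module_H module_H])
    (use assms in \<open>auto intro!: pair_lin comult_closed simp: pair_tens\<close>)

text \<open>Both sides are the linear map \<open>x \<otimes> (y \<otimes> z) \<mapsto> f x \<otimes>
  (g y \<otimes> h z)\<close>, with products of \<open>H\<close> on the right, applied to the two
  iterated coproducts of \<open>x\<close>. Coassociativity identifies these.\<close>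

lemma conv_assoc:
  assumes f: "f \<in> lin_hom K H H" and g: "g \<in> lin_hom K H H" and h: "h \<in> lin_hom K H H"
    and x: "x \<in> carrier H"
  shows "conv (conv f g) h x = conv f (conv g h) x"
proof -
  note closed = f[THEN lin_hom_closed] g[THEN lin_hom_closed] h[THEN lin_hom_closed]
    bilin_closed[OF bilin_tens_HH]
  let ?fg = "pairing f g" and ?gh = "pairing g h"
  let ?t = "tensor_lift H (\<lambda>x w. f x \<otimes> ?gh w)"
  have b: "bilin K H (tensor K H H) H (\<lambda>x w. f x \<otimes> ?gh w)"
    by (rule bilin_comp[OF bilin_mult f pair_lin[OF g h]])
  note t = tensor_lift_lin[OF module_H b] tensor_lift_tens[OF module_H b]
  note dx = comult_closed[OF x]
  have "?t (tensor_map K H (tensor K H H) id \<Delta> w) = pairing f (conv g h) w"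
    if "w \<in> carrier (tensor K H H)" for w
  proof (rule tensor_ext[where P = H, OF module_H module_H _ _ _ that])
    show "(\<lambda>w. ?t (tensor_map K H (tensor K H H) id \<Delta> w)) \<in> lin_hom K (tensor K H H) H"
      by (intro lin_hom_comp[OF t(1)] tensor_map_lin module_H module_HH comult_lin)
        (simp add: id_def lin_hom_id)
    show "pairing f (conv g h) \<in> lin_hom K (tensor K H H) H"
      by (intro pair_lin conv_lin f g h)
    show "?t (tensor_map K H (tensor K H H) id \<Delta> (tens K H H y z)) =
        pairing f (conv g h) (tens K H H y z)"
      if "y \<in> carrier H" "z \<in> carrier H" for y z
      using that
      by (simp add: pair_tens f g h conv_lin t comult_closed conv_def
          tensor_map_tens[OF module_H module_H module_H module_HH lin_hom_id comult_lin] id_def)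
  qed
  then have 1: "?t (tensor_map K H (tensor K H H) id \<Delta> (\<Delta> x)) = conv f (conv g h) x"
    using dx by (simp add: conv_def)
  have 2: "?t (tensor_assoc K H H H (tens K (tensor K H H) H v z)) = ?fg v \<otimes> h z"
    if "v \<in> carrier (tensor K H H)" and z: "z \<in> carrier H" for v z
  proof (rule tensor_ext[where P = H, OF module_H module_H _ _ _ that(1)])
    show "(\<lambda>v. ?t (tensor_assoc K H H H (tens K (tensor K H H) H v z))) \<in> lin_hom K (tensor K H H) H"
      by (rule lin_hom_comp[OF t(1) lin_hom_comp[OF tensor_assoc_lin[OF module_H module_H module_H]
        bilinD(2)[OF bilin_tens[OF module_HH module_H] z]]])
    show "(\<lambda>v. ?fg v \<otimes> h z) \<in> lin_hom K (tensor K H H) H"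
      by (intro bilin_left[OF bilin_mult] pair_lin f g lin_hom_closed[OF h z])
  qed (use z in \<open>simp add: tensor_assoc_tens module_H pair_tens f g h t closed m_assoc\<close>)
  have "?t (tensor_assoc K H H H (tensor_map K (tensor K H H) H \<Delta> id w)) =
      pairing (conv f g) h w"
    if "w \<in> carrier (tensor K H H)" for w
  proof (rule tensor_ext[where P = H, OF module_H module_H _ _ _ that])
    show "(\<lambda>w. ?t (tensor_assoc K H H H (tensor_map K (tensor K H H) H \<Delta> id w)))
        \<in> lin_hom K (tensor K H H) H"
      by (intro lin_hom_comp[OF t(1)] lin_hom_comp[OF tensor_assoc_lin] tensor_map_lin
          module_H module_HH comult_lin) (simp add: id_def lin_hom_id)
    show "pairing (conv f g) h \<in> lin_hom K (tensor K H H) H"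
      by (intro pair_lin conv_lin f g h)
    show "?t (tensor_assoc K H H H (tensor_map K (tensor K H H) H \<Delta> id (tens K H H y z))) =
        pairing (conv f g) h (tens K H H y z)"
      if "y \<in> carrier H" "z \<in> carrier H" for y z
      using that
      by (simp add: pair_tens f g h conv_lin 2 comult_closed conv_def
          tensor_map_tens[OF module_H module_H module_HH module_H comult_lin lin_hom_id] id_def)
  qed
  then have "?t (tensor_assoc K H H H (tensor_map K (tensor K H H) H \<Delta> id (\<Delta> x))) =
      conv (conv f g) h x"
    using dx by (simp add: conv_def)
  with 1 show ?thesis
    by (simp add: coassoc[OF x])
qed

lemma conv_unit_left:
  assumes f: "f \<in> lin_hom K H H" and x: "x \<in> carrier H"
  shows "conv unit_counit f x = f x"
proof -
  have b: "bilin K H H H (\<lambda>y z. \<kappa> y \<odot> z)"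
    by (rule bilin_comp[OF bilin_smult[OF module_H] counit_lin lin_hom_id])
  have "pairing unit_counit f w = f (tensor_lift H (\<lambda>y z. \<kappa> y \<odot> z) w)"
    if "w \<in> carrier (tensor K H H)" for w
    by (rule tensor_ext[where P = H, OF module_H module_H _ _ _ that],
        (rule pair_lin lin_hom_comp[OF f] tensor_lift_lin module_H b unit_counit_lin f)+,
        simp add: pair_tens unit_counit_lin f tensor_lift_tens[OF module_H b])
      (simp add: unit_counit_def smult_mult_left counit_closed lin_homD[OF f])
  then show ?thesis
    using comult_closed[OF x] by (simp add: conv_def counit_left x)
qed

lemma conv_unit_right:
  assumes f: "f \<in> lin_hom K H H" and x: "x \<in> carrier H"
  shows "conv f unit_counit x = f x"
proof -
  have b: "bilin K H H H (\<lambda>y z. \<kappa> z \<odot> y)"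
    using bilin_comp[OF bilin_smult[OF module_H] counit_lin lin_hom_id]
    unfolding bilin_def by blast
  have "pairing f unit_counit w = f (tensor_lift H (\<lambda>y z. \<kappa> z \<odot> y) w)"
    if "w \<in> carrier (tensor K H H)" for w
    by (rule tensor_ext[where P = H, OF module_H module_H _ _ _ that],
        (rule pair_lin lin_hom_comp[OF f] tensor_lift_lin module_H b unit_counit_lin f)+,
        simp add: pair_tens unit_counit_lin f tensor_lift_tens[OF module_H b])
      (simp add: unit_counit_def smult_mult_right counit_closed lin_homD[OF f])
  then show ?thesis
    using comult_closed[OF x] by (simp add: conv_def counit_right x)
qed

lemma conv_diff_right:
  assumes "f \<in> lin_hom K H H" "g \<in> lin_hom K H H" "h \<in> lin_hom K H H" "x \<in> carrier H"
  shows "conv f (\<lambda>x. g x \<ominus> h x) x = conv f g x \<ominus> conv f h x"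
  unfolding conv_def
  by (rule tensor_ext[where P = H, OF module_H module_H])
    (use assms in \<open>simp_all add: pair_lin pair_tens lin_hom_plus lin_hom_uminus module_H comult_closed
      lin_hom_closed a_minus_def r_distr r_minus\<close>)

lemma conv_diff_left:
  assumes "f \<in> lin_hom K H H" "g \<in> lin_hom K H H" "h \<in> lin_hom K H H" "x \<in> carrier H"
  shows "conv (\<lambda>x. g x \<ominus> h x) f x = conv g f x \<ominus> conv h f x"
  unfolding conv_def
  by (rule tensor_ext[where P = H, OF module_H module_H])
    (use assms in \<open>simp_all add: pair_lin pair_tens lin_hom_plus lin_hom_uminus module_H comult_closed
      lin_hom_closed a_minus_def l_distr l_minus\<close>)

section \<open>The filtration of a bialgebra\<close>

abbreviation filt :: "nat \<Rightarrow> 'h set"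
  where "filt \<equiv> conn_filt K H \<Delta>"

definition reduced :: "'h \<Rightarrow> ('k, unit, 'h \<times> 'h) lterm set"
  where "reduced x =
    \<Delta> x \<ominus>\<^bsub>tensor K H H\<^esub> tens K H H \<one> x \<ominus>\<^bsub>tensor K H H\<^esub> tens K H H x \<one>"

lemma reduced_lin: "reduced \<in> lin_hom K H (tensor K H H)"
  unfolding reduced_def [abs_def]
  by (intro lin_hom_minus module_HH comult_lin bilinD[OF bilin_tens_HH] one_closed)

lemma filt_Suc: "filt (Suc r) = {x \<in> carrier H. reduced x \<in> tensor_square K H (filt r)}"
  by (simp add: reduced_def)

lemma filt_submodule: "submodule (filt r) K H"
proof (induction r)
  case 0
  show ?case
  proof (rule submoduleI'[OF module_H])
    show "filt 0 \<subseteq> carrier H" by auto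
    show "\<zero> \<in> filt 0" by (auto intro!: exI[of _ "\<zero>\<^bsub>K\<^esub>"])
  next
    fix x y assume "x \<in> filt 0" "y \<in> filt 0"
    then show "x \<oplus> y \<in> filt 0" by (auto simp flip: smult_l_distr)
  next
    fix c x assume "c \<in> carrier K" "x \<in> filt 0"
    then show "c \<odot> x \<in> filt 0" by (auto simp flip: smult_assoc1)
  qed
next
  case (Suc r)
  then have "filt r \<subseteq> carrier H" by (rule submoduleD)
  then show ?case
    unfolding filt_Suc
    by (intro lin_hom_preimage_submodule[OF module_H module_HH reduced_lin]
        tensor_square_submodule[OF module_H])
qed

lemma filt_subset: "filt r \<subseteq> carrier H"
  by (rule submoduleD[OF filt_submodule])

lemmas square_submodule = tensor_square_submodule[OF module_H filt_subset]

lemma square_mono: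
  assumes "filt r \<subseteq> filt s"
  shows "tensor_square K H (filt r) \<subseteq> tensor_square K H (filt s)"
  by (rule tensor_square_least[OF module_H filt_subset square_submodule])
    (use assms in \<open>auto intro!: tens_in_tensor_square[OF module_H filt_subset]\<close>)

lemma one_filt_0: "\<one> \<in> filt 0"
  by (auto intro!: exI[of _ "\<one>\<^bsub>K\<^esub>"])

text \<open>Only the base case uses the coproduct; the induction step is monotonicity of the tensor
  square.\<close>

lemma filt_Suc_mono: "filt r \<subseteq> filt (Suc r)"
proof (induction r)
  case 0
  \<comment> \<open>The reduced coproduct of the unit does not vanish: two copies of
    \<open>\<one> \<otimes> \<one>\<close> are subtracted from one.\<close>
  have "reduced \<one> = \<ominus>\<^bsub>tensor K H H\<^esub> tens K H H \<one> \<one>"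
    using bilin_closed[OF bilin_tens_HH one_closed one_closed]
    by (simp add: reduced_def comult_one a_minus_def T.M.r_neg)
  then have "reduced \<one> \<in> tensor_square K H (filt 0)"
    by (simp add: submoduleD(5)[OF square_submodule] tens_in_tensor_square[OF module_H filt_subset] one_filt_0
        del: conn_filt.simps)
  then have "\<one> \<in> filt (Suc 0)"
    by (simp add: filt_Suc del: conn_filt.simps)
  then show ?case
    using submoduleD(4)[OF filt_submodule, of _ \<one> "Suc 0"] by (auto simp del: conn_filt.simps(2))
next
  case (Suc r)
  then show ?case
    using square_mono[OF Suc] unfolding filt_Suc by blast
qed

lemma filt_mono: "r \<le> s \<Longrightarrow> filt r \<subseteq> filt s"
  by (rule lift_Suc_mono_le[of filt]) (rule filt_Suc_mono)

lemma one_filt: "\<one> \<in> filt r"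
  using one_filt_0 filt_mono[of 0 r] by auto

text \<open>A form without subtraction, whose three summands can be expanded directly by
  bilinearity.\<close>

lemma filt_SucD:
  assumes "x \<in> filt (Suc r)"
  obtains w where "w \<in> tensor_square K H (filt r)" "\<Delta> x =
    tens K H H \<one> x \<oplus>\<^bsub>tensor K H H\<^esub> tens K H H x \<one> \<oplus>\<^bsub>tensor K H H\<^esub> w"
proof
  show "reduced x \<in> tensor_square K H (filt r)"
    using assms unfolding filt_Suc by blast
  have "x \<in> carrier H" using assms filt_subset by blast
  then show "\<Delta> x = tens K H H \<one> x \<oplus>\<^bsub>tensor K H H\<^esub> tens K H H x \<one> \<oplus>\<^bsub>tensor K H H\<^esub> reduced x"
    using comult_closed[of x] bilin_closed[OF bilin_tens_HH]
    by (simp add: reduced_def T.M.add_diff_diff)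
qed

lemma filt_SucI:
  assumes "x \<in> carrier H" "w \<in> tensor_square K H (filt r)" "\<Delta> x =
    tens K H H \<one> x \<oplus>\<^bsub>tensor K H H\<^esub> tens K H H x \<one> \<oplus>\<^bsub>tensor K H H\<^esub> w"
  shows "x \<in> filt (Suc r)"
proof -
  have w: "w \<in> carrier (tensor K H H)"
    using assms(2) submoduleD(1)[OF square_submodule] by blast
  have "reduced x = w"
    using w assms(1) bilin_closed[OF bilin_tens_HH]
    by (simp add: reduced_def assms(3) T.M.diff_diff_add)
  then show ?thesis
    using assms unfolding filt_Suc by blast
qed

text \<open>Allows a map to be replaced under a convolution by another one that agrees with it on a
  single filtration step only.\<close>

lemma lin_hom_eq_on_square:
  assumes "module K P" "A \<subseteq> carrier H" "f \<in> lin_hom K (tensor K H H) P" "g \<in> lin_hom K (tensor K H H) P"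
    and "\<And>x y. \<lbrakk>x \<in> A; y \<in> A\<rbrakk> \<Longrightarrow> f (tens K H H x y) = g (tens K H H x y)"
    and "w \<in> tensor_square K H A"
  shows "f w = g w"
proof -
  have "tensor_square K H A \<subseteq> {w \<in> carrier (tensor K H H). f w = g w}"
  proof (rule tensor_square_least[OF module_H assms(2)])
    show "submodule {w \<in> carrier (tensor K H H). f w = g w} K (tensor K H H)"
      by (rule submoduleI'[OF module_HH])
        (use assms(3,4) in \<open>auto simp: lin_homD lin_hom_zero[OF module_HH assms(1)]\<close>)
  qed (use assms(2,5) in \<open>auto intro: bilin_closed[OF bilin_tens_HH]\<close>)
  then show ?thesis using assms(6) by blast
qed

text \<open>The unit lies in every step, so the two outer summands cause no trouble. Hence all the
  values needed to convolve at \<open>x\<close> are taken at elements of one step, where a single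
  partial sum computes the antipode.\<close>

lemma comult_in_square:
  assumes "x \<in> filt (Suc r)"
  shows "\<Delta> x \<in> tensor_square K H (filt (Suc r))"
proof -
  obtain w where w: "w \<in> tensor_square K H (filt r)" "\<Delta> x =
      tens K H H \<one> x \<oplus>\<^bsub>tensor K H H\<^esub> tens K H H x \<one> \<oplus>\<^bsub>tensor K H H\<^esub> w"
    using assms by (rule filt_SucD)
  have "w \<in> tensor_square K H (filt (Suc r))"
    using w(1) square_mono[OF filt_Suc_mono] by blast
  then show ?thesis
    unfolding w(2) using assms
    by (intro submoduleD(3)[OF square_submodule] tens_in_tensor_square[OF module_H filt_subset] one_filt)
qed

text \<open>With \<open>J = id - \<eta>\<kappa>\<close>, the antipode is \<open>\<Sum>n. (-1)^n J^n\<close> for the convolution product. The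
  partial sums satisfy the recursion below, and they stabilise on each step of the filtration
  because \<open>J \<one> = \<zero>\<close>.\<close>

definition aug :: "'h \<Rightarrow> 'h"
  where "aug x = x \<ominus> unit_counit x"

primrec antip :: "nat \<Rightarrow> 'h \<Rightarrow> 'h"
  where
    "antip 0 = (\<lambda>x. \<zero>)"
  | "antip (Suc n) = (\<lambda>x. unit_counit x \<ominus> conv (antip n) aug x)"

lemma aug_lin: "aug \<in> lin_hom K H H"
  unfolding aug_def [abs_def] by (intro lin_hom_minus module_H lin_hom_id unit_counit_lin)

lemma aug_one: "aug \<one> = \<zero>"
  by (simp add: aug_def unit_counit_def counit_one a_minus_def r_neg)

lemma antip_lin: "antip n \<in> lin_hom K H H"
  by (induction n)
    (auto intro!: lin_hom_zero_map lin_hom_minus conv_lin module_H unit_counit_lin aug_lin)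

text \<open>The partial sums are convolution polynomials in \<open>aug\<close>. The recursion
  multiplies by \<open>aug\<close> on the right; commutation makes it serve for both antipode
  identities.\<close>

lemma antip_comm:
  assumes "x \<in> carrier H"
  shows "conv aug (antip n) x = conv (antip n) aug x"
  using assms
proof (induction n arbitrary: x)
  case 0
  have z: "(\<lambda>x. \<zero>) \<in> lin_hom K H H"
    by (rule lin_hom_zero_map[OF module_H])
  show ?case
    unfolding conv_def antip.simps
    by (rule tensor_ext[where P = H, OF module_H module_H pair_lin[OF aug_lin z] pair_lin[OF z aug_lin]])
      (simp_all add: pair_tens[OF aug_lin z] pair_tens[OF z aug_lin] lin_hom_closed[OF aug_lin]
        comult_closed 0)
next
  case (Suc n)
  note l = antip_lin aug_lin unit_counit_lin conv_lin[OF antip_lin aug_lin] conv_lin[OF aug_lin antip_lin]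
  have "conv aug (antip (Suc n)) x =
      conv aug unit_counit x \<ominus> conv aug (conv (antip n) aug) x"
    using Suc.prems by (simp add: conv_diff_right l)
  also have "conv aug (conv (antip n) aug) x = conv (conv aug (antip n)) aug x"
    using Suc.prems by (simp add: conv_assoc l)
  also have "\<dots> = conv (conv (antip n) aug) aug x"
    by (rule conv_cong) (use Suc in \<open>auto simp: l simp del: antip.simps\<close>)
  also have "conv aug unit_counit x = conv unit_counit aug x"
    using Suc.prems by (simp add: conv_unit_left conv_unit_right l)
  finally show ?case
    using Suc.prems by (simp add: conv_diff_left l)
qed

text \<open>\<open>\<Delta> \<one> = \<one> \<otimes> \<one>\<close> and
  \<open>aug \<one> = \<zero>\<close> remove the correction in the recursion. The index is a
  successor because the empty sum \<open>antip 0\<close> is zero even at the unit.\<close>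

lemma antip_one:
  assumes "c \<in> carrier K"
  shows "antip (Suc n) (c \<odot> \<one>) = c \<odot> \<one>"
proof -
  have 1: "conv (antip n) aug \<one> = \<zero>"
    by (simp add: conv_def comult_one pair_tens antip_lin aug_lin aug_one lin_hom_closed[OF antip_lin])
  have "antip (Suc n) \<one> = \<one>"
    by (simp add: 1) (simp add: unit_counit_def counit_one a_minus_def)
  then show ?thesis
    using assms by (simp add: lin_hom_smult[OF antip_lin] del: antip.simps)
qed

text \<open>In the convolution with \<open>aug\<close>, the summand
  \<open>x \<otimes> \<one>\<close> dies because \<open>aug \<one> = \<zero>\<close>. The summand
  \<open>\<one> \<otimes> x\<close> and the remainder evaluate the partial sums on the previous step
  only, where they already agree.\<close>

lemma antip_stable:
  assumes "x \<in> filt r" "n \<ge> Suc r"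
  shows "antip (Suc n) x = antip n x"
  using assms
proof (induction r arbitrary: x n)
  case 0
  then obtain c m where "x = c \<odot> \<one>" "c \<in> carrier K" "n = Suc m"
    by (cases n) auto
  then show ?case by (simp add: antip_one del: antip.simps)
next
  case (Suc r)
  then obtain m where n: "n = Suc m" "m \<ge> Suc r" by (cases n) auto
  obtain w where w: "w \<in> tensor_square K H (filt r)" "\<Delta> x =
      tens K H H \<one> x \<oplus>\<^bsub>tensor K H H\<^esub> tens K H H x \<one> \<oplus>\<^bsub>tensor K H H\<^esub> w"
    using Suc.prems(1) by (rule filt_SucD)
  have x: "x \<in> carrier H" and w': "w \<in> carrier (tensor K H H)"
    using Suc.prems(1) w(1) filt_subset submoduleD(1)[OF square_submodule] by blast+
  have eq: "antip (Suc m) y = antip m y" if "y \<in> filt r" for y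
    using Suc.IH that n(2) by blast
  let ?p = "\<lambda>f. pairing f aug"
  have "?p (antip (Suc m)) w = ?p (antip m) w"
    by (rule lin_hom_eq_on_square[OF module_H filt_subset _ _ _ w(1)])
      (use filt_subset in \<open>auto intro!: pair_lin antip_lin aug_lin simp: pair_tens antip_lin aug_lin
        subsetD[OF filt_subset] eq simp del: antip.simps\<close>)
  then have "conv (antip (Suc m)) aug x = conv (antip m) aug x"
    unfolding conv_def w(2) using x w' bilin_closed[OF bilin_tens_HH]
    by (simp add: lin_hom_add[OF pair_lin[OF antip_lin aug_lin]] pair_tens antip_lin aug_lin
        eq[OF one_filt] aug_one lin_hom_closed[OF antip_lin] del: antip.simps)
  then show ?case
    unfolding n by (simp only: antip.simps)
qed

lemma antip_stable':
  assumes "x \<in> filt r" "n \<ge> Suc r"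
  shows "antip n x = antip (Suc r) x"
  using assms(2) by (induction rule: dec_induct) (simp_all only: antip_stable[OF assms(1)])

end

context connected_bialgebra
begin

text \<open>The limit of the partial sums. The least index is merely a choice: by stabilisation
  every larger one gives the same value.\<close>

definition antipode_map
  where "antipode_map x = antip (Suc (LEAST r. x \<in> filt r)) x"

lemma antipode_map_eq:
  assumes "x \<in> filt r" "n \<ge> Suc r"
  shows "antipode_map x = antip n x"
proof -
  have "x \<in> filt (LEAST r. x \<in> filt r)" "(LEAST r. x \<in> filt r) \<le> r"
    using assms(1) by (auto intro: LeastI Least_le)
  then show ?thesis
    unfolding antipode_map_def using assms(2) by (intro antip_stable'[symmetric]) auto
qed

lemma in_filt:
  assumes "x \<in> carrier H"
  obtains r where "x \<in> filt (Suc r)"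
  using assms connected filt_Suc_mono by blast

lemma antipode_map_lin: "antipode_map \<in> lin_hom K H H"
proof (rule lin_homI)
  fix x assume x: "x \<in> carrier H"
  then obtain r where r: "x \<in> filt (Suc r)" by (rule in_filt)
  then show "antipode_map x \<in> carrier H"
    using antipode_map_eq[OF r le_refl] lin_hom_closed[OF antip_lin] x
    by (simp del: antip.simps conn_filt.simps)
  fix y assume y: "y \<in> carrier H"
  then obtain s where s: "y \<in> filt (Suc s)" by (rule in_filt)
  \<comment> \<open>A common step for \<open>x\<close>, \<open>y\<close> and their sum, so that one
    and the same linear partial sum computes all three values.\<close>
  define m where "m = Suc (max r s)"
  have m: "x \<in> filt m" "y \<in> filt m"
    using r s filt_mono[of "Suc r" m] filt_mono[of "Suc s" m] by (auto simp: m_def simp del: conn_filt.simps)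
  then have "x \<oplus> y \<in> filt m"
    by (rule submoduleD(3)[OF filt_submodule])
  then show "antipode_map (x \<oplus> y) = antipode_map x \<oplus> antipode_map y"
    using antipode_map_eq[OF _ le_refl, of _ m] m lin_hom_add[OF antip_lin] x y
    by (simp del: antip.simps)
next
  fix c x assume c: "c \<in> carrier K" and x: "x \<in> carrier H"
  then obtain r where r: "x \<in> filt (Suc r)" by - (rule in_filt)
  then have "c \<odot> x \<in> filt (Suc r)"
    using c by (intro submoduleD(4)[OF filt_submodule])
  then show "antipode_map (c \<odot> x) = c \<odot> antipode_map x"
    using antipode_map_eq[OF _ le_refl, of _ "Suc r"] r lin_hom_smult[OF antip_lin] c x
    by (simp del: antip.simps conn_filt.simps)
qed

text \<open>Since the identity is \<open>unit_counit\<close> plus \<open>aug\<close>, convolving a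
  partial sum with it gives that sum plus its convolution with \<open>aug\<close>. By the recursion
  this is \<open>unit_counit\<close> as soon as the sum has stabilised.\<close>

lemma antipode_map_conv:
  assumes x: "x \<in> carrier H"
  shows "conv antipode_map (\<lambda>z. z) x = unit_counit x" "conv (\<lambda>z. z) antipode_map x = unit_counit x"
proof -
  obtain r where r: "x \<in> filt (Suc r)" using x by (rule in_filt)
  define n where "n = Suc (Suc r)"
  note l = antip_lin[of n] aug_lin unit_counit_lin antipode_map_lin lin_hom_id[where K = K and M = H]
    conv_lin[OF antip_lin[of n] aug_lin] conv_lin[OF aug_lin antip_lin[of n]]
  have eq: "antipode_map y = antip n y" if "y \<in> filt (Suc r)" for y
    by (rule antipode_map_eq[OF that]) (simp add: n_def)
  have c: "conv (antip n) aug x \<in> carrier H"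
    by (rule lin_hom_closed[OF l(6) x])
  have ec: "unit_counit x \<in> carrier H" and an: "antip n x \<in> carrier H"
    using lin_hom_closed[OF unit_counit_lin x] lin_hom_closed[OF l(1) x] by auto
  \<comment> \<open>The recursion has \<open>antip (Suc n)\<close> on its left side; stability turns
    it into a fixed point equation for \<open>antip n\<close> at \<open>x\<close>.\<close>
  have a: "antip n x = unit_counit x \<ominus> conv (antip n) aug x"
    using antip_stable[OF r, of n] by (simp add: n_def del: conn_filt.simps)
  \<comment> \<open>Written as a difference with a double sign, so that additivity of convolution in
    the form \<open>conv_diff_left\<close> and \<open>conv_diff_right\<close> applies.\<close>
  have id: "z = unit_counit z \<ominus> (\<ominus> aug z)" if "z \<in> carrier H" for z
    using that lin_hom_closed[OF unit_counit_lin that]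
    by (simp add: aug_def a_minus_def minus_add a_ac r_neg1 r_neg2 r_neg)
  have na: "(\<lambda>z. \<ominus> aug z) \<in> lin_hom K H H"
    by (rule lin_hom_uminus[OF module_H aug_lin])
  have sum: "(\<lambda>z. unit_counit z \<ominus> (\<ominus> aug z)) \<in> lin_hom K H H"
    by (rule lin_hom_minus[OF module_H unit_counit_lin na])
  have neg: "conv (antip n) (\<lambda>z. \<ominus> aug z) x = \<ominus> conv (antip n) aug x"
    "conv (\<lambda>z. \<ominus> aug z) (antip n) x = \<ominus> conv aug (antip n) x"
    unfolding conv_def
    by (rule tensor_ext[where P = H, OF module_H module_H]; 
        simp add: pair_lin pair_tens l na comult_closed x lin_hom_uminus module_H r_minus l_minus
          lin_hom_closed[OF l(1)] lin_hom_closed[OF aug_lin])+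
  have "conv antipode_map (\<lambda>z. z) x = conv (antip n) (\<lambda>z. z) x"
    unfolding conv_def
    by (rule lin_hom_eq_on_square[OF module_H filt_subset _ _ _ comult_in_square[OF r]])
      (auto intro!: pair_lin l simp: pair_tens l subsetD[OF filt_subset] eq simp del: conn_filt.simps)
  also have "\<dots> = conv (antip n) (\<lambda>z. unit_counit z \<ominus> (\<ominus> aug z)) x"
    using id x by (intro conv_cong l sum) auto
  also have "\<dots> = antip n x \<ominus> (\<ominus> conv (antip n) aug x)"
    by (simp add: conv_diff_right l na x neg conv_unit_right)
  also have "\<dots> = unit_counit x"
    using c ec by (subst a) (simp add: a_minus_def a_ac r_neg1 r_neg2 r_neg)
  finally show "conv antipode_map (\<lambda>z. z) x = unit_counit x" .
  have "conv (\<lambda>z. z) antipode_map x = conv (\<lambda>z. z) (antip n) x"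
    unfolding conv_def
    by (rule lin_hom_eq_on_square[OF module_H filt_subset _ _ _ comult_in_square[OF r]])
      (auto intro!: pair_lin l simp: pair_tens l subsetD[OF filt_subset] eq simp del: conn_filt.simps)
  also have "\<dots> = conv (\<lambda>z. unit_counit z \<ominus> (\<ominus> aug z)) (antip n) x"
    using id x by (intro conv_cong l sum) auto
  also have "\<dots> = antip n x \<ominus> (\<ominus> conv (antip n) aug x)"
    by (simp add: conv_diff_left l na x neg conv_unit_left antip_comm)
  also have "\<dots> = unit_counit x"
    using c ec by (subst a) (simp add: a_minus_def a_ac r_neg1 r_neg2 r_neg)
  finally show "conv (\<lambda>z. z) antipode_map x = unit_counit x" .
qed

theorem connected_hopf: "connected_hopf_algebra K H \<Delta> \<kappa>"
  using antipode_map_lin antipode_map_conv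
  by unfold_locales (auto simp: conv_def pairing_def unit_counit_def)

end

section \<open>The relations as lists of monomials\<close>

text \<open>Over an explicit list of operations such a sum unfolds by simplification, and a
  rearrangement of terms becomes an equality of multisets.\<close>

definition lsum :: "('k, 'a, 'n) module_scheme \<Rightarrow> ('i \<Rightarrow> 'a) \<Rightarrow> 'i list \<Rightarrow> 'a"
  where "lsum M f xs = foldr (\<lambda>x s. f x \<oplus>\<^bsub>M\<^esub> s) xs \<zero>\<^bsub>M\<^esub>"

lemma lsum_simps [simp]:
  "lsum M f [] = \<zero>\<^bsub>M\<^esub>" "lsum M f (x # xs) = f x \<oplus>\<^bsub>M\<^esub> lsum M f xs"
  by (simp_all add: lsum_def)

lemma lsum_map: "lsum M f (map g xs) = lsum M (\<lambda>x. f (g x)) xs"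
  by (induction xs) auto

lemma lsum_cong: "(\<And>x. x \<in> set xs \<Longrightarrow> f x = g x) \<Longrightarrow> lsum M f xs = lsum M g xs"
  by (induction xs) auto

context module
begin

lemma lsum_closed: "(\<And>x. x \<in> set xs \<Longrightarrow> f x \<in> carrier M) \<Longrightarrow> lsum M f xs \<in> carrier M"
  by (induction xs) auto

lemma lsum_zero: "lsum M (\<lambda>x. \<zero>\<^bsub>M\<^esub>) xs = \<zero>\<^bsub>M\<^esub>"
  by (induction xs) auto

lemma lsum_add:
  assumes "\<And>x. f x \<in> carrier M" "\<And>x. g x \<in> carrier M"
  shows "lsum M (\<lambda>x. f x \<oplus>\<^bsub>M\<^esub> g x) xs = lsum M f xs \<oplus>\<^bsub>M\<^esub> lsum M g xs"
  by (induction xs) (simp_all add: assms lsum_closed M.a_ac)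

lemma lsum_append:
  assumes "\<And>x. f x \<in> carrier M"
  shows "lsum M f (xs @ ys) = lsum M f xs \<oplus>\<^bsub>M\<^esub> lsum M f ys"
  by (induction xs) (simp_all add: assms lsum_closed M.a_assoc)

lemma lsum_concat:
  assumes "\<And>x. f x \<in> carrier M"
  shows "lsum M f (concat xss) = lsum M (lsum M f) xss"
  by (induction xss) (simp_all add: assms lsum_append)

lemma lsum_remove1:
  assumes "\<And>x. f x \<in> carrier M"
  shows "x \<in> set xs \<Longrightarrow> lsum M f xs = f x \<oplus>\<^bsub>M\<^esub> lsum M f (remove1 x xs)"
  by (induction xs) (auto simp: assms lsum_closed M.a_ac)

lemma lsum_mset:
  assumes f: "\<And>x. f x \<in> carrier M"
  shows "mset xs = mset ys \<Longrightarrow> lsum M f xs = lsum M f ys"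
proof (induction xs arbitrary: ys)
  case (Cons x xs)
  then have x: "x \<in> set ys"
    using mset_eq_setD[OF Cons.prems] by auto
  have eq: "mset xs = mset (remove1 x ys)"
    by (simp flip: Cons.prems)
  show ?case
    using lsum_remove1[OF f x] Cons.IH[OF eq] by simp
qed simp

end

lemma lin_hom_lsum:
  assumes "module K M" "module K N" "f \<in> lin_hom K M N" "\<And>x. x \<in> set xs \<Longrightarrow> g x \<in> carrier M"
  shows "f (lsum M g xs) = lsum N (\<lambda>x. f (g x)) xs"
proof -
  interpret M: module K M by fact
  show ?thesis
    using assms(4)
    by (induction xs) (simp_all add: lin_hom_zero[OF assms(1-3)] lin_hom_add[OF assms(3)] M.lsum_closed)
qed

lemma lsum_lin:
  assumes "module K N" "\<And>i. f i \<in> lin_hom K M N"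
  shows "(\<lambda>x. lsum N (\<lambda>i. f i x) xs) \<in> lin_hom K M N"
  by (induction xs) (use assms in \<open>auto intro: lin_hom_plus lin_hom_zero_map\<close>)

lemma bilin_lsum:
  assumes "module K P" "\<And>i. bilin K M N P (f i)"
  shows "bilin K M N P (\<lambda>x y. lsum P (\<lambda>i. f i x y) xs)"
  by (intro bilinI lsum_lin assms(1) bilinD[OF assms(2)])

definition all_ops :: "dn_op list"
  where "all_ops = [NE, SE, SW, NW, Up, Down, Prec, Succ, Bullet]"

text \<open>A relation is a pair \<open>(L, R)\<close>, where \<open>(p, q)\<close> stands for the monomial \<open>(x p y) q z\<close> in \<open>L\<close>
  and for \<open>x p (y q z)\<close> in \<open>R\<close>.\<close>

definition dn_list :: "((dn_op \<times> dn_op) list \<times> (dn_op \<times> dn_op) list) list"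
  where "dn_list = (
    let left = [NW, SW, Prec]; right = [NE, SE, Succ]; bar = [Up, Down, Bullet];
      wedge = [NW, NE, Up]; vee = [SE, SW, Down]; tilde = [Prec, Succ, Bullet];
      l = (\<lambda>ps q. map (\<lambda>p. (p, q)) ps); r = (\<lambda>p qs. map (Pair p) qs)
    in
    [([(NW, NW)], r NW all_ops),
     ([(NE, NW)], r NE left),
     (l wedge NE, r NE right),
     ([(SW, NW)], r SW wedge),
     ([(SE, NW)], [(SE, NW)]),
     (l vee NE, [(SE, NE)]),
     (l left SW, r SW vee),
     (l right SW, [(SE, SW)]),
     (l all_ops SE, [(SE, SE)]),
     ([(SW, Prec)], r SW tilde),
     ([(SE, Prec)], [(SE, Prec)]),
     (l vee Succ, [(SE, Succ)]),
     ([(NW, Prec)], r Prec vee),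
     ([(NE, Prec)], [(Succ, SW)]),
     (l wedge Succ, [(Succ, SE)]),
     ([(Prec, NW)], r Prec wedge),
     ([(Succ, NW)], [(Succ, NW)]),
     (l tilde NE, [(Succ, NE)]),
     ([(Prec, Prec)], r Prec tilde),
     ([(Succ, Prec)], [(Succ, Prec)]),
     (l tilde Succ, [(Succ, Succ)]),
     (l wedge Up @ [(Up, NW)], r NE bar @ r Up all_ops),
     (l vee Up @ [(Down, NW)], (SE, Up) # r Down wedge),
     (l all_ops Down @ l bar SW, (SE, Down) # r Down vee),
     (l vee Bullet @ [(Down, Prec)], (SE, Bullet) # r Down tilde),
     (l wedge Bullet @ [(Up, Prec)], (Succ, Down) # r Bullet vee),
     (l tilde Up @ [(Bullet, NW)], (Succ, Up) # r Bullet wedge),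
     (l tilde Bullet @ [(Bullet, Prec)], (Succ, Bullet) # r Bullet tilde)])"

lemmas dn_list_unfold =
  dn_list_def[unfolded Let_def all_ops_def list.map append.simps]

definition dn_lhs ::
  "('k, 'a, 'n) module_scheme \<Rightarrow> (dn_op \<Rightarrow> 'a \<Rightarrow> 'a \<Rightarrow> 'a) \<Rightarrow> (dn_op \<times> dn_op) list \<Rightarrow> 'a \<Rightarrow> 'a \<Rightarrow> 'a \<Rightarrow> 'a"
  where "dn_lhs A b L x y z = lsum A (\<lambda>(p, q). b q (b p x y) z) L"

definition dn_rhs ::
  "('k, 'a, 'n) module_scheme \<Rightarrow> (dn_op \<Rightarrow> 'a \<Rightarrow> 'a \<Rightarrow> 'a) \<Rightarrow> (dn_op \<times> dn_op) list \<Rightarrow> 'a \<Rightarrow> 'a \<Rightarrow> 'a \<Rightarrow> 'a"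
  where "dn_rhs A b R x y z = lsum A (\<lambda>(p, q). b p x (b q y z)) R"

lemma op_moduleI_bilin:
  assumes "module K A" "\<And>p. p \<in> \<Omega> \<Longrightarrow> bilin K A A A (b p)"
  shows "op_module K \<Omega> A b"
  by (intro op_module.intro op_module_axioms.intro assms)
    (simp_all add: bilin_simps[OF assms(2)])

lemma (in op_module) bilin_op: "p \<in> \<Omega> \<Longrightarrow> bilin K A A A (b p)"
  by (intro bilinI lin_homI)
    (simp_all add: op_closed op_add_left op_add_right op_smult_left op_smult_right)

text \<open>Nine bilinear operations without any relations. The augmentation ideal of the tensor
  square is such a structure before its relations are known.\<close>

locale dn_module = op_module K "UNIV :: dn_op set" D b
  for K :: "('k, 'm) ring_scheme" and D :: "('k, 'd, 'n) module_scheme"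
    and b :: "dn_op \<Rightarrow> 'd \<Rightarrow> 'd \<Rightarrow> 'd"
begin

lemma module_D: "module K D" ..

lemmas bilin_b = bilin_op[OF UNIV_I]

lemma b_closed [simp]: "\<lbrakk>x \<in> carrier D; y \<in> carrier D\<rbrakk> \<Longrightarrow> b p x y \<in> carrier D"
  by (rule op_closed) simp_all

text \<open>Bilinearity expands the derived operations into sums of monomials. One direction reads
  the relations off from a given algebra, the other establishes them for a new one.\<close>

lemma dn_identities_iff:
  assumes "x \<in> carrier D" "y \<in> carrier D" "z \<in> carrier D"
  shows "(\<forall>(l, r)\<in>dn_identities (add D) b x y z. l = r) \<longleftrightarrow>
    (\<forall>(L, R)\<in>set dn_list. dn_lhs D b L x y z = dn_rhs D b R x y z)"
  using assms
  by (simp add: dn_identities_def dn_star_def dn_lhs_def dn_rhs_def dn_list_unfold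
      op_add_left op_add_right M.a_assoc)

lemma dn_star_lsum:
  assumes "x \<in> carrier D" "y \<in> carrier D"
  shows "dn_star (add D) b x y = lsum D (\<lambda>p. b p x y) all_ops"
  using assms by (simp add: dn_star_def all_ops_def M.a_assoc)

text \<open>Linearity in each argument, here and for the right sides, reduces a relation to
  arguments from a spanning set.\<close>

lemma dn_lhs_lin:
  "\<lbrakk>y \<in> carrier D; z \<in> carrier D\<rbrakk> \<Longrightarrow> (\<lambda>x. dn_lhs D b L x y z) \<in> lin_hom K D D"
  "\<lbrakk>x \<in> carrier D; z \<in> carrier D\<rbrakk> \<Longrightarrow> (\<lambda>y. dn_lhs D b L x y z) \<in> lin_hom K D D"
  "\<lbrakk>x \<in> carrier D; y \<in> carrier D\<rbrakk> \<Longrightarrow> (\<lambda>z. dn_lhs D b L x y z) \<in> lin_hom K D D"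
  unfolding dn_lhs_def case_prod_unfold
  by (intro lsum_lin module_D; (intro bilin_left[OF bilin_b] bilinD[OF bilin_b])?; simp)+

lemma dn_rhs_lin:
  "\<lbrakk>y \<in> carrier D; z \<in> carrier D\<rbrakk> \<Longrightarrow> (\<lambda>x. dn_rhs D b L x y z) \<in> lin_hom K D D"
  "\<lbrakk>x \<in> carrier D; z \<in> carrier D\<rbrakk> \<Longrightarrow> (\<lambda>y. dn_rhs D b L x y z) \<in> lin_hom K D D"
  "\<lbrakk>x \<in> carrier D; y \<in> carrier D\<rbrakk> \<Longrightarrow> (\<lambda>z. dn_rhs D b L x y z) \<in> lin_hom K D D"
  unfolding dn_rhs_def case_prod_unfold
  by (intro lsum_lin module_D; (intro bilin_right[OF bilin_b] bilinD[OF bilin_b])?; simp)+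

end

sublocale dn_algebra \<subseteq> dn_module ..

text \<open>Associativity of the total product is the sum of the 28 relations, because each of the
  81 monomials of either bracketing occurs in exactly one of them, and once.\<close>

lemma dn_list_monomials:
  "mset (concat (map fst dn_list)) = mset (concat (map (\<lambda>q. map (\<lambda>p. (p, q)) all_ops) all_ops))"
  "mset (concat (map snd dn_list)) = mset (concat (map (\<lambda>p. map (Pair p) all_ops) all_ops))"
proof -
  \<comment> \<open>For lists without repetition, equality of multisets is equality of sets; both
    facts are then decided by evaluation.\<close>
  have d: "distinct (concat (map fst dn_list))" "distinct (concat (map snd dn_list))"
    "distinct (concat (map (\<lambda>q. map (\<lambda>p. (p, q)) all_ops) all_ops))"
    "distinct (concat (map (\<lambda>p. map (Pair p) all_ops) all_ops))"
    by code_simp+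
  have "set (concat (map fst dn_list)) = set (concat (map (\<lambda>q. map (\<lambda>p. (p, q)) all_ops) all_ops))"
    "set (concat (map snd dn_list)) = set (concat (map (\<lambda>p. map (Pair p) all_ops) all_ops))"
    by code_simp+
  with d show
    "mset (concat (map fst dn_list)) = mset (concat (map (\<lambda>q. map (\<lambda>p. (p, q)) all_ops) all_ops))"
    "mset (concat (map snd dn_list)) = mset (concat (map (\<lambda>p. map (Pair p) all_ops) all_ops))"
    by (simp_all only: set_eq_iff_mset_eq_distinct)
qed

lemma (in dn_algebra) dn_list_identity:
  assumes "x \<in> carrier D" "y \<in> carrier D" "z \<in> carrier D" "(L, R) \<in> set dn_list"
  shows "dn_lhs D b L x y z = dn_rhs D b R x y z"
  using dn_identities_iff[OF assms(1-3)] dn_identities[OF assms(1-3)] assms(4) by blast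

section \<open>The augmentation of a dendriform-Nijenhuis algebra\<close>

context dn_algebra
begin

definition star :: "'d \<Rightarrow> 'd \<Rightarrow> 'd"
  where "star x y = lsum D (\<lambda>p. b p x y) all_ops"

lemma bilin_star: "bilin K D D D star"
  unfolding star_def [abs_def] by (intro bilin_lsum module_D bilin_b)

lemma star_assoc:
  assumes x: "x \<in> carrier D" and y: "y \<in> carrier D" and z: "z \<in> carrier D"
  shows "star (star x y) z = star x (star y z)"
proof -
  let ?l = "\<lambda>(p, q). b q (b p x y) z" and ?r = "\<lambda>(p, q). b p x (b q y z)"
  have l: "?l i \<in> carrier D" and r: "?r i \<in> carrier D" for i
    using assms by (auto split: prod.split)
  have "star (star x y) z = lsum D (\<lambda>q. lsum D (\<lambda>p. b q (b p x y) z) all_ops) all_ops"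
    unfolding star_def
    by (intro lsum_cong lin_hom_lsum[OF module_D module_D bilinD(2)[OF bilin_b z]])
      (simp add: assms)
  also have "\<dots> = lsum D ?l (concat (map (\<lambda>q. map (\<lambda>p. (p, q)) all_ops) all_ops))"
    by (subst lsum_concat[OF l]) (simp add: lsum_map)
  \<comment> \<open>The 81 monomials are regrouped by the relation in which they occur.\<close>
  also have "\<dots> = lsum D ?l (concat (map fst dn_list))"
    by (intro lsum_mset l dn_list_monomials(1)[symmetric])
  also have "\<dots> = lsum D (\<lambda>(L, R). dn_lhs D b L x y z) dn_list"
    by (subst lsum_concat[OF l]) (simp add: lsum_map dn_lhs_def case_prod_unfold)
  also have "\<dots> = lsum D (\<lambda>(L, R). dn_rhs D b R x y z) dn_list"
    using dn_list_identity[OF x y z] by (intro lsum_cong) auto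
  also have "\<dots> = lsum D ?r (concat (map snd dn_list))"
    by (subst lsum_concat[OF r]) (simp add: lsum_map dn_rhs_def case_prod_unfold)
  also have "\<dots> = lsum D ?r (concat (map (\<lambda>p. map (Pair p) all_ops) all_ops))"
    by (intro lsum_mset r dn_list_monomials(2))
  also have "\<dots> = lsum D (\<lambda>p. lsum D (\<lambda>q. b p x (b q y z)) all_ops) all_ops"
    by (subst lsum_concat[OF r]) (simp add: lsum_map)
  also have "\<dots> = star x (star y z)"
    unfolding star_def
    by (intro lsum_cong lin_hom_lsum[OF module_D module_D bilinD(1)[OF bilin_b x], symmetric])
      (simp add: assms)
  finally show ?thesis .
qed

abbreviation H :: "('k, 'k \<times> 'd) module"
  where "H \<equiv> augmentation K D b"

lemma H_simps [simp]:
  "carrier H = carrier K \<times> carrier D"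
  "\<one>\<^bsub>H\<^esub> = (\<one>\<^bsub>K\<^esub>, \<zero>\<^bsub>D\<^esub>)"
  "\<zero>\<^bsub>H\<^esub> = (\<zero>\<^bsub>K\<^esub>, \<zero>\<^bsub>D\<^esub>)"
  "(c, x) \<oplus>\<^bsub>H\<^esub> (d, y) = (c \<oplus>\<^bsub>K\<^esub> d, x \<oplus>\<^bsub>D\<^esub> y)"
  "c \<odot>\<^bsub>H\<^esub> (d, y) = (c \<otimes>\<^bsub>K\<^esub> d, c \<odot>\<^bsub>D\<^esub> y)"
  by (simp_all add: augmentation_def)

lemma H_mult [simp]:
  assumes "x \<in> carrier D" "y \<in> carrier D"
  shows "(c, x) \<otimes>\<^bsub>H\<^esub> (d, y) = (c \<otimes>\<^bsub>K\<^esub> d, c \<odot>\<^bsub>D\<^esub> y \<oplus>\<^bsub>D\<^esub> d \<odot>\<^bsub>D\<^esub> x \<oplus>\<^bsub>D\<^esub> star x y)"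
  using assms by (simp add: augmentation_def dn_star_lsum star_def)

lemmas star_simps [simp] = bilin_closed[OF bilin_star]
  bilin_zero_left[OF bilin_star module_D module_D module_D]
  bilin_zero_right[OF bilin_star module_D module_D module_D]

lemma smult_left_commute:
  assumes "c \<in> carrier K" "d \<in> carrier K" "x \<in> carrier D"
  shows "c \<odot>\<^bsub>D\<^esub> (d \<odot>\<^bsub>D\<^esub> x) = d \<odot>\<^bsub>D\<^esub> (c \<odot>\<^bsub>D\<^esub> x)"
  using assms by (metis smult_assoc1 R.m_comm)

lemma unital_algebra_H: "unital_algebra K H"
proof -
  have "abelian_group H"
  proof (rule abelian_groupI)
    fix x assume "x \<in> carrier H"
    then show "\<exists>y\<in>carrier H. y \<oplus>\<^bsub>H\<^esub> x = \<zero>\<^bsub>H\<^esub>"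
      by (auto intro!: bexI[of _ "\<ominus>\<^bsub>K\<^esub> (fst x)"] bexI[of _ "\<ominus>\<^bsub>D\<^esub> (snd x)"] simp: R.l_neg M.l_neg)
  qed (auto simp: R.a_ac M.a_ac)
  moreover have "module K H"
    by (rule moduleI[OF R.is_cring calculation])
      (auto simp: R.l_distr R.r_distr R.m_assoc smult_l_distr smult_r_distr smult_assoc1)
  moreover have "ring H"
  proof (rule ringI)
    show "Group.monoid H"
      by (rule monoidI) (auto simp: R.m_assoc smult_r_distr smult_assoc1 smult_left_commute
          bilin_simps[OF bilin_star] star_assoc M.a_ac)
  qed (use \<open>abelian_group H\<close> in \<open>auto simp: R.l_distr R.r_distr smult_l_distr smult_r_distr
      bilin_simps[OF bilin_star] M.a_ac\<close>)
  ultimately show ?thesis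
    unfolding unital_algebra_def unital_algebra_axioms_def
    by (auto simp: R.m_assoc R.m_lcomm smult_assoc1 smult_left_commute smult_r_distr
        bilin_simps[OF bilin_star])
qed

end

lemma bilin_flip: "bilin K M N P f \<Longrightarrow> bilin K N M P (\<lambda>x y. f y x)"
  by (simp add: bilin_def)

lemma bilin_zero_map: "module K P \<Longrightarrow> bilin K M N P (\<lambda>x y. \<zero>\<^bsub>P\<^esub>)"
  by (intro bilinI lin_hom_zero_map)

lemma bilin_if:
  "\<lbrakk>c \<Longrightarrow> bilin K M N P f; \<not> c \<Longrightarrow> bilin K M N P g\<rbrakk> \<Longrightarrow>
    bilin K M N P (\<lambda>x y. if c then f x y else g x y)"
  by (cases c) simp_all

section \<open>Direct sums of modules\<close>

definition dsum ::
  "('k, 'a, 'n) module_scheme \<Rightarrow> ('k, 'b, 'p) module_scheme \<Rightarrow> ('k, 'a \<times> 'b) module"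
  where "dsum M N =
    \<lparr>carrier = carrier M \<times> carrier N, monoid.mult = undefined, one = undefined,
     zero = (\<zero>\<^bsub>M\<^esub>, \<zero>\<^bsub>N\<^esub>),
     add = (\<lambda>(x, y) (x', y'). (x \<oplus>\<^bsub>M\<^esub> x', y \<oplus>\<^bsub>N\<^esub> y')),
     smult = (\<lambda>c (x, y). (c \<odot>\<^bsub>M\<^esub> x, c \<odot>\<^bsub>N\<^esub> y))\<rparr>"

lemma dsum_simps [simp]:
  "carrier (dsum M N) = carrier M \<times> carrier N"
  "\<zero>\<^bsub>dsum M N\<^esub> = (\<zero>\<^bsub>M\<^esub>, \<zero>\<^bsub>N\<^esub>)"
  "v \<oplus>\<^bsub>dsum M N\<^esub> w = (fst v \<oplus>\<^bsub>M\<^esub> fst w, snd v \<oplus>\<^bsub>N\<^esub> snd w)"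
  "c \<odot>\<^bsub>dsum M N\<^esub> v = (c \<odot>\<^bsub>M\<^esub> fst v, c \<odot>\<^bsub>N\<^esub> snd v)"
  by (simp_all add: dsum_def case_prod_unfold)

lemma module_dsum:
  assumes "module K M" "module K N"
  shows "module K (dsum M N)"
proof -
  interpret M: module K M by fact
  interpret N: module K N by fact
  have "abelian_group (dsum M N)"
  proof (rule abelian_groupI)
    fix v assume "v \<in> carrier (dsum M N)"
    then show "\<exists>w\<in>carrier (dsum M N). w \<oplus>\<^bsub>dsum M N\<^esub> v = \<zero>\<^bsub>dsum M N\<^esub>"
      by (auto intro!: bexI[of _ "\<ominus>\<^bsub>M\<^esub> (fst v)"] bexI[of _ "\<ominus>\<^bsub>N\<^esub> (snd v)"] simp: M.M.l_neg N.M.l_neg)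
  qed (auto simp: M.M.a_ac N.M.a_ac)
  then show ?thesis
    by (rule moduleI[OF M.R.is_cring])
      (auto simp: M.smult_l_distr M.smult_r_distr M.smult_assoc1
        N.smult_l_distr N.smult_r_distr N.smult_assoc1)
qed

lemma dsum_proj_lin: "fst \<in> lin_hom K (dsum M N) M" "snd \<in> lin_hom K (dsum M N) N"
  by (auto intro!: lin_homI)

lemma dsum_pair_lin:
  "\<lbrakk>f \<in> lin_hom K X M; g \<in> lin_hom K X N\<rbrakk> \<Longrightarrow> (\<lambda>x. (f x, g x)) \<in> lin_hom K X (dsum M N)"
  by (rule lin_homI) (simp_all add: lin_homD)

lemma bilin_dsum_pair:
  "\<lbrakk>bilin K X Y M f; bilin K X Y N g\<rbrakk> \<Longrightarrow> bilin K X Y (dsum M N) (\<lambda>x y. (f x y, g x y))"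
  by (intro bilinI dsum_pair_lin) (auto intro: bilinD)

lemma lsum_dsum:
  "lsum (dsum M N) f xs = (lsum M (\<lambda>i. fst (f i)) xs, lsum N (\<lambda>i. snd (f i)) xs)"
  by (induction xs) simp_all

lemma dsum_ext:
  assumes mods: "module K M" "module K N" "module K P"
    and f: "f \<in> lin_hom K (dsum M N) P" and g: "g \<in> lin_hom K (dsum M N) P"
    and "\<And>x. x \<in> carrier M \<Longrightarrow> f (x, \<zero>\<^bsub>N\<^esub>) = g (x, \<zero>\<^bsub>N\<^esub>)"
      "\<And>y. y \<in> carrier N \<Longrightarrow> f (\<zero>\<^bsub>M\<^esub>, y) = g (\<zero>\<^bsub>M\<^esub>, y)"
    and v: "v \<in> carrier (dsum M N)"
  shows "f v = g v"
proof -
  interpret M: module K M by fact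
  interpret N: module K N by fact
  obtain x y where xy: "v = (x, y)" "x \<in> carrier M" "y \<in> carrier N"
    using v by auto
  then have "v = (x, \<zero>\<^bsub>N\<^esub>) \<oplus>\<^bsub>dsum M N\<^esub> (\<zero>\<^bsub>M\<^esub>, y)" by simp
  moreover have "(x, \<zero>\<^bsub>N\<^esub>) \<in> carrier (dsum M N)" "(\<zero>\<^bsub>M\<^esub>, y) \<in> carrier (dsum M N)"
    using xy by auto
  ultimately show ?thesis
    using lin_hom_add[OF f] lin_hom_add[OF g] assms(6,7) xy by metis
qed

section \<open>The unit action and the augmentation ideal of the tensor square\<close>

sublocale dn_algebra \<subseteq> H: unital_algebra K "augmentation K D b"
  by (rule unital_algebra_H)

context dn_algebra
begin

declare H_simps(1-3) [simp del]

lemma module_H: "module K H" ..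

lemma pair_in_H: "(c, x) \<in> carrier H \<longleftrightarrow> c \<in> carrier K \<and> x \<in> carrier D"
  by (simp add: H_simps)

definition emb :: "'d \<Rightarrow> 'k \<times> 'd"
  where "emb x = (\<zero>\<^bsub>K\<^esub>, x)"

lemma emb_lin: "emb \<in> lin_hom K D H"
  by (rule lin_homI) (simp_all add: emb_def pair_in_H)

lemmas emb_closed [simp] = lin_hom_closed[OF emb_lin]

lemma emb_zero [simp]: "emb \<zero>\<^bsub>D\<^esub> = \<zero>\<^bsub>H\<^esub>"
  by (simp add: emb_def H_simps)

lemma snd_H_lin: "snd \<in> lin_hom K H D"
  by (rule lin_homI) (auto simp: H_simps(1))

lemma fst_H_lin: "fst \<in> lin_hom K H (ground_algebra K)"
  by (rule lin_homI) (auto simp: H_simps(1))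

lemma H_decomp:
  assumes "h \<in> carrier H"
  shows "h = fst h \<odot>\<^bsub>H\<^esub> \<one>\<^bsub>H\<^esub> \<oplus>\<^bsub>H\<^esub> emb (snd h)" "fst h \<in> carrier K" "snd h \<in> carrier D"
  using assms by (auto simp: emb_def H_simps)

lemma H_ext:
  assumes f: "f \<in> lin_hom K H P" and g: "g \<in> lin_hom K H P" and "f \<one>\<^bsub>H\<^esub> = g \<one>\<^bsub>H\<^esub>"
    and "\<And>x. x \<in> carrier D \<Longrightarrow> f (emb x) = g (emb x)" and "h \<in> carrier H"
  shows "f h = g h"
  using H_decomp[OF assms(5)] assms(3,4)
  by (metis H.smult_closed H.one_closed emb_closed lin_hom_add[OF f] lin_hom_add[OF g]
      lin_hom_smult[OF f] lin_hom_smult[OF g])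

text \<open>The operations on the augmentation, with the unit action \<open>x \<nwarrow> 1 = x = 1 \<searrow> x\<close>, all other
  values with one argument \<open>1\<close> being \<open>0\<close>. The values on \<open>(1, 1)\<close> are set to \<open>0\<close>; this is a
  mere convention which breaks the relations.\<close>

definition eop :: "dn_op \<Rightarrow> 'k \<times> 'd \<Rightarrow> 'k \<times> 'd \<Rightarrow> 'd"
  where "eop p h k = b p (snd h) (snd k) \<oplus>\<^bsub>D\<^esub>
    ((if p = SE then fst h \<odot>\<^bsub>D\<^esub> snd k else \<zero>\<^bsub>D\<^esub>) \<oplus>\<^bsub>D\<^esub>
     (if p = NW then fst k \<odot>\<^bsub>D\<^esub> snd h else \<zero>\<^bsub>D\<^esub>))"

lemma bilin_eop: "bilin K H H D (eop p)"
proof -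
  have s: "bilin K H H D (\<lambda>h k. fst h \<odot>\<^bsub>D\<^esub> snd k)"
    by (rule bilin_comp[OF bilin_smult[OF module_D] fst_H_lin snd_H_lin])
  show ?thesis
    unfolding eop_def [abs_def]
    by (intro bilin_plus bilin_if module_D bilin_comp[OF bilin_b snd_H_lin snd_H_lin]
        s bilin_flip[OF s] bilin_zero_map)
qed

lemmas eop_closed [simp] = bilin_closed[OF bilin_eop]

lemma zero_b [simp]:
  "x \<in> carrier D \<Longrightarrow> b p \<zero>\<^bsub>D\<^esub> x = \<zero>\<^bsub>D\<^esub>" "x \<in> carrier D \<Longrightarrow> b p x \<zero>\<^bsub>D\<^esub> = \<zero>\<^bsub>D\<^esub>"
  by (rule bilin_zero_left[OF bilin_b] bilin_zero_right[OF bilin_b]; (rule module_D)?; simp)+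

lemma eop_simps [simp]:
  "\<lbrakk>x \<in> carrier D; y \<in> carrier D\<rbrakk> \<Longrightarrow> eop p (emb x) (emb y) = b p x y"
  "y \<in> carrier D \<Longrightarrow> eop p \<one>\<^bsub>H\<^esub> (emb y) = (if p = SE then y else \<zero>\<^bsub>D\<^esub>)"
  "x \<in> carrier D \<Longrightarrow> eop p (emb x) \<one>\<^bsub>H\<^esub> = (if p = NW then x else \<zero>\<^bsub>D\<^esub>)"
  "eop p \<one>\<^bsub>H\<^esub> \<one>\<^bsub>H\<^esub> = \<zero>\<^bsub>D\<^esub>"
  by (simp_all add: eop_def emb_def H_simps)

text \<open>The unit action makes \<open>1\<close> a unit for the sum of the nine operations, except
  on the pair of units, where the sum is zero by convention. The scalar term restores
  \<open>1\<close> there.\<close>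

lemma mult_eop:
  assumes "h \<in> carrier H" "k \<in> carrier H"
  shows "h \<otimes>\<^bsub>H\<^esub> k = lsum H (\<lambda>p. emb (eop p h k)) all_ops \<oplus>\<^bsub>H\<^esub> (fst h \<otimes>\<^bsub>K\<^esub> fst k) \<odot>\<^bsub>H\<^esub> \<one>\<^bsub>H\<^esub>"
proof -
  obtain c x d y where hk: "h = (c, x)" "k = (d, y)" "c \<in> carrier K" "x \<in> carrier D"
      "d \<in> carrier K" "y \<in> carrier D"
    using assms by (auto simp: H_simps(1))
  have "lsum H (\<lambda>p. emb (eop p h k)) all_ops = emb (lsum D (\<lambda>p. eop p h k) all_ops)"
    using assms by (intro lin_hom_lsum[OF module_D module_H emb_lin, symmetric]) simp
  also have "lsum D (\<lambda>p. eop p h k) all_ops = c \<odot>\<^bsub>D\<^esub> y \<oplus>\<^bsub>D\<^esub> d \<odot>\<^bsub>D\<^esub> x \<oplus>\<^bsub>D\<^esub> star x y"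
    using hk by (simp add: all_ops_def eop_def star_def M.a_ac)
  finally show ?thesis
    using hk by (simp add: emb_def H_simps)
qed

lemma emb_mult:
  assumes "x \<in> carrier D" "y \<in> carrier D"
  shows "emb x \<otimes>\<^bsub>H\<^esub> emb y = emb (star x y)"
  using assms by (simp add: emb_def)

abbreviation "HD \<equiv> tensor K H D"
abbreviation "HH \<equiv> tensor K H H"
abbreviation "tD \<equiv> tens K H D"
abbreviation "tH \<equiv> tens K H H"

lemma module_HD: "module K HD" and module_HH: "module K HH"
  by (intro module_tensor R.is_cring)+

lemmas bilin_tD = bilin_tens[OF module_H module_D]
lemmas bilin_tH = bilin_tens[OF module_H module_H]

lemmas tens_simps [simp] =
  bilin_closed[OF bilin_tD] bilin_closed[OF bilin_tH]
  bilin_zero_left[OF bilin_tD module_H module_D module_HD]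
  bilin_zero_right[OF bilin_tD module_H module_D module_HD]
  bilin_zero_left[OF bilin_tH module_H module_H module_HH]
  bilin_zero_right[OF bilin_tH module_H module_H module_HH]

sublocale HD: module K "tensor K (augmentation K D b) D" by (rule module_HD)
sublocale HH: module K "tensor K (augmentation K D b) (augmentation K D b)" by (rule module_HH)

text \<open>The target is \<open>HD\<close> since \<open>eop\<close> takes its values in
  \<open>D\<close>. If both right factors are \<open>1\<close>, the result is zero.\<close>

definition opT where
  "opT p = tensor_lift2 HD (\<lambda>h h' k k'. tD (h \<otimes>\<^bsub>H\<^esub> k) (eop p h' k'))"

lemma bilin_opT: "bilin K HH HH HD (opT p)"
    and opT_tens: "\<lbrakk>h \<in> carrier H; h' \<in> carrier H; k \<in> carrier H; k' \<in> carrier H\<rbrakk> \<Longrightarrow>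
    opT p (tH h h') (tH k k') = tD (h \<otimes>\<^bsub>H\<^esub> k) (eop p h' k')"
proof -
  have 1: "bilin K H H HD (\<lambda>k k'. tD (h \<otimes>\<^bsub>H\<^esub> k) (eop p h' k'))"
    if "h \<in> carrier H" "h' \<in> carrier H" for h h'
    using that by (intro bilin_comp[OF bilin_tD] bilinD(1)[OF H.bilin_mult] bilinD(1)[OF bilin_eop])
  have 2: "bilin K H H HD (\<lambda>k k'. tD (k \<otimes>\<^bsub>H\<^esub> h) (eop p k' h'))"
    if "h \<in> carrier H" "h' \<in> carrier H" for h h'
    using that by (intro bilin_comp[OF bilin_tD] bilinD(2)[OF H.bilin_mult] bilinD(2)[OF bilin_eop])
  show "bilin K HH HH HD (opT p)"
    unfolding opT_def by (intro bilin_tensor_lift2 module_H module_HD 1 2)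
  show "\<lbrakk>h \<in> carrier H; h' \<in> carrier H; k \<in> carrier H; k' \<in> carrier H\<rbrakk> \<Longrightarrow>
    opT p (tH h h') (tH k k') = tD (h \<otimes>\<^bsub>H\<^esub> k) (eop p h' k')"
    unfolding opT_def
    by (rule tensor_lift2_tens[OF module_H module_H module_H module_H module_HD]) (rule 1 2; assumption)+
qed

definition iota where "iota = tensor_map K H H (\<lambda>h. h) emb"

lemma iota_lin: "iota \<in> lin_hom K HD HH"
  and iota_tens: "\<lbrakk>h \<in> carrier H; x \<in> carrier D\<rbrakk> \<Longrightarrow> iota (tD h x) = tH h (emb x)"
  unfolding iota_def
  by (intro tensor_map_lin tensor_map_tens module_H module_D lin_hom_id emb_lin)+

text \<open>The augmentation ideal of \<open>H \<otimes> H\<close> is \<open>D \<otimes> 1 \<oplus> H \<otimes> D\<close>; \<open>inc\<close> is its inclusion.\<close>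

abbreviation "Q \<equiv> dsum D HD"

definition inc where "inc v = tH (emb (fst v)) \<one>\<^bsub>H\<^esub> \<oplus>\<^bsub>HH\<^esub> iota (snd v)"

text \<open>The two components do not compete: \<open>opT\<close> vanishes on two elements of
  \<open>D \<otimes> 1\<close>, and exactly there the first component supplies the value.\<close>

definition qop where "qop p v w = (b p (fst v) (fst w), opT p (inc v) (inc w))"

lemma module_Q: "module K Q"
  by (intro module_dsum module_D module_HD)

lemma inc_lin: "inc \<in> lin_hom K Q HH"
  unfolding inc_def [abs_def]
  by (intro lin_hom_plus module_HH bilin_left[OF bilin_tH] lin_hom_comp[OF emb_lin]
      lin_hom_comp[OF iota_lin] dsum_proj_lin H.one_closed)

lemma bilin_qop: "bilin K Q Q Q (qop p)"
  unfolding qop_def [abs_def]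
  by (intro bilin_dsum_pair bilin_comp[OF bilin_b] bilin_comp[OF bilin_opT] dsum_proj_lin inc_lin)

lemma inc_simps:
  "u \<in> carrier D \<Longrightarrow> inc (u, \<zero>\<^bsub>HD\<^esub>) = tH (emb u) \<one>\<^bsub>H\<^esub>"
  "\<lbrakk>h \<in> carrier H; a \<in> carrier D\<rbrakk> \<Longrightarrow> inc (\<zero>\<^bsub>D\<^esub>, tD h a) = tH h (emb a)"
  by (simp_all add: inc_def lin_hom_zero[OF module_HD module_HH iota_lin] iota_tens)

lemma qop_simps:
  "\<lbrakk>u \<in> carrier D; u' \<in> carrier D\<rbrakk> \<Longrightarrow>
    qop p (u, \<zero>\<^bsub>HD\<^esub>) (u', \<zero>\<^bsub>HD\<^esub>) = (b p u u', \<zero>\<^bsub>HD\<^esub>)"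
  "\<lbrakk>u \<in> carrier D; k \<in> carrier H; a \<in> carrier D\<rbrakk> \<Longrightarrow>
    qop p (u, \<zero>\<^bsub>HD\<^esub>) (\<zero>\<^bsub>D\<^esub>, tD k a) =
      (\<zero>\<^bsub>D\<^esub>, if p = SE then tD (emb u \<otimes>\<^bsub>H\<^esub> k) a else \<zero>\<^bsub>HD\<^esub>)"
  "\<lbrakk>u \<in> carrier D; k \<in> carrier H; a \<in> carrier D\<rbrakk> \<Longrightarrow>
    qop p (\<zero>\<^bsub>D\<^esub>, tD k a) (u, \<zero>\<^bsub>HD\<^esub>) =
      (\<zero>\<^bsub>D\<^esub>, if p = NW then tD (k \<otimes>\<^bsub>H\<^esub> emb u) a else \<zero>\<^bsub>HD\<^esub>)"
  "\<lbrakk>h \<in> carrier H; a \<in> carrier D; k \<in> carrier H; c \<in> carrier D\<rbrakk> \<Longrightarrow>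
    qop p (\<zero>\<^bsub>D\<^esub>, tD h a) (\<zero>\<^bsub>D\<^esub>, tD k c) = (\<zero>\<^bsub>D\<^esub>, tD (h \<otimes>\<^bsub>H\<^esub> k) (b p a c))"
  by (simp_all add: qop_def inc_simps opT_tens)

lemma Q_ext:
  assumes "module K P" "f \<in> lin_hom K Q P" "g \<in> lin_hom K Q P"
    and "\<And>u. u \<in> carrier D \<Longrightarrow> f (u, \<zero>\<^bsub>HD\<^esub>) = g (u, \<zero>\<^bsub>HD\<^esub>)"
      "\<And>h a. \<lbrakk>h \<in> carrier H; a \<in> carrier D\<rbrakk> \<Longrightarrow> f (\<zero>\<^bsub>D\<^esub>, tD h a) = g (\<zero>\<^bsub>D\<^esub>, tD h a)"
    and "v \<in> carrier Q"
  shows "f v = g v"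
proof (rule dsum_ext[OF module_D module_HD assms(1-4) _ assms(6)])
  fix s assume s: "s \<in> carrier HD"
  have in2: "(\<lambda>s. (\<zero>\<^bsub>D\<^esub>, s)) \<in> lin_hom K HD Q"
    by (intro dsum_pair_lin lin_hom_zero_map module_D lin_hom_id)
  show "f (\<zero>\<^bsub>D\<^esub>, s) = g (\<zero>\<^bsub>D\<^esub>, s)"
    by (rule tensor_ext[OF module_H module_D lin_hom_comp[OF assms(2) in2]
          lin_hom_comp[OF assms(3) in2] _ s]) (rule assms(5))
qed

sublocale Q: dn_module K "dsum D (tensor K (augmentation K D b) D)" qop
  by (intro dn_module.intro op_moduleI_bilin module_Q bilin_qop)

lemma tD_lsum:
  assumes "\<And>i. i \<in> set xs \<Longrightarrow> f i \<in> carrier D" "g \<in> carrier H"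
  shows "lsum HD (\<lambda>i. tD g (f i)) xs = tD g (lsum D f xs)"
  using assms by (intro lin_hom_lsum[OF module_D module_HD, symmetric] bilinD(1)[OF bilin_tD])

text \<open>Needed when two neighbouring arguments lie in \<open>D \<otimes> 1\<close>: the nine
  operations between them must add up to a product in the left factor.\<close>

lemma tD_emb_mult:
  assumes "h \<in> carrier H" "u \<in> carrier D" "u' \<in> carrier D" "a \<in> carrier D"
  shows "tD (h \<otimes>\<^bsub>H\<^esub> emb u \<otimes>\<^bsub>H\<^esub> emb u') a = lsum HD (\<lambda>p. tD (h \<otimes>\<^bsub>H\<^esub> emb (b p u u')) a) all_ops"
    "tD (emb u \<otimes>\<^bsub>H\<^esub> (emb u' \<otimes>\<^bsub>H\<^esub> h)) a = lsum HD (\<lambda>p. tD (emb (b p u u') \<otimes>\<^bsub>H\<^esub> h) a) all_ops"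
proof -
  have l: "(\<lambda>x. tD (h \<otimes>\<^bsub>H\<^esub> emb x) a) \<in> lin_hom K D HD"
    "(\<lambda>x. tD (emb x \<otimes>\<^bsub>H\<^esub> h) a) \<in> lin_hom K D HD"
    using assms
    by (intro bilin_left[OF bilin_tD] bilin_left[OF H.bilin_mult] bilin_right[OF H.bilin_mult] emb_lin; simp)+
  show "tD (h \<otimes>\<^bsub>H\<^esub> emb u \<otimes>\<^bsub>H\<^esub> emb u') a = lsum HD (\<lambda>p. tD (h \<otimes>\<^bsub>H\<^esub> emb (b p u u')) a) all_ops"
    using lin_hom_lsum[OF module_D module_HD l(1), of all_ops "\<lambda>p. b p u u'"] assms
    by (simp add: H.m_assoc emb_mult star_def)
  show "tD (emb u \<otimes>\<^bsub>H\<^esub> (emb u' \<otimes>\<^bsub>H\<^esub> h)) a = lsum HD (\<lambda>p. tD (emb (b p u u') \<otimes>\<^bsub>H\<^esub> h) a) all_ops"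
    using lin_hom_lsum[OF module_D module_HD l(2), of all_ops "\<lambda>p. b p u u'"] assms
    by (simp add: emb_mult star_def flip: H.m_assoc)
qed

lemma qop_zero [simp]:
  "v \<in> carrier Q \<Longrightarrow> qop p (\<zero>\<^bsub>D\<^esub>, \<zero>\<^bsub>HD\<^esub>) v = (\<zero>\<^bsub>D\<^esub>, \<zero>\<^bsub>HD\<^esub>)"
  "v \<in> carrier Q \<Longrightarrow> qop p v (\<zero>\<^bsub>D\<^esub>, \<zero>\<^bsub>HD\<^esub>) = (\<zero>\<^bsub>D\<^esub>, \<zero>\<^bsub>HD\<^esub>)"
  using bilin_zero_left[OF bilin_qop module_Q module_Q module_Q]
    bilin_zero_right[OF bilin_qop module_Q module_Q module_Q] by simp_all

definition pure :: "'d \<times> ('k, unit, ('k \<times> 'd) \<times> 'd) lterm set \<Rightarrow> bool"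
  where "pure v \<longleftrightarrow> (\<exists>u\<in>carrier D. v = (u, \<zero>\<^bsub>HD\<^esub>)) \<or>
    (\<exists>h\<in>carrier H. \<exists>a\<in>carrier D. v = (\<zero>\<^bsub>D\<^esub>, tD h a))"

lemma pure_left: "u \<in> carrier D \<Longrightarrow> pure (u, \<zero>\<^bsub>HD\<^esub>)"
  unfolding pure_def by (rule disjI1, rule bexI, rule HOL.refl)

lemma pure_right: "\<lbrakk>h \<in> carrier H; a \<in> carrier D\<rbrakk> \<Longrightarrow> pure (\<zero>\<^bsub>D\<^esub>, tD h a)"
  unfolding pure_def by (rule disjI2, rule bexI[where x = h], rule bexI[where x = a], rule HOL.refl)

lemma pure_closed: "pure v \<Longrightarrow> v \<in> carrier Q"
  by (auto simp: pure_def)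

lemma pure_ext:
  assumes "f \<in> lin_hom K Q Q" "g \<in> lin_hom K Q Q" "\<And>v. pure v \<Longrightarrow> f v = g v" "v \<in> carrier Q"
  shows "f v = g v"
  by (rule Q_ext[OF module_Q assms(1,2) assms(3)[OF pure_left] assms(3)[OF pure_right] assms(4)])

text \<open>In the case names, \<open>A\<close> marks an argument \<open>u \<otimes> 1\<close> and
  \<open>M\<close> an argument \<open>h \<otimes> a\<close>. The unit is thus the right factor at
  each \<open>A\<close>. With exactly one \<open>A\<close>, the unit action turns both sides of
  every relation into the same expression, without use of the relations of \<open>D\<close>. With
  two of them, only the relation containing the monomial that survives the unit action is not
  trivially \<open>0 = 0\<close>.\<close>

lemma Q_identity_cases:
  assumes LR: "(L, R) \<in> set dn_list"
    and D: "u \<in> carrier D" "u' \<in> carrier D" "u'' \<in> carrier D"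
      "a \<in> carrier D" "a' \<in> carrier D" "a'' \<in> carrier D"
    and H: "h \<in> carrier H" "h' \<in> carrier H" "h'' \<in> carrier H"
  shows "dn_lhs Q qop L (u, \<zero>\<^bsub>HD\<^esub>) (u', \<zero>\<^bsub>HD\<^esub>) (u'', \<zero>\<^bsub>HD\<^esub>) =
      dn_rhs Q qop R (u, \<zero>\<^bsub>HD\<^esub>) (u', \<zero>\<^bsub>HD\<^esub>) (u'', \<zero>\<^bsub>HD\<^esub>)" (is ?AAA)
    and "dn_lhs Q qop L (\<zero>\<^bsub>D\<^esub>, tD h a) (\<zero>\<^bsub>D\<^esub>, tD h' a') (\<zero>\<^bsub>D\<^esub>, tD h'' a'') =
      dn_rhs Q qop R (\<zero>\<^bsub>D\<^esub>, tD h a) (\<zero>\<^bsub>D\<^esub>, tD h' a') (\<zero>\<^bsub>D\<^esub>, tD h'' a'')" (is ?MMM)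
    and "dn_lhs Q qop L (\<zero>\<^bsub>D\<^esub>, tD h a) (\<zero>\<^bsub>D\<^esub>, tD h' a') (u'', \<zero>\<^bsub>HD\<^esub>) =
      dn_rhs Q qop R (\<zero>\<^bsub>D\<^esub>, tD h a) (\<zero>\<^bsub>D\<^esub>, tD h' a') (u'', \<zero>\<^bsub>HD\<^esub>)" (is ?MMA)
    and "dn_lhs Q qop L (\<zero>\<^bsub>D\<^esub>, tD h a) (u', \<zero>\<^bsub>HD\<^esub>) (\<zero>\<^bsub>D\<^esub>, tD h'' a'') =
      dn_rhs Q qop R (\<zero>\<^bsub>D\<^esub>, tD h a) (u', \<zero>\<^bsub>HD\<^esub>) (\<zero>\<^bsub>D\<^esub>, tD h'' a'')" (is ?MAM)
    and "dn_lhs Q qop L (u, \<zero>\<^bsub>HD\<^esub>) (\<zero>\<^bsub>D\<^esub>, tD h' a') (\<zero>\<^bsub>D\<^esub>, tD h'' a'') =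
      dn_rhs Q qop R (u, \<zero>\<^bsub>HD\<^esub>) (\<zero>\<^bsub>D\<^esub>, tD h' a') (\<zero>\<^bsub>D\<^esub>, tD h'' a'')" (is ?AMM)
    and "dn_lhs Q qop L (\<zero>\<^bsub>D\<^esub>, tD h a) (u', \<zero>\<^bsub>HD\<^esub>) (u'', \<zero>\<^bsub>HD\<^esub>) =
      dn_rhs Q qop R (\<zero>\<^bsub>D\<^esub>, tD h a) (u', \<zero>\<^bsub>HD\<^esub>) (u'', \<zero>\<^bsub>HD\<^esub>)" (is ?MAA)
    and "dn_lhs Q qop L (u, \<zero>\<^bsub>HD\<^esub>) (\<zero>\<^bsub>D\<^esub>, tD h' a') (u'', \<zero>\<^bsub>HD\<^esub>) =
      dn_rhs Q qop R (u, \<zero>\<^bsub>HD\<^esub>) (\<zero>\<^bsub>D\<^esub>, tD h' a') (u'', \<zero>\<^bsub>HD\<^esub>)" (is ?AMA)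
    and "dn_lhs Q qop L (u, \<zero>\<^bsub>HD\<^esub>) (u', \<zero>\<^bsub>HD\<^esub>) (\<zero>\<^bsub>D\<^esub>, tD h'' a'') =
      dn_rhs Q qop R (u, \<zero>\<^bsub>HD\<^esub>) (u', \<zero>\<^bsub>HD\<^esub>) (\<zero>\<^bsub>D\<^esub>, tD h'' a'')" (is ?AAM)
proof -
  note DH = D H dn_lhs_def dn_rhs_def case_prod_unfold
  show ?AAA
    using dn_list_identity[OF D(1-3) LR]
    by (simp add: DH qop_simps lsum_dsum HD.lsum_zero lsum_zero)
  \<comment> \<open>All monomials have the same left factor by associativity in \<open>H\<close>,
    which leaves the relation between the right factors.\<close>
  have "lsum D (\<lambda>x. b (snd x) (b (fst x) a a') a'') L = lsum D (\<lambda>x. b (fst x) a (b (snd x) a' a'')) R"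
    using dn_list_identity[OF D(4-6) LR] by (simp add: dn_lhs_def dn_rhs_def case_prod_unfold)
  then show ?MMM
    by (simp add: DH qop_simps lsum_dsum tD_lsum lsum_zero H.m_assoc)
  show ?MMA
    using LR unfolding dn_list_unfold dn_lhs_def dn_rhs_def
    by (auto simp: DH qop_simps H.m_assoc)
  show ?MAM
    using LR unfolding dn_list_unfold dn_lhs_def dn_rhs_def
    by (auto simp: DH qop_simps H.m_assoc)
  show ?AMM
    using LR unfolding dn_list_unfold dn_lhs_def dn_rhs_def
    by (auto simp: DH qop_simps H.m_assoc)
  \<comment> \<open>Here \<open>NW\<close> must act from the left: only the relation whose right
    side runs over all \<open>(NW, q)\<close> matters, and its nine left factors add up to a
    product.\<close>
  show ?MAA
    using LR unfolding dn_list_unfold dn_lhs_def dn_rhs_def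
    by (auto simp: DH qop_simps tD_emb_mult all_ops_def)
  \<comment> \<open>Only \<open>(x \<searrow> y) \<nwarrow> z = x \<searrow> (y \<nwarrow>
    z)\<close> contributes, and it reduces to associativity of the left factors.\<close>
  show ?AMA
    using LR unfolding dn_list_unfold dn_lhs_def dn_rhs_def
    by (auto simp: DH qop_simps H.m_assoc)
  \<comment> \<open>The mirror image of the case \<open>MAA\<close>, with \<open>SE\<close> and the
    relation whose left side runs over all \<open>(p, SE)\<close>.\<close>
  show ?AAM
    using LR unfolding dn_list_unfold dn_lhs_def dn_rhs_def
    by (auto simp: DH qop_simps tD_emb_mult all_ops_def)
qed

lemma Q_identity_pure:
  assumes LR: "(L, R) \<in> set dn_list" and vwx: "pure v" "pure w" "pure x"
  shows "dn_lhs Q qop L v w x = dn_rhs Q qop R v w x"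
  using vwx unfolding pure_def
  by (elim disjE bexE)
    (hypsubst, rule Q_identity_cases[OF LR]; (assumption | rule M.zero_closed H.one_closed))+

text \<open>Trilinearity frees the arguments from being pure one after the other, beginning with the
  last.\<close>

lemma Q_identity:
  assumes LR: "(L, R) \<in> set dn_list" and v: "v \<in> carrier Q" "w \<in> carrier Q" "x \<in> carrier Q"
  shows "dn_lhs Q qop L v w x = dn_rhs Q qop R v w x"
proof -
  have 2: "dn_lhs Q qop L v w x = dn_rhs Q qop R v w x" if "pure v" "pure w" "x \<in> carrier Q" for v w x
    by (rule pure_ext[where f = "\<lambda>x. dn_lhs Q qop L v w x" and g = "\<lambda>x. dn_rhs Q qop R v w x"])
      (intro Q.dn_lhs_lin Q.dn_rhs_lin Q_identity_pure LR pure_closed that | assumption)+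
  have 1: "dn_lhs Q qop L v w x = dn_rhs Q qop R v w x"
    if "pure v" "w \<in> carrier Q" "x \<in> carrier Q" for v w x
    by (rule pure_ext[where f = "\<lambda>w. dn_lhs Q qop L v w x" and g = "\<lambda>w. dn_rhs Q qop R v w x"])
      (intro Q.dn_lhs_lin Q.dn_rhs_lin 2 pure_closed that | assumption)+
  show ?thesis
    by (rule pure_ext[where f = "\<lambda>v. dn_lhs Q qop L v w x" and g = "\<lambda>v. dn_rhs Q qop R v w x"])
      (intro Q.dn_lhs_lin Q.dn_rhs_lin 1 pure_closed v | assumption)+
qed

theorem dn_algebra_Q: "dn_algebra K Q qop"
proof (intro dn_algebra.intro dn_algebra_axioms.intro Q.op_module_axioms)
  fix v w x l r
  assume vwx: "v \<in> carrier Q" "w \<in> carrier Q" "x \<in> carrier Q"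
    and lr: "(l, r) \<in> dn_identities (add Q) qop v w x"
  have "\<forall>(L, R)\<in>set dn_list. dn_lhs Q qop L v w x = dn_rhs Q qop R v w x"
    using Q_identity[OF _ vwx] by blast
  then have "\<forall>(l, r)\<in>dn_identities (add Q) qop v w x. l = r"
    by (rule iffD2[OF Q.dn_identities_iff[OF vwx]])
  from bspec[OF this lr] show "l = r" by simp
qed

end

section \<open>The commutative case\<close>

primrec flip :: "dn_op \<Rightarrow> dn_op"
  where "flip SE = NW" | "flip NW = SE" | "flip NE = SW" | "flip SW = NE" | "flip Up = Down"
  | "flip Down = Up" | "flip Succ = Prec" | "flip Prec = Succ" | "flip Bullet = Bullet"

text \<open>The five identities name only one operation of each exchanged pair; the other is reached
  by interchanging \<open>x\<close> and \<open>y\<close>, hence the quantification over both. The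
  uniform statement in \<open>p\<close> avoids later case distinctions.\<close>

lemma dn_comm_identities_iff:
  "(\<forall>x\<in>A. \<forall>y\<in>A. \<forall>(l, r)\<in>dn_comm_identities b x y. l = r) \<longleftrightarrow>
    (\<forall>p. \<forall>x\<in>A. \<forall>y\<in>A. b p x y = b (flip p) y x)" (is "?L \<longleftrightarrow> ?R")
proof
  assume L: ?L
  show ?R
  proof (intro allI ballI)
    fix p x y assume "x \<in> A" "y \<in> A"
    then have "\<forall>(l, r)\<in>dn_comm_identities b x y. l = r" "\<forall>(l, r)\<in>dn_comm_identities b y x. l = r"
      by - (rule L[THEN bspec, THEN bspec]; assumption)+
    then show "b p x y = b (flip p) y x"
      unfolding dn_comm_identities_def by (cases p) auto
  qed
next
  assume R: ?R
  have "b p x y = b (flip p) y x" if "x \<in> A" "y \<in> A" for p x y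
    using R that by blast
  from this[where p = SE] this[where p = NE] this[where p = Up] this[where p = Succ]
    this[where p = Bullet]
  show ?L
    unfolding dn_comm_identities_def flip.simps by blast
qed

context comm_dn_algebra
begin

lemma b_flip:
  assumes "x \<in> carrier D" "y \<in> carrier D"
  shows "b p x y = b (flip p) y x"
proof -
  have "\<forall>x\<in>carrier D. \<forall>y\<in>carrier D. \<forall>(l, r)\<in>dn_comm_identities b x y. l = r"
    using dn_comm_identities by (simp add: case_prod_unfold)
  then have "\<forall>p. \<forall>x\<in>carrier D. \<forall>y\<in>carrier D. b p x y = b (flip p) y x"
    by (rule iffD1[OF dn_comm_identities_iff])
  from this[THEN spec, THEN bspec, THEN bspec, OF assms] show ?thesis .
qed

lemma star_comm:
  assumes "x \<in> carrier D" "y \<in> carrier D"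
  shows "star x y = star y x"
proof -
  have "star x y = lsum D (\<lambda>p. b (flip p) y x) all_ops"
    unfolding star_def by (intro lsum_cong b_flip assms)
  also have "\<dots> = star y x"
    using assms by (simp add: star_def all_ops_def M.a_ac)
  finally show ?thesis .
qed

lemma H_comm:
  assumes "h \<in> carrier H" "k \<in> carrier H"
  shows "h \<otimes>\<^bsub>H\<^esub> k = k \<otimes>\<^bsub>H\<^esub> h"
  using assms by (auto simp: H_simps(1) R.m_comm star_comm M.a_ac)

text \<open>The unit action respects the passage to the opposite structure, because
  \<open>flip\<close> exchanges \<open>SE\<close> and \<open>NW\<close>, the two operations with
  nonzero unit values.\<close>

lemma eop_flip:
  assumes "h \<in> carrier H" "k \<in> carrier H"
  shows "eop p h k = eop (flip p) k h"
  using assms b_flip[of "snd h" "snd k" p]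
  by (cases p) (auto simp: eop_def H_simps(1) M.a_ac)

lemma opT_flip:
  assumes s: "s \<in> carrier HH" and t: "t \<in> carrier HH"
  shows "opT p s t = opT (flip p) t s"
proof (rule tensor_ext[OF module_H module_H bilinD(2)[OF bilin_opT t] bilinD(1)[OF bilin_opT t] _ s])
  fix h h' assume h: "h \<in> carrier H" "h' \<in> carrier H"
  then have th: "tH h h' \<in> carrier HH" by simp
  show "opT p (tH h h') t = opT (flip p) t (tH h h')"
  proof (rule tensor_ext[OF module_H module_H bilinD(1)[OF bilin_opT th] bilinD(2)[OF bilin_opT th] _ t])
    fix k k' assume k: "k \<in> carrier H" "k' \<in> carrier H"
    show "opT p (tH h h') (tH k k') = opT (flip p) (tH k k') (tH h h')"
      by (simp only: opT_tens h k H_comm[OF h(1) k(1)] eop_flip[OF h(2) k(2), of p])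
  qed
qed

theorem comm_dn_algebra_Q: "comm_dn_algebra K Q qop"
proof (intro comm_dn_algebra.intro comm_dn_algebra_axioms.intro dn_algebra_Q)
  have "\<forall>p. \<forall>v\<in>carrier Q. \<forall>w\<in>carrier Q. qop p v w = qop (flip p) w v"
  proof (intro allI ballI)
    fix p v w assume v: "v \<in> carrier Q" and w: "w \<in> carrier Q"
    then have "fst v \<in> carrier D" "fst w \<in> carrier D" by auto
    then show "qop p v w = qop (flip p) w v"
      unfolding qop_def prod.inject
      by (intro conjI b_flip opT_flip lin_hom_closed[OF inc_lin] v w)
  qed
  then have *: "\<forall>v\<in>carrier Q. \<forall>w\<in>carrier Q. \<forall>(l, r)\<in>dn_comm_identities qop v w. l = r"
    by (rule iffD2[OF dn_comm_identities_iff])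
  show "l = r" if "v \<in> carrier Q" "w \<in> carrier Q" "(l, r) \<in> dn_comm_identities qop v w" for v w l r
    using *[THEN bspec, OF that(1), THEN bspec, OF that(2), THEN bspec, OF that(3)] by simp
qed

end

section \<open>The coproduct\<close>

context dn_algebra
begin

definition op2 where "op2 p s t = iota (opT p s t)"

lemma bilin_op2: "bilin K HH HH HH (op2 p)"
  unfolding op2_def [abs_def] by (rule bilin_post[OF bilin_opT iota_lin])

lemma op2_tens: "\<lbrakk>h \<in> carrier H; h' \<in> carrier H; k \<in> carrier H; k' \<in> carrier H\<rbrakk> \<Longrightarrow>
    op2 p (tH h h') (tH k k') = tH (h \<otimes>\<^bsub>H\<^esub> k) (emb (eop p h' k'))"
  by (simp add: op2_def opT_tens iota_tens)

definition right_counit where "right_counit = tensor_lift H (\<lambda>y z. fst z \<odot>\<^bsub>H\<^esub> y)"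

definition left_counit where "left_counit = tensor_lift H (\<lambda>y z. fst y \<odot>\<^bsub>H\<^esub> z)"

lemma bilin_left_counit: "bilin K H H H (\<lambda>y z. fst y \<odot>\<^bsub>H\<^esub> z)"
  by (rule bilin_comp[OF bilin_smult[OF module_H] fst_H_lin lin_hom_id])

lemmas right_counit_lin = tensor_lift_lin[OF module_H bilin_flip[OF bilin_left_counit],
    folded right_counit_def]
  and right_counit_tens = tensor_lift_tens[OF module_H bilin_flip[OF bilin_left_counit],
    folded right_counit_def]
  and left_counit_lin = tensor_lift_lin[OF module_H bilin_left_counit, folded left_counit_def]
  and left_counit_tens = tensor_lift_tens[OF module_H bilin_left_counit, folded left_counit_def]

abbreviation (input) mulHH :: "_ \<Rightarrow> _ \<Rightarrow> ('k, unit, ('k \<times> 'd) \<times> ('k \<times> 'd)) lterm set"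
  where "mulHH \<equiv> tensor_lift2 HH (\<lambda>x y x' y'. tH (x \<otimes>\<^bsub>H\<^esub> x') (y \<otimes>\<^bsub>H\<^esub> y'))"

lemma bilin_mulHH: "bilin K HH HH HH mulHH"
  and mulHH_tens: "\<lbrakk>h \<in> carrier H; h' \<in> carrier H; k \<in> carrier H; k' \<in> carrier H\<rbrakk> \<Longrightarrow>
    mulHH (tH h h') (tH k k') = tH (h \<otimes>\<^bsub>H\<^esub> k) (h' \<otimes>\<^bsub>H\<^esub> k')"
proof -
  have 1: "bilin K H H HH (\<lambda>k k'. tH (h \<otimes>\<^bsub>H\<^esub> k) (h' \<otimes>\<^bsub>H\<^esub> k'))"
    if "h \<in> carrier H" "h' \<in> carrier H" for h h'
    using that by (intro bilin_comp[OF bilin_tH] bilinD(1)[OF H.bilin_mult])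
  have 2: "bilin K H H HH (\<lambda>k k'. tH (k \<otimes>\<^bsub>H\<^esub> h) (k' \<otimes>\<^bsub>H\<^esub> h'))"
    if "h \<in> carrier H" "h' \<in> carrier H" for h h'
    using that by (intro bilin_comp[OF bilin_tH] bilinD(2)[OF H.bilin_mult])
  show "bilin K HH HH HH mulHH"
    by (intro bilin_tensor_lift2 module_H module_HH 1 2)
  show "\<lbrakk>h \<in> carrier H; h' \<in> carrier H; k \<in> carrier H; k' \<in> carrier H\<rbrakk> \<Longrightarrow>
    mulHH (tH h h') (tH k k') = tH (h \<otimes>\<^bsub>H\<^esub> k) (h' \<otimes>\<^bsub>H\<^esub> k')"
    by (rule tensor_lift2_tens[OF module_H module_H module_H module_H module_HH]) (rule 1 2; assumption)+
qed

text \<open>This is \<open>mult_eop\<close> applied to the right factors. Its scalar term, moved to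
  the left factors, becomes the product of the two right counits.\<close>

lemma mulHH_op2:
  assumes s: "s \<in> carrier HH" and t: "t \<in> carrier HH"
  shows "mulHH s t = lsum HH (\<lambda>p. op2 p s t) all_ops \<oplus>\<^bsub>HH\<^esub>
    tH (right_counit s \<otimes>\<^bsub>H\<^esub> right_counit t) \<one>\<^bsub>H\<^esub>" (is "_ = ?r s t")
proof -
  have r: "bilin K HH HH HH ?r"
    by (intro bilin_plus bilin_lsum module_HH bilin_op2
        bilin_post[OF bilin_comp[OF H.bilin_mult right_counit_lin right_counit_lin] bilinD(2)[OF bilin_tH]])
      simp
  have pure: "mulHH (tH h h') (tH k k') = ?r (tH h h') (tH k k')"
    if H: "h \<in> carrier H" "h' \<in> carrier H" "k \<in> carrier H" "k' \<in> carrier H" for h h' k k'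
  proof -
    have fc: "fst h' \<in> carrier K" "fst k' \<in> carrier K"
      using H by (auto simp: H_simps(1))
    have l: "lsum HH (\<lambda>p. tH (h \<otimes>\<^bsub>H\<^esub> k) (emb (eop p h' k'))) all_ops =
        tH (h \<otimes>\<^bsub>H\<^esub> k) (lsum H (\<lambda>p. emb (eop p h' k')) all_ops)"
      using H by (intro lin_hom_lsum[OF module_H module_HH, symmetric] bilinD(1)[OF bilin_tH]) auto
    have c: "lsum H (\<lambda>p. emb (eop p h' k')) all_ops \<in> carrier H"
      using H by (intro H.lsum_closed) simp
    \<comment> \<open>The counit values of the right factors cross the tensor sign.\<close>
    have "tH ((fst h' \<odot>\<^bsub>H\<^esub> h) \<otimes>\<^bsub>H\<^esub> (fst k' \<odot>\<^bsub>H\<^esub> k)) \<one>\<^bsub>H\<^esub> =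
        tH (h \<otimes>\<^bsub>H\<^esub> k) ((fst h' \<otimes>\<^bsub>K\<^esub> fst k') \<odot>\<^bsub>H\<^esub> \<one>\<^bsub>H\<^esub>)"
      using H fc
      by (simp add: H.smult_mult_left H.smult_mult_right bilin_smult_left[OF bilin_tH]
          bilin_smult_right[OF bilin_tH] R.m_comm flip: HH.smult_assoc1)
    then show ?thesis
      using H fc c
      by (simp add: mulHH_tens op2_tens right_counit_tens l mult_eop[of h' k']
          bilin_add_right[OF bilin_tH])
  qed
  show ?thesis
  proof (rule tensor_ext[OF module_H module_H bilinD(2)[OF bilin_mulHH t] bilinD(2)[OF r t] _ s])
    fix h h' assume h: "h \<in> carrier H" "h' \<in> carrier H"
    then have th: "tH h h' \<in> carrier HH" by simp
    show "mulHH (tH h h') t = ?r (tH h h') t"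
      by (rule tensor_ext[OF module_H module_H bilinD(1)[OF bilin_mulHH th] bilinD(1)[OF r th] _ t])
        (rule pure[OF h])
  qed
qed

text \<open>The left factors are multiplied and the counit is multiplicative, so applying it there
  leaves the operation on the right factors.\<close>

lemma left_counit_op2:
  assumes s: "s \<in> carrier HH" and t: "t \<in> carrier HH"
  shows "left_counit (op2 p s t) = emb (eop p (left_counit s) (left_counit t))" (is "?l s t = ?r s t")
proof -
  have l: "bilin K HH HH H ?l"
    by (rule bilin_post[OF bilin_op2 left_counit_lin])
  have r: "bilin K HH HH H ?r"
    by (rule bilin_post[OF bilin_comp[OF bilin_eop left_counit_lin left_counit_lin] emb_lin])
  show ?thesis
  proof (rule tensor_ext[OF module_H module_H bilinD(2)[OF l t] bilinD(2)[OF r t] _ s])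
    fix h h' assume h: "h \<in> carrier H" "h' \<in> carrier H"
    then have th: "tH h h' \<in> carrier HH" by simp
    show "?l (tH h h') t = ?r (tH h h') t"
    proof (rule tensor_ext[OF module_H module_H bilinD(1)[OF l th] bilinD(1)[OF r th] _ t])
      fix k k' assume k: "k \<in> carrier H" "k' \<in> carrier H"
      have "fst h \<in> carrier K" "fst k \<in> carrier K" "fst (h \<otimes>\<^bsub>H\<^esub> k) = fst h \<otimes>\<^bsub>K\<^esub> fst k"
        using h k by (auto simp: H_simps(1))
      then show "?l (tH h h') (tH k k') = ?r (tH h h') (tH k k')"
        using h k by (simp add: op2_tens left_counit_tens bilin_smult_left[OF bilin_eop]
            bilin_smult_right[OF bilin_eop] lin_hom_smult[OF emb_lin] R.m_comm flip: H.smult_assoc1)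
    qed
  qed
qed

abbreviation "HHH \<equiv> tensor K H HH"
abbreviation "tHH \<equiv> tens K H HH"

lemma module_HHH: "module K HHH"
  by (intro module_tensor R.is_cring)

sublocale HHH: module K "tensor K (augmentation K D b) (tensor K (augmentation K D b) (augmentation K D b))"
  by (rule module_HHH)

lemmas bilin_tHH = bilin_tens[OF module_H module_HH]
lemmas tHH_closed [simp] = bilin_closed[OF bilin_tHH]
lemmas op2_closed [simp] = bilin_closed[OF bilin_op2]

text \<open>The analogue of \<open>op2\<close> on three factors: since \<open>op2\<close> multiplies
  its own left factors, the first two factors are multiplied and \<open>p\<close> acts on the
  third.\<close>

definition op3 where
  "op3 p = tensor_lift2 HHH (\<lambda>h s k t. tHH (h \<otimes>\<^bsub>H\<^esub> k) (op2 p s t))"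

lemma bilin_op3: "bilin K HHH HHH HHH (op3 p)"
  and op3_tens: "\<lbrakk>h \<in> carrier H; s \<in> carrier HH; k \<in> carrier H; t \<in> carrier HH\<rbrakk> \<Longrightarrow>
    op3 p (tHH h s) (tHH k t) = tHH (h \<otimes>\<^bsub>H\<^esub> k) (op2 p s t)"
proof -
  have 1: "bilin K H HH HHH (\<lambda>k t. tHH (h \<otimes>\<^bsub>H\<^esub> k) (op2 p s t))"
    if "h \<in> carrier H" "s \<in> carrier HH" for h s
    using that by (intro bilin_comp[OF bilin_tHH] bilinD(1)[OF H.bilin_mult] bilinD(1)[OF bilin_op2])
  have 2: "bilin K H HH HHH (\<lambda>k t. tHH (k \<otimes>\<^bsub>H\<^esub> h) (op2 p t s))"
    if "h \<in> carrier H" "s \<in> carrier HH" for h s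
    using that by (intro bilin_comp[OF bilin_tHH] bilinD(2)[OF H.bilin_mult] bilinD(2)[OF bilin_op2])
  show "bilin K HHH HHH HHH (op3 p)"
    unfolding op3_def by (intro bilin_tensor_lift2 module_H module_HH module_HHH 1 2)
  show "\<lbrakk>h \<in> carrier H; s \<in> carrier HH; k \<in> carrier H; t \<in> carrier HH\<rbrakk> \<Longrightarrow>
    op3 p (tHH h s) (tHH k t) = tHH (h \<otimes>\<^bsub>H\<^esub> k) (op2 p s t)"
    unfolding op3_def
    by (rule tensor_lift2_tens[OF module_H module_HH module_H module_HH module_HHH]) (rule 1 2; assumption)+
qed

end

text \<open>What the free and the free commutative algebra have in common, so that the bialgebra is
  built once. In the splitting of the augmentation ideal, the prescribed value on a generator is
  \<open>g \<otimes> 1 + 1 \<otimes> g\<close>.\<close>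

locale dn_coalgebra = dn_algebra K D b
  for K :: "('k, 'm) ring_scheme" and D :: "('k, 'd, 'n) module_scheme"
    and b :: "dn_op \<Rightarrow> 'd \<Rightarrow> 'd \<Rightarrow> 'd" +
  fixes G :: "'d set" and \<delta>
  assumes gens: "G \<subseteq> carrier D"
    and generate: "\<lbrakk>submodule W K D; G \<subseteq> W; \<And>p x y. \<lbrakk>x \<in> W; y \<in> W\<rbrakk> \<Longrightarrow> b p x y \<in> W\<rbrakk> \<Longrightarrow>
      carrier D \<subseteq> W"
    and \<delta>_hom: "\<delta> \<in> op_hom K UNIV D b Q qop"
    and \<delta>_gen: "g \<in> G \<Longrightarrow> \<delta> g = (g, tD \<one>\<^bsub>H\<^esub> g)"
begin

lemma \<delta>_lin: "\<delta> \<in> lin_hom K D Q"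
  using \<delta>_hom by (simp add: op_hom_def)

lemma \<delta>_op: "\<lbrakk>x \<in> carrier D; y \<in> carrier D\<rbrakk> \<Longrightarrow> \<delta> (b p x y) = qop p (\<delta> x) (\<delta> y)"
  using \<delta>_hom by (simp add: op_hom_def)

lemma lin_hom_eq_generate:
  assumes "module K M" "f \<in> lin_hom K D M" "g \<in> lin_hom K D M" "\<And>x. x \<in> G \<Longrightarrow> f x = g x"
    and "\<And>p x y. \<lbrakk>x \<in> carrier D; y \<in> carrier D; f x = g x; f y = g y\<rbrakk> \<Longrightarrow> f (b p x y) = g (b p x y)"
    and "x \<in> carrier D"
  shows "f x = g x"
proof -
  let ?W = "{x \<in> carrier D. f x = g x}"
  have "submodule ?W K D"
    by (rule submoduleI'[OF module_D])
      (use assms(2,3) in \<open>auto simp: lin_homD lin_hom_zero[OF module_D assms(1)]\<close>)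
  moreover have "G \<subseteq> ?W"
    using gens assms(4) by auto
  ultimately have "carrier D \<subseteq> ?W"
    by (rule generate) (use assms(5) in auto)
  then show ?thesis using assms(6) by blast
qed

text \<open>First components multiply as in \<open>D\<close>, so this is an endomorphism of
  \<open>D\<close> that fixes the generators. It accounts for the summand
  \<open>x \<otimes> 1\<close> of every coproduct.\<close>

lemma fst_\<delta>: "x \<in> carrier D \<Longrightarrow> fst (\<delta> x) = x"
  by (rule lin_hom_eq_generate[OF module_D lin_hom_comp[OF dsum_proj_lin(1) \<delta>_lin] lin_hom_id])
    (simp_all add: \<delta>_gen \<delta>_op qop_def)

definition cop :: "'k \<times> 'd \<Rightarrow> ('k, unit, ('k \<times> 'd) \<times> ('k \<times> 'd)) lterm set"
  where "cop h = fst h \<odot>\<^bsub>HH\<^esub> tH \<one>\<^bsub>H\<^esub> \<one>\<^bsub>H\<^esub> \<oplus>\<^bsub>HH\<^esub> inc (\<delta> (snd h))"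

lemma cop_lin: "cop \<in> lin_hom K H HH"
  unfolding cop_def [abs_def]
  by (intro lin_hom_plus module_HH lin_hom_smult_left fst_H_lin lin_hom_comp[OF inc_lin]
      lin_hom_comp[OF \<delta>_lin] snd_H_lin) simp

lemmas cop_closed [simp] = lin_hom_closed[OF cop_lin]
lemmas inc_\<delta>_closed [simp] = lin_hom_closed[OF lin_hom_comp[OF inc_lin \<delta>_lin]]

lemma \<delta>_closed: "x \<in> carrier D \<Longrightarrow> snd (\<delta> x) \<in> carrier HD"
  using lin_hom_closed[OF \<delta>_lin, of x] by auto

lemma cop_one: "cop \<one>\<^bsub>H\<^esub> = tH \<one>\<^bsub>H\<^esub> \<one>\<^bsub>H\<^esub>"
  using lin_hom_zero[OF module_D module_HH lin_hom_comp[OF inc_lin \<delta>_lin]]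
  by (simp add: cop_def H_simps(2)) (simp flip: H_simps(2))

lemma cop_emb: "x \<in> carrier D \<Longrightarrow> cop (emb x) = inc (\<delta> x)"
  by (simp add: cop_def emb_def)

lemma cop_emb': "x \<in> carrier D \<Longrightarrow> cop (emb x) = tH (emb x) \<one>\<^bsub>H\<^esub> \<oplus>\<^bsub>HH\<^esub> iota (snd (\<delta> x))"
  by (simp add: cop_emb inc_def fst_\<delta>)

lemma cop_op:
  assumes "x \<in> carrier D" "y \<in> carrier D"
  shows "cop (emb (b p x y)) = tH (emb (b p x y)) \<one>\<^bsub>H\<^esub> \<oplus>\<^bsub>HH\<^esub> op2 p (cop (emb x)) (cop (emb y))"
  using assms by (simp add: cop_emb \<delta>_op) (simp add: inc_def qop_def op2_def fst_\<delta>)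

lemma op2_one_iota:
  assumes s: "s \<in> carrier HD"
  shows "op2 p (tH \<one>\<^bsub>H\<^esub> \<one>\<^bsub>H\<^esub>) (iota s) = (if p = SE then iota s else \<zero>\<^bsub>HH\<^esub>)"
    and "op2 p (iota s) (tH \<one>\<^bsub>H\<^esub> \<one>\<^bsub>H\<^esub>) = (if p = NW then iota s else \<zero>\<^bsub>HH\<^esub>)"
proof -
  have if_lin: "(\<lambda>s. if c then iota s else \<zero>\<^bsub>HH\<^esub>) \<in> lin_hom K HD HH" for c
    using iota_lin lin_hom_zero_map[OF module_HH] by (cases c) simp_all
  show "op2 p (tH \<one>\<^bsub>H\<^esub> \<one>\<^bsub>H\<^esub>) (iota s) = (if p = SE then iota s else \<zero>\<^bsub>HH\<^esub>)"
    by (rule tensor_ext[OF module_H module_D bilin_right[OF bilin_op2 _ iota_lin] if_lin _ s])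
      (simp_all add: op2_tens iota_tens)
  show "op2 p (iota s) (tH \<one>\<^bsub>H\<^esub> \<one>\<^bsub>H\<^esub>) = (if p = NW then iota s else \<zero>\<^bsub>HH\<^esub>)"
    by (rule tensor_ext[OF module_H module_D bilin_left[OF bilin_op2 _ iota_lin] if_lin _ s])
      (simp_all add: op2_tens iota_tens)
qed

text \<open>When one argument is the unit, say on the left, \<open>op2\<close> loses the summand
  \<open>y \<otimes> 1\<close>, two units meeting in the right factor, and keeps the rest exactly
  for \<open>SE\<close>. The correction term puts the lost summand back.\<close>

lemma cop_eop:
  assumes h: "h \<in> carrier H" and k: "k \<in> carrier H"
  shows "cop (emb (eop p h k)) = tH (emb (eop p h k)) \<one>\<^bsub>H\<^esub> \<oplus>\<^bsub>HH\<^esub> op2 p (cop h) (cop k)"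
    (is "?l h k = ?r h k")
proof -
  have l: "bilin K H H HH ?l"
    by (rule bilin_post[OF bilin_eop lin_hom_comp[OF cop_lin emb_lin]])
  have r: "bilin K H H HH ?r"
    by (intro bilin_plus module_HH bilin_comp[OF bilin_op2 cop_lin cop_lin]
        bilin_post[OF bilin_eop bilin_left[OF bilin_tH _ emb_lin]]) simp
  note iota_closed = lin_hom_closed[OF iota_lin \<delta>_closed]
  have one: "op2 p (tH \<one>\<^bsub>H\<^esub> \<one>\<^bsub>H\<^esub>) (cop (emb y)) = (if p = SE then iota (snd (\<delta> y)) else \<zero>\<^bsub>HH\<^esub>)"
    "op2 p (cop (emb y)) (tH \<one>\<^bsub>H\<^esub> \<one>\<^bsub>H\<^esub>) = (if p = NW then iota (snd (\<delta> y)) else \<zero>\<^bsub>HH\<^esub>)"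
    if y: "y \<in> carrier D" for y
    using y iota_closed[OF y]
    by (auto simp: cop_emb' bilin_add_left[OF bilin_op2] bilin_add_right[OF bilin_op2]
        op2_tens op2_one_iota[OF \<delta>_closed[OF y]])
  have zero: "cop \<zero>\<^bsub>H\<^esub> = \<zero>\<^bsub>HH\<^esub>"
    by (rule lin_hom_zero[OF module_H module_HH cop_lin])
  show ?thesis
  proof (rule H_ext[OF bilinD(2)[OF l k] bilinD(2)[OF r k] _ _ h])
    show "?l \<one>\<^bsub>H\<^esub> k = ?r \<one>\<^bsub>H\<^esub> k"
      by (rule H_ext[OF bilinD(1)[OF l H.one_closed] bilinD(1)[OF r H.one_closed] _ _ k])
        (simp_all add: cop_one op2_tens zero one, simp_all add: cop_emb')
    show "?l (emb x) k = ?r (emb x) k" if x: "x \<in> carrier D" for x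
      by (rule H_ext[OF bilinD(1)[OF l emb_closed[OF x]] bilinD(1)[OF r emb_closed[OF x]] _ _ k])
        (use x in \<open>simp_all add: cop_one zero one cop_op\<close>, simp_all add: cop_emb')
  qed
qed

lemma right_counit_cop:
  assumes h: "h \<in> carrier H"
  shows "right_counit (cop h) = h"
proof (rule H_ext[OF lin_hom_comp[OF right_counit_lin cop_lin] lin_hom_id _ _ h])
  show "right_counit (cop \<one>\<^bsub>H\<^esub>) = \<one>\<^bsub>H\<^esub>"
    by (simp add: cop_one right_counit_tens) (simp add: H_simps)
  fix x assume x: "x \<in> carrier D"
  have "right_counit (iota s) = \<zero>\<^bsub>H\<^esub>" if s: "s \<in> carrier HD" for s
    by (rule tensor_ext[OF module_H module_D lin_hom_comp[OF right_counit_lin iota_lin]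
          lin_hom_zero_map[OF module_H] _ s])
      (simp add: iota_tens right_counit_tens, simp add: emb_def)
  then show "right_counit (cop (emb x)) = emb x"
    using x \<delta>_closed[OF x] lin_hom_closed[OF iota_lin \<delta>_closed[OF x]]
    by (simp add: cop_emb' lin_hom_add[OF right_counit_lin] right_counit_tens) (simp add: emb_def H_simps)
qed

text \<open>The right counit law is read off from the summand \<open>x \<otimes> 1\<close>. The part
  of \<open>\<delta>\<close> in \<open>H \<otimes> D\<close> is explicit on generators only, so this
  law takes an induction. In its step the correction term of \<open>cop_op\<close> is killed, since
  the counit vanishes on \<open>D\<close>.\<close>

lemma left_counit_cop:
  assumes h: "h \<in> carrier H"
  shows "left_counit (cop h) = h"
proof (rule H_ext[OF lin_hom_comp[OF left_counit_lin cop_lin] lin_hom_id _ _ h])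
  show "left_counit (cop \<one>\<^bsub>H\<^esub>) = \<one>\<^bsub>H\<^esub>"
    by (simp add: cop_one left_counit_tens) (simp add: H_simps)
  have fst_emb: "fst (emb x) = \<zero>\<^bsub>K\<^esub>" for x by (simp add: emb_def)
  show "left_counit (cop (emb x)) = emb x" if "x \<in> carrier D" for x
  proof (rule lin_hom_eq_generate[OF module_H
        lin_hom_comp[OF lin_hom_comp[OF left_counit_lin cop_lin] emb_lin] emb_lin _ _ that])
    fix g assume g: "g \<in> G"
    then have g': "g \<in> carrier D" using gens by auto
    then show "left_counit (cop (emb g)) = emb g"
      using g by (simp add: cop_emb' \<delta>_gen iota_tens lin_hom_add[OF left_counit_lin]
          left_counit_tens fst_emb) (simp add: H_simps emb_def)
  next
    fix p x y assume xy: "x \<in> carrier D" "y \<in> carrier D"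
      "left_counit (cop (emb x)) = emb x" "left_counit (cop (emb y)) = emb y"
    then show "left_counit (cop (emb (b p x y))) = emb (b p x y)"
      by (simp add: cop_op lin_hom_add[OF left_counit_lin] left_counit_tens fst_emb left_counit_op2)
  qed
qed

text \<open>Sum \<open>cop_eop\<close> over the nine operations. The correction terms and the scalar
  term of \<open>mult_eop\<close> combine to \<open>(h \<otimes> k) \<otimes> 1\<close> with the
  product of \<open>H\<close> inside. By the right counit law this is just the term by which the
  product of \<open>HH\<close> exceeds the sum of the \<open>op2\<close>.\<close>

lemma cop_mult:
  assumes h: "h \<in> carrier H" and k: "k \<in> carrier H"
  shows "cop (h \<otimes>\<^bsub>H\<^esub> k) = mulHH (cop h) (cop k)"
proof -
  have c: "fst h \<otimes>\<^bsub>K\<^esub> fst k \<in> carrier K" using h k by (auto simp: H_simps(1))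
  let ?e = "lsum H (\<lambda>p. emb (eop p h k)) all_ops" and ?o = "(fst h \<otimes>\<^bsub>K\<^esub> fst k) \<odot>\<^bsub>H\<^esub> \<one>\<^bsub>H\<^esub>"
    and ?s = "lsum HH (\<lambda>p. op2 p (cop h) (cop k)) all_ops"
  have e: "?e \<in> carrier H" using h k by (intro H.lsum_closed) simp
  have o: "?o \<in> carrier H" using c by simp
  have s: "?s \<in> carrier HH" using h k by (intro HH.lsum_closed) simp
  have "cop ?e = lsum HH (\<lambda>p. cop (emb (eop p h k))) all_ops"
    using h k by (intro lin_hom_lsum[OF module_H module_HH cop_lin]) simp
  also have "\<dots> = lsum HH (\<lambda>p. tH (emb (eop p h k)) \<one>\<^bsub>H\<^esub>) all_ops \<oplus>\<^bsub>HH\<^esub> ?s"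
    using h k by (simp add: cop_eop HH.lsum_add)
  also have "lsum HH (\<lambda>p. tH (emb (eop p h k)) \<one>\<^bsub>H\<^esub>) all_ops = tH ?e \<one>\<^bsub>H\<^esub>"
    using h k by (intro lin_hom_lsum[OF module_H module_HH, symmetric] bilinD(2)[OF bilin_tH]) auto
  finally have ce: "cop ?e = tH ?e \<one>\<^bsub>H\<^esub> \<oplus>\<^bsub>HH\<^esub> ?s" .
  have co: "cop ?o = tH ?o \<one>\<^bsub>H\<^esub>"
    using c by (simp add: lin_hom_smult[OF cop_lin] cop_one bilin_smult_left[OF bilin_tH])
  have "cop (h \<otimes>\<^bsub>H\<^esub> k) = (tH ?e \<one>\<^bsub>H\<^esub> \<oplus>\<^bsub>HH\<^esub> ?s) \<oplus>\<^bsub>HH\<^esub> tH ?o \<one>\<^bsub>H\<^esub>"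
    using e o by (simp only: mult_eop[OF h k] lin_hom_add[OF cop_lin] ce co)
  also have "\<dots> = ?s \<oplus>\<^bsub>HH\<^esub> tH (?e \<oplus>\<^bsub>H\<^esub> ?o) \<one>\<^bsub>H\<^esub>"
    using e o s by (simp add: bilin_add_left[OF bilin_tH] HH.M.a_ac)
  also have "\<dots> = mulHH (cop h) (cop k)"
    using h k by (simp add: mulHH_op2 right_counit_cop flip: mult_eop[OF h k])
  finally show ?thesis .
qed

section \<open>Coassociativity\<close>

definition cop_right where "cop_right = tensor_map K H HH id cop"

definition cop_left where "cop_left w = tensor_assoc K H H H (tensor_map K HH H cop id w)"

lemma cop_right_lin: "cop_right \<in> lin_hom K HH HHH"
  and cop_right_tens: "\<lbrakk>h \<in> carrier H; k \<in> carrier H\<rbrakk> \<Longrightarrow> cop_right (tH h k) = tHH h (cop k)"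
  unfolding cop_right_def
  by (intro tensor_map_lin module_H module_HH cop_lin, simp add: id_def lin_hom_id)
    (simp add: tensor_map_tens[OF module_H module_H module_H module_HH lin_hom_id cop_lin] id_def)

lemma cop_left_lin: "cop_left \<in> lin_hom K HH HHH"
  and cop_left_tens: "\<lbrakk>h \<in> carrier H; k \<in> carrier H\<rbrakk> \<Longrightarrow>
    cop_left (tH h k) = tensor_assoc K H H H (tens K HH H (cop h) k)"
  unfolding cop_left_def [abs_def]
  by (intro lin_hom_comp[OF tensor_assoc_lin] tensor_map_lin module_H module_HH cop_lin,
      simp add: id_def lin_hom_id)
    (simp add: tensor_map_tens[OF module_H module_H module_HH module_H cop_lin lin_hom_id] id_def)

text \<open>Appends a unit as third factor; this is the shape of the correction term when the
  coproduct is applied to a right factor.\<close>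

definition unit_right where "unit_right = tensor_map K H HH (\<lambda>h. h) (\<lambda>k. tH k \<one>\<^bsub>H\<^esub>)"

lemma unit_right_lin: "unit_right \<in> lin_hom K HH HHH"
  and unit_right_tens: "\<lbrakk>h \<in> carrier H; k \<in> carrier H\<rbrakk> \<Longrightarrow> unit_right (tH h k) = tHH h (tH k \<one>\<^bsub>H\<^esub>)"
  unfolding unit_right_def
  by (intro tensor_map_lin tensor_map_tens module_H module_HH lin_hom_id bilinD(2)[OF bilin_tH] H.one_closed)+

text \<open>The operation sits in the right factor, so \<open>cop_eop\<close> applies there and
  leaves its correction term.\<close>

lemma cop_right_op2:
  assumes s: "s \<in> carrier HH" and t: "t \<in> carrier HH"
  shows "cop_right (op2 p s t) =
    unit_right (op2 p s t) \<oplus>\<^bsub>HHH\<^esub> op3 p (cop_right s) (cop_right t)" (is "?l s t = ?r s t")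
proof -
  have l: "bilin K HH HH HHH ?l"
    by (rule bilin_post[OF bilin_op2 cop_right_lin])
  have r: "bilin K HH HH HHH ?r"
    by (intro bilin_plus module_HHH bilin_post[OF bilin_op2 unit_right_lin]
        bilin_comp[OF bilin_op3 cop_right_lin cop_right_lin])
  show ?thesis
  proof (rule tensor_ext[OF module_H module_H bilinD(2)[OF l t] bilinD(2)[OF r t] _ s])
    fix h h' assume h: "h \<in> carrier H" "h' \<in> carrier H"
    then have th: "tH h h' \<in> carrier HH" by simp
    show "?l (tH h h') t = ?r (tH h h') t"
      by (rule tensor_ext[OF module_H module_H bilinD(1)[OF l th] bilinD(1)[OF r th] _ t])
        (use h in \<open>simp add: op2_tens cop_right_tens unit_right_tens op3_tens cop_eop
          bilin_add_right[OF bilin_tHH]\<close>)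
  qed
qed

lemma assoc_op3:
  assumes v: "v \<in> carrier HH" and w: "w \<in> carrier HH" and h: "h \<in> carrier H" and k: "k \<in> carrier H"
  shows "tensor_assoc K H H H (tens K HH H (mulHH v w) (emb (eop p h k))) =
    op3 p (tensor_assoc K H H H (tens K HH H v h)) (tensor_assoc K H H H (tens K HH H w k))"
    (is "?l v w = ?r v w")
proof -
  note bt = bilin_tens[OF module_HH module_H]
  note al = tensor_assoc_lin[OF module_H module_H module_H]
  have ah: "(\<lambda>v. tensor_assoc K H H H (tens K HH H v h)) \<in> lin_hom K HH HHH" if "h \<in> carrier H" for h
    by (rule lin_hom_comp[OF al bilinD(2)[OF bt that]])
  have l: "bilin K HH HH HHH ?l"
    by (rule bilin_post[OF bilin_mulHH ah]) (use h k in simp)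
  have r: "bilin K HH HH HHH ?r"
    by (rule bilin_comp[OF bilin_op3 ah[OF h] ah[OF k]])
  show ?thesis
  proof (rule tensor_ext[OF module_H module_H bilinD(2)[OF l w] bilinD(2)[OF r w] _ v])
    fix x y assume x: "x \<in> carrier H" "y \<in> carrier H"
    then have th: "tH x y \<in> carrier HH" by simp
    show "?l (tH x y) w = ?r (tH x y) w"
      by (rule tensor_ext[OF module_H module_H bilinD(1)[OF l th] bilinD(1)[OF r th] _ w])
        (use h k x in \<open>simp add: mulHH_tens tensor_assoc_tens module_H op3_tens op2_tens\<close>)
  qed
qed

text \<open>No correction term arises: the left factors are multiplied, and the coproduct is
  multiplicative by \<open>cop_mult\<close>.\<close>

lemma cop_left_op2:
  assumes s: "s \<in> carrier HH" and t: "t \<in> carrier HH"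
  shows "cop_left (op2 p s t) = op3 p (cop_left s) (cop_left t)" (is "?l s t = ?r s t")
proof -
  have l: "bilin K HH HH HHH ?l"
    by (rule bilin_post[OF bilin_op2 cop_left_lin])
  have r: "bilin K HH HH HHH ?r"
    by (rule bilin_comp[OF bilin_op3 cop_left_lin cop_left_lin])
  show ?thesis
  proof (rule tensor_ext[OF module_H module_H bilinD(2)[OF l t] bilinD(2)[OF r t] _ s])
    fix h h' assume h: "h \<in> carrier H" "h' \<in> carrier H"
    then have th: "tH h h' \<in> carrier HH" by simp
    show "?l (tH h h') t = ?r (tH h h') t"
      by (rule tensor_ext[OF module_H module_H bilinD(1)[OF l th] bilinD(1)[OF r th] _ t])
        (use h in \<open>simp add: op2_tens cop_left_tens cop_mult assoc_op3\<close>)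
  qed
qed

lemma cop_left_one:
  assumes h: "h \<in> carrier H"
  shows "cop_left (tH h \<one>\<^bsub>H\<^esub>) = unit_right (cop h)"
proof -
  have "tensor_assoc K H H H (tens K HH H w \<one>\<^bsub>H\<^esub>) = unit_right w" if w: "w \<in> carrier HH" for w
    by (rule tensor_ext[OF module_H module_H lin_hom_comp[OF tensor_assoc_lin bilinD(2)[OF bilin_tens]]
          unit_right_lin _ w])
      (simp_all add: module_H module_HH tensor_assoc_tens unit_right_tens)
  then show ?thesis
    using h by (simp add: cop_left_tens)
qed

text \<open>In the induction step, the correction term that \<open>cop_right\<close> produces from
  \<open>op2\<close> has to come from somewhere on the other side. It comes from the summand
  \<open>(x p y) \<otimes> 1\<close>, whose left factor \<open>cop_left\<close> expands once more by
  \<open>cop_op\<close>.\<close>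

lemma coassociative:
  assumes h: "h \<in> carrier H"
  shows "cop_left (cop h) = cop_right (cop h)"
proof (rule H_ext[OF lin_hom_comp[OF cop_left_lin cop_lin] lin_hom_comp[OF cop_right_lin cop_lin] _ _ h])
  show "cop_left (cop \<one>\<^bsub>H\<^esub>) = cop_right (cop \<one>\<^bsub>H\<^esub>)"
    by (simp add: cop_one cop_left_one cop_right_tens unit_right_tens)
  note al = lin_hom_add[OF cop_left_lin] lin_hom_add[OF cop_right_lin] lin_hom_add[OF unit_right_lin]
  note closed = lin_hom_closed[OF cop_left_lin] lin_hom_closed[OF cop_right_lin]
    lin_hom_closed[OF unit_right_lin] bilin_closed[OF bilin_op3]
  show "cop_left (cop (emb x)) = cop_right (cop (emb x))" if "x \<in> carrier D" for x
  proof (rule lin_hom_eq_generate[OF module_HHH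
        lin_hom_comp[OF lin_hom_comp[OF cop_left_lin cop_lin] emb_lin]
        lin_hom_comp[OF lin_hom_comp[OF cop_right_lin cop_lin] emb_lin] _ _ that])
    fix g assume g: "g \<in> G"
    then have g': "g \<in> carrier D" using gens by auto
    have c: "cop (emb g) = tH (emb g) \<one>\<^bsub>H\<^esub> \<oplus>\<^bsub>HH\<^esub> tH \<one>\<^bsub>H\<^esub> (emb g)"
      using g g' by (simp add: cop_emb' \<delta>_gen iota_tens)
    have l: "cop_left (tH \<one>\<^bsub>H\<^esub> (emb g)) = tHH \<one>\<^bsub>H\<^esub> (tH \<one>\<^bsub>H\<^esub> (emb g))"
      using g' by (simp add: cop_left_tens cop_one tensor_assoc_tens module_H)
    have "cop_left (cop (emb g)) = tHH (emb g) (tH \<one>\<^bsub>H\<^esub> \<one>\<^bsub>H\<^esub>) \<oplus>\<^bsub>HHH\<^esub>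
        tHH \<one>\<^bsub>H\<^esub> (tH (emb g) \<one>\<^bsub>H\<^esub>) \<oplus>\<^bsub>HHH\<^esub> tHH \<one>\<^bsub>H\<^esub> (tH \<one>\<^bsub>H\<^esub> (emb g))"
      using g' by (subst c) (simp add: al cop_left_one l, simp add: c al unit_right_tens)
    moreover have "cop_right (cop (emb g)) = tHH (emb g) (tH \<one>\<^bsub>H\<^esub> \<one>\<^bsub>H\<^esub>) \<oplus>\<^bsub>HHH\<^esub>
        (tHH \<one>\<^bsub>H\<^esub> (tH (emb g) \<one>\<^bsub>H\<^esub>) \<oplus>\<^bsub>HHH\<^esub> tHH \<one>\<^bsub>H\<^esub> (tH \<one>\<^bsub>H\<^esub> (emb g)))"
      using g' by (subst c) (simp add: al cop_right_tens cop_one, simp add: c bilin_add_right[OF bilin_tHH])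
    ultimately show "cop_left (cop (emb g)) = cop_right (cop (emb g))"
      using g' by (simp add: HHH.M.a_assoc)
  next
    fix p x y assume xy: "x \<in> carrier D" "y \<in> carrier D"
      "cop_left (cop (emb x)) = cop_right (cop (emb x))" "cop_left (cop (emb y)) = cop_right (cop (emb y))"
    let ?u = "emb (b p x y)" and ?s = "op2 p (cop (emb x)) (cop (emb y))"
    have s: "?s \<in> carrier HH" and u: "?u \<in> carrier H" using xy by simp_all
    have "cop_left (cop ?u) = unit_right (cop ?u) \<oplus>\<^bsub>HHH\<^esub> op3 p (cop_left (cop (emb x))) (cop_left (cop (emb y)))"
      using xy s u by (subst cop_op) (simp_all add: al cop_left_one cop_left_op2)
    also have "unit_right (cop ?u) = tHH ?u (tH \<one>\<^bsub>H\<^esub> \<one>\<^bsub>H\<^esub>) \<oplus>\<^bsub>HHH\<^esub> unit_right ?s"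
      using xy s u by (subst cop_op) (simp_all add: al unit_right_tens)
    finally have left: "cop_left (cop ?u) = tHH ?u (tH \<one>\<^bsub>H\<^esub> \<one>\<^bsub>H\<^esub>) \<oplus>\<^bsub>HHH\<^esub> unit_right ?s \<oplus>\<^bsub>HHH\<^esub>
        op3 p (cop_right (cop (emb x))) (cop_right (cop (emb y)))"
      using xy by simp
    have "cop_right (cop ?u) = tHH ?u (tH \<one>\<^bsub>H\<^esub> \<one>\<^bsub>H\<^esub>) \<oplus>\<^bsub>HHH\<^esub> (unit_right ?s \<oplus>\<^bsub>HHH\<^esub>
        op3 p (cop_right (cop (emb x))) (cop_right (cop (emb y))))"
      using xy s u by (subst cop_op) (simp_all add: al cop_right_tens cop_one cop_right_op2)
    then show "cop_left (cop ?u) = cop_right (cop ?u)"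
      using xy s u by (simp add: left closed HHH.M.a_assoc)
  qed
qed

theorem bialgebra_H: "bialgebra K H cop fst"
proof (intro bialgebra.intro bialgebra_axioms.intro H.unital_algebra_axioms)
  show "cop \<in> algebra_hom K H (tensor_algebra K H)"
    unfolding algebra_hom_def
    by (intro IntI ring_hom_memI)
      (simp_all add: cop_mult cop_one lin_hom_add[OF cop_lin],
       rule lin_homI, simp_all add: lin_hom_add[OF cop_lin] lin_hom_smult[OF cop_lin])
  show "fst \<in> algebra_hom K H (ground_algebra K)"
    using fst_H_lin unfolding algebra_hom_def ring_hom_def by (auto simp: H_simps(1,2))
next
  fix h assume h: "h \<in> carrier H"
  show "tensor_assoc K H H H (tensor_map K HH H cop id (cop h)) = tensor_map K H HH id cop (cop h)"
    using coassociative[OF h] by (simp add: cop_left_def cop_right_def)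
  show "tensor_lift H (\<lambda>y z. fst y \<odot>\<^bsub>H\<^esub> z) (cop h) = h"
    using left_counit_cop[OF h] by (simp add: left_counit_def)
  show "tensor_lift H (\<lambda>y z. fst z \<odot>\<^bsub>H\<^esub> y) (cop h) = h"
    using right_counit_cop[OF h] by (simp add: right_counit_def)
qed

end

section \<open>Connectedness\<close>

context dn_coalgebra
begin

sublocale B: bialgebra K "augmentation K D b" cop fst
  by (rule bialgebra_H)

lemma op2_in_submodule:
  assumes "submodule W K HH" "A \<subseteq> carrier H" "B \<subseteq> carrier H"
    and A: "v \<in> tensor_square K H A" and B: "w \<in> tensor_square K H B"
    and "\<And>x y x' y'. \<lbrakk>x \<in> A; y \<in> A; x' \<in> B; y' \<in> B\<rbrakk> \<Longrightarrow> tH (x \<otimes>\<^bsub>H\<^esub> x') (emb (eop p y y')) \<in> W"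
  shows "op2 p v w \<in> W"
proof -
  have right: "op2 p v w \<in> W"
    if "v \<in> carrier HH" "\<And>x' y'. \<lbrakk>x' \<in> B; y' \<in> B\<rbrakk> \<Longrightarrow> op2 p v (tH x' y') \<in> W" for v
  proof -
    have "tensor_square K H B \<subseteq> {w \<in> carrier HH. op2 p v w \<in> W}"
      by (rule tensor_square_least[OF module_H assms(3)
            lin_hom_preimage_submodule[OF module_HH module_HH bilinD(1)[OF bilin_op2] assms(1)]])
        (simp_all add: that subsetD[OF assms(3)])
    then show ?thesis using B by blast
  qed
  have "tensor_square K H A \<subseteq> {v \<in> carrier HH. op2 p v w \<in> W}"
  proof (rule tensor_square_least[OF module_H assms(2)
        lin_hom_preimage_submodule[OF module_HH module_HH bilinD(2)[OF bilin_op2] assms(1)]])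
    show "w \<in> carrier HH"
      using B submoduleD(1)[OF tensor_square_submodule[OF module_H assms(3)]] by blast
    fix x y assume xy: "x \<in> A" "y \<in> A"
    then have c: "x \<in> carrier H" "y \<in> carrier H" using assms(2) by auto
    moreover have "op2 p (tH x y) (tH x' y') \<in> W" if "x' \<in> B" "y' \<in> B" for x' y'
      using assms(3) that c assms(6)[OF xy that] by (simp add: op2_tens subsetD)
    ultimately show "tH x y \<in> {v \<in> carrier HH. op2 p v w \<in> W}"
      using right[of "tH x y"] by simp
  qed
  then show ?thesis using A by blast
qed

text \<open>The unit lies in every step, so its component may be subtracted. The unit action sees
  only what remains.\<close>

lemma emb_snd_filt:
  assumes h: "h \<in> carrier H" "h \<in> B.filt r"
  shows "emb (snd h) \<in> B.filt r"
proof -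
  have "emb (snd h) = h \<oplus>\<^bsub>H\<^esub> (\<ominus>\<^bsub>K\<^esub> (fst h)) \<odot>\<^bsub>H\<^esub> \<one>\<^bsub>H\<^esub>"
    using h(1) by (auto simp: emb_def H_simps R.r_neg)
  also have "\<dots> \<in> B.filt r"
    using h by (intro submoduleD(3,4)[OF B.filt_submodule] B.one_filt) (auto simp: H_simps(1))
  finally show ?thesis .
qed

lemma eop_one:
  assumes "h \<in> carrier H"
  shows "eop p \<one>\<^bsub>H\<^esub> h = (if p = SE then snd h else \<zero>\<^bsub>D\<^esub>)"
    and "eop p h \<one>\<^bsub>H\<^esub> = (if p = NW then snd h else \<zero>\<^bsub>D\<^esub>)"
  using assms by (auto simp: eop_def H_simps)

lemma eop_one_filt:
  assumes "h \<in> B.filt r"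
  shows "emb (eop p \<one>\<^bsub>H\<^esub> h) \<in> B.filt r" "emb (eop p h \<one>\<^bsub>H\<^esub>) \<in> B.filt r"
proof -
  have h: "h \<in> carrier H" using assms B.filt_subset by blast
  show "emb (eop p \<one>\<^bsub>H\<^esub> h) \<in> B.filt r" "emb (eop p h \<one>\<^bsub>H\<^esub>) \<in> B.filt r"
    using emb_snd_filt[OF h assms] submoduleD(2)[OF B.filt_submodule, of r]
    by (simp_all add: eop_one[OF h] del: conn_filt.simps)
qed

text \<open>By \<open>mult_eop\<close> a product is the sum of the nine operations and a multiple of
  the unit.\<close>

lemma mult_filt:
  assumes "h \<in> B.filt r" "k \<in> B.filt s" "\<And>p. emb (eop p h k) \<in> B.filt n"
  shows "h \<otimes>\<^bsub>H\<^esub> k \<in> B.filt n"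
proof -
  have hk: "h \<in> carrier H" "k \<in> carrier H" using assms B.filt_subset by blast+
  then have c: "fst h \<otimes>\<^bsub>K\<^esub> fst k \<in> carrier K" by (auto simp: H_simps(1))
  have "lsum H (\<lambda>p. emb (eop p h k)) xs \<in> B.filt n" for xs
    by (induction xs)
      (simp_all add: submoduleD(2,3)[OF B.filt_submodule] assms(3) del: conn_filt.simps)
  then show ?thesis
    unfolding mult_eop[OF hk] using c
    by (intro submoduleD(3,4)[OF B.filt_submodule] B.one_filt)
qed

text \<open>The filtration is multiplicative for all operations. In the induction step, all terms of
  \<open>\<Delta> h p \<Delta> k\<close> other than \<open>(1 \<otimes> h) p (1 \<otimes> k)\<close> are products of terms with smaller total degree.\<close>

lemma eop_filt: "\<lbrakk>h \<in> B.filt r; k \<in> B.filt s\<rbrakk> \<Longrightarrow> emb (eop p h k) \<in> B.filt (r + s)"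
proof (induction "r + s" arbitrary: r s h k p rule: less_induct)
  case less
  have hk: "h \<in> carrier H" "k \<in> carrier H" using less.prems B.filt_subset by blast+
  consider "r = 0" | "s = 0" | r' s' where "r = Suc r'" "s = Suc s'"
    using not0_implies_Suc by blast
  then show ?case
  proof cases
    case 1
    then obtain c where c: "c \<in> carrier K" "h = c \<odot>\<^bsub>H\<^esub> \<one>\<^bsub>H\<^esub>"
      using less.prems(1) by auto
    then have "emb (eop p h k) = c \<odot>\<^bsub>H\<^esub> emb (eop p \<one>\<^bsub>H\<^esub> k)"
      using hk by (simp add: bilin_smult_left[OF bilin_eop] lin_hom_smult[OF emb_lin])
    then show ?thesis
      using 1 submoduleD(4)[OF B.filt_submodule c(1) eop_one_filt(1)[OF less.prems(2)]]
      by (simp del: conn_filt.simps)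
  next
    case 2
    then obtain c where c: "c \<in> carrier K" "k = c \<odot>\<^bsub>H\<^esub> \<one>\<^bsub>H\<^esub>"
      using less.prems(2) by auto
    then have "emb (eop p h k) = c \<odot>\<^bsub>H\<^esub> emb (eop p h \<one>\<^bsub>H\<^esub>)"
      using hk by (simp add: bilin_smult_right[OF bilin_eop] lin_hom_smult[OF emb_lin])
    then show ?thesis
      using 2 submoduleD(4)[OF B.filt_submodule c(1) eop_one_filt(2)[OF less.prems(1)]]
      by (simp del: conn_filt.simps)
  next
    case 3
    \<comment> \<open>One less than \<open>r + s\<close>: the step in which all factors of the
      remainder have to lie.\<close>
    define m where "m = Suc (r' + s')"
    have rs: "r + s = Suc m" using 3 by (simp add: m_def)
    have h: "h \<in> B.filt (Suc r')" and k: "k \<in> B.filt (Suc s')"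
      using less.prems 3 by simp_all
    have eop: "emb (eop q x y) \<in> B.filt m" if "x \<in> B.filt i" "y \<in> B.filt j" "i + j \<le> m" for q x y i j
      using less.hyps[OF _ that(1,2)] that(3) rs B.filt_mono[of "i + j" m] by auto
    \<comment> \<open>Products of left factors follow from the same induction hypothesis, as it is
      available for every operation.\<close>
    have mul: "x \<otimes>\<^bsub>H\<^esub> y \<in> B.filt m" if "x \<in> B.filt i" "y \<in> B.filt j" "i + j \<le> m" for x y i j
      using that by (intro mult_filt[OF that(1,2)] eop)
    have up: "x \<in> B.filt m" if "x \<in> B.filt i" "i \<le> m" for x i
      using that B.filt_mono by blast
    obtain v where v: "v \<in> tensor_square K H (B.filt r')"
        "cop h = tH \<one>\<^bsub>H\<^esub> h \<oplus>\<^bsub>HH\<^esub> tH h \<one>\<^bsub>H\<^esub> \<oplus>\<^bsub>HH\<^esub> v"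
      using h by (rule B.filt_SucD)
    obtain w where w: "w \<in> tensor_square K H (B.filt s')"
        "cop k = tH \<one>\<^bsub>H\<^esub> k \<oplus>\<^bsub>HH\<^esub> tH k \<one>\<^bsub>H\<^esub> \<oplus>\<^bsub>HH\<^esub> w"
      using k by (rule B.filt_SucD)
    have vw: "v \<in> carrier HH" "w \<in> carrier HH"
      using v(1) w(1) submoduleD(1)[OF B.square_submodule] by blast+
    let ?W = "tensor_square K H (B.filt m)"
    note W = B.square_submodule[of m]
    note tW = tens_in_tensor_square[OF module_H B.filt_subset]
    have one: "\<one>\<^bsub>H\<^esub> \<in> B.filt i" for i by (rule B.one_filt)
    \<comment> \<open>One side may keep its full degree \<open>Suc r'\<close>, because the factors
      of \<open>w\<close> have degree at most \<open>s'\<close> and the total is still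
      \<open>m\<close>.\<close>
    have hw: "op2 p (tH x y) w \<in> ?W" if xy: "x \<in> B.filt i" "y \<in> B.filt j" "i \<le> Suc r'" "j \<le> Suc r'" for x y i j
    proof -
      have "op2 p (tH x y) (tH x' y') \<in> ?W" if "x' \<in> B.filt s'" "y' \<in> B.filt s'" for x' y'
      proof -
        have "x \<in> carrier H" "y \<in> carrier H" "x' \<in> carrier H" "y' \<in> carrier H"
          using that xy B.filt_subset by blast+
        then have "op2 p (tH x y) (tH x' y') = tH (x \<otimes>\<^bsub>H\<^esub> x') (emb (eop p y y'))"
          by (rule op2_tens)
        also have "\<dots> \<in> ?W"
          by (rule tW[OF mul[OF xy(1) that(1)] eop[OF xy(2) that(2)]]) (use xy in \<open>simp_all add: m_def\<close>)
        finally show ?thesis .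
      qed
      then have "tensor_square K H (B.filt s') \<subseteq> {w \<in> carrier HH. op2 p (tH x y) w \<in> ?W}"
        using xy
        by (intro tensor_square_least[OF module_H B.filt_subset
            lin_hom_preimage_submodule[OF module_HH module_HH bilinD(1)[OF bilin_op2] W]])
          (simp_all add: subsetD[OF B.filt_subset] del: conn_filt.simps)
      then show ?thesis using w(1) by blast
    qed
    have vk: "op2 p v (tH x y) \<in> ?W" if xy: "x \<in> B.filt i" "y \<in> B.filt j" "i \<le> Suc s'" "j \<le> Suc s'" for x y i j
    proof -
      have "op2 p (tH x' y') (tH x y) \<in> ?W" if "x' \<in> B.filt r'" "y' \<in> B.filt r'" for x' y'
      proof -
        have "x \<in> carrier H" "y \<in> carrier H" "x' \<in> carrier H" "y' \<in> carrier H"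
          using that xy B.filt_subset by blast+
        then have "op2 p (tH x' y') (tH x y) = tH (x' \<otimes>\<^bsub>H\<^esub> x) (emb (eop p y' y))"
          by (intro op2_tens)
        also have "\<dots> \<in> ?W"
          by (rule tW[OF mul[OF that(1) xy(1)] eop[OF that(2) xy(2)]]) (use xy in \<open>simp_all add: m_def\<close>)
        finally show ?thesis .
      qed
      then have "tensor_square K H (B.filt r') \<subseteq> {v \<in> carrier HH. op2 p v (tH x y) \<in> ?W}"
        using xy
        by (intro tensor_square_least[OF module_H B.filt_subset
            lin_hom_preimage_submodule[OF module_HH module_HH bilinD(2)[OF bilin_op2] W]])
          (simp_all add: subsetD[OF B.filt_subset] del: conn_filt.simps)
      then show ?thesis using v(1) by blast
    qed
    have vw': "op2 p v w \<in> ?W"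
    proof (rule op2_in_submodule[OF W B.filt_subset B.filt_subset v(1) w(1)])
      fix x y x' y'
      assume x: "x \<in> B.filt r'" "y \<in> B.filt r'" and x': "x' \<in> B.filt s'" "y' \<in> B.filt s'"
      show "tH (x \<otimes>\<^bsub>H\<^esub> x') (emb (eop p y y')) \<in> ?W"
        by (rule tW[OF mul[OF x(1) x'(1)] eop[OF x(2) x'(2)]]) (simp_all add: m_def)
    qed
    let ?e = "emb (eop p h k)"
    \<comment> \<open>Of the nine products of summands, \<open>1 \<otimes> h\<close> with
      \<open>1 \<otimes> k\<close> gives \<open>1 \<otimes> ?e\<close>, and
      \<open>h \<otimes> 1\<close> with \<open>k \<otimes> 1\<close> gives zero. The other seven
      form the remainder, while the correction term of \<open>cop_eop\<close> provides
      \<open>?e \<otimes> 1\<close>.\<close>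
    let ?r = "tH k (emb (eop p h \<one>\<^bsub>H\<^esub>)) \<oplus>\<^bsub>HH\<^esub> (op2 p (tH \<one>\<^bsub>H\<^esub> h) w \<oplus>\<^bsub>HH\<^esub> (tH h (emb (eop p \<one>\<^bsub>H\<^esub> k)) \<oplus>\<^bsub>HH\<^esub>
      (op2 p (tH h \<one>\<^bsub>H\<^esub>) w \<oplus>\<^bsub>HH\<^esub> (op2 p v (tH \<one>\<^bsub>H\<^esub> k) \<oplus>\<^bsub>HH\<^esub> (op2 p v (tH k \<one>\<^bsub>H\<^esub>) \<oplus>\<^bsub>HH\<^esub> op2 p v w)))))"
    have "cop ?e = tH ?e \<one>\<^bsub>H\<^esub> \<oplus>\<^bsub>HH\<^esub> op2 p (cop h) (cop k)"
      by (rule cop_eop[OF hk])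
    also have "op2 p (cop h) (cop k) = tH \<one>\<^bsub>H\<^esub> ?e \<oplus>\<^bsub>HH\<^esub> ?r"
      using hk vw unfolding v(2) w(2)
      by (simp add: bilin_add_left[OF bilin_op2] bilin_add_right[OF bilin_op2] op2_tens HH.M.a_ac)
    also have "tH ?e \<one>\<^bsub>H\<^esub> \<oplus>\<^bsub>HH\<^esub> (tH \<one>\<^bsub>H\<^esub> ?e \<oplus>\<^bsub>HH\<^esub> ?r) = tH \<one>\<^bsub>H\<^esub> ?e \<oplus>\<^bsub>HH\<^esub> tH ?e \<one>\<^bsub>H\<^esub> \<oplus>\<^bsub>HH\<^esub> ?r"
      using hk vw by (simp add: HH.M.a_ac)
    finally have ce: "cop ?e = tH \<one>\<^bsub>H\<^esub> ?e \<oplus>\<^bsub>HH\<^esub> tH ?e \<one>\<^bsub>H\<^esub> \<oplus>\<^bsub>HH\<^esub> ?r" .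
    have "?r \<in> ?W"
    proof (intro submoduleD(3)[OF W])
      have "h \<in> B.filt m" "k \<in> B.filt m"
        by (rule up[OF h] up[OF k]; simp add: m_def)+
      then show "tH k (emb (eop p h \<one>\<^bsub>H\<^esub>)) \<in> ?W" "tH h (emb (eop p \<one>\<^bsub>H\<^esub> k)) \<in> ?W"
        by - (intro tW eop_one_filt; assumption)+
      show "op2 p (tH \<one>\<^bsub>H\<^esub> h) w \<in> ?W" "op2 p (tH h \<one>\<^bsub>H\<^esub>) w \<in> ?W"
        by (rule hw[OF one h le_refl le_refl] hw[OF h one le_refl le_refl])+
      show "op2 p v (tH \<one>\<^bsub>H\<^esub> k) \<in> ?W" "op2 p v (tH k \<one>\<^bsub>H\<^esub>) \<in> ?W"
        by (rule vk[OF one k le_refl le_refl] vk[OF k one le_refl le_refl])+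
    qed (rule vw')
    from B.filt_SucI[OF emb_closed[OF eop_closed[OF hk]] this ce] show ?thesis
      unfolding rs .
  qed
qed

theorem connected_hopf_algebra_H: "connected_hopf_algebra K H cop fst"
proof -
  \<comment> \<open>The union of the filtration steps, intersected with \<open>D\<close>. It is
    closed under the operations by \<open>eop_filt\<close>, so generation makes it all of
    \<open>D\<close>.\<close>
  let ?W = "{x \<in> carrier D. \<exists>r. emb x \<in> B.filt r}"
  have common: "\<exists>t. x \<in> B.filt t \<and> y \<in> B.filt t" if "x \<in> B.filt r" "y \<in> B.filt s" for x y r s
    using that B.filt_mono[of r "max r s"] B.filt_mono[of s "max r s"] by auto
  have "submodule ?W K D"
  proof (rule submoduleI'[OF module_D])
    show "\<zero>\<^bsub>D\<^esub> \<in> ?W"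
      using submoduleD(2)[OF B.filt_submodule] by (auto simp del: conn_filt.simps)
  next
    fix x y assume "x \<in> ?W" "y \<in> ?W"
    then obtain r where r: "emb x \<in> B.filt r" "emb y \<in> B.filt r"
        and xy: "x \<in> carrier D" "y \<in> carrier D"
      using common by blast
    have "emb (x \<oplus>\<^bsub>D\<^esub> y) \<in> B.filt r"
      unfolding lin_hom_add[OF emb_lin xy] by (rule submoduleD(3)[OF B.filt_submodule r])
    then show "x \<oplus>\<^bsub>D\<^esub> y \<in> ?W"
      using xy by blast
  next
    fix c x assume c: "c \<in> carrier K" and "x \<in> ?W"
    then obtain r where r: "emb x \<in> B.filt r" and x: "x \<in> carrier D"
      by blast
    have "emb (c \<odot>\<^bsub>D\<^esub> x) \<in> B.filt r"
      unfolding lin_hom_smult[OF emb_lin c x] by (rule submoduleD(4)[OF B.filt_submodule c r])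
    then show "c \<odot>\<^bsub>D\<^esub> x \<in> ?W"
      using c x by blast
  qed blast
  moreover have "G \<subseteq> ?W"
  proof
    fix g assume g: "g \<in> G"
    then have g': "g \<in> carrier D" using gens by auto
    \<comment> \<open>Generators are primitive, so they lie in the first step with remainder
      zero.\<close>
    have "cop (emb g) = tH \<one>\<^bsub>H\<^esub> (emb g) \<oplus>\<^bsub>HH\<^esub> tH (emb g) \<one>\<^bsub>H\<^esub> \<oplus>\<^bsub>HH\<^esub> \<zero>\<^bsub>HH\<^esub>"
      using g g' by (simp add: cop_emb' \<delta>_gen iota_tens HH.M.a_comm)
    then have "emb g \<in> B.filt (Suc 0)"
      by (rule B.filt_SucI[OF emb_closed[OF g'] submoduleD(2)[OF B.square_submodule]])
    then show "g \<in> ?W" using g' by blast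
  qed
  moreover have "b p x y \<in> ?W" if xy: "x \<in> ?W" "y \<in> ?W" for p x y
  proof -
    obtain r s where "emb x \<in> B.filt r" "emb y \<in> B.filt s"
      using xy by blast
    from eop_filt[OF this, of p] have "emb (b p x y) \<in> B.filt (r + s)"
      using xy by (simp del: conn_filt.simps)
    then show ?thesis
      using xy b_closed by blast
  qed
  ultimately have W: "carrier D \<subseteq> ?W"
    by (rule generate)
  have "connected_bialgebra K H cop fst"
  proof (intro connected_bialgebra.intro connected_bialgebra_axioms.intro B.bialgebra_axioms
      equalityI subsetI)
    fix h assume h: "h \<in> carrier H"
    then obtain r where "emb (snd h) \<in> B.filt r"
      using H_decomp(3)[OF h] W by blast
    then have "h \<in> B.filt r"
      using H_decomp[OF h] submoduleD(3,4)[OF B.filt_submodule] B.one_filt by metis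
    then show "h \<in> (\<Union>r. B.filt r)" by blast
  qed (use B.filt_subset in blast)
  then show ?thesis
    by (rule connected_bialgebra.connected_hopf)
qed

end

section \<open>The two free algebras\<close>

lemma presented_generate:
  assumes "cring K" "submodule W K (presented K \<Omega> G E)"
    and "\<And>g. g \<in> G \<Longrightarrow> lclass K \<Omega> G E (Gen g) \<in> W"
    and "\<And>p x y. \<lbrakk>p \<in> \<Omega>; x \<in> W; y \<in> W\<rbrakk> \<Longrightarrow> presented_op K \<Omega> G E p x y \<in> W"
  shows "carrier (presented K \<Omega> G E) \<subseteq> W"
proof -
  note W = submoduleD[OF assms(2)]
  have "lclass K \<Omega> G E t \<in> W" if "t \<in> lterms K \<Omega> G" for t
    using that
  proof induction
    case Zero
    show ?case using W(2) by (simp add: presented_zero)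
  next
    case (Add s t)
    then show ?case using W(3)[OF Add.IH] by (simp add: presented_add)
  next
    case (Smul c t)
    then show ?case using W(4)[OF Smul.hyps(1) Smul.IH] by (simp add: presented_smult)
  next
    case (Op p s t)
    then show ?case using assms(4)[OF Op.hyps(1) Op.IH] by (simp add: presented_op)
  qed (rule assms(3))
  then show ?thesis
    by (auto simp: presented_carrier)
qed

text \<open>Makes the prescription on generators linear in \<open>V\<close>, as the universal
  properties require.\<close>

lemma (in dn_algebra) gen_coproduct_lin:
  assumes "f \<in> lin_hom K V D"
  shows "(\<lambda>v. (f v, tD \<one>\<^bsub>H\<^esub> (f v))) \<in> lin_hom K V Q"
  by (intro dsum_pair_lin assms bilin_right[OF bilin_tD]) simp

theorem corollary8p5:
  fixes K :: "('k, 'm) ring_scheme" and V :: "('k, 'v, 'n) module_scheme"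
  assumes "field K"
    and char_0: "\<And>n :: nat. n > 0 \<Longrightarrow> [n] \<cdot>\<^bsub>K\<^esub> \<one>\<^bsub>K\<^esub> \<noteq> \<zero>\<^bsub>K\<^esub>"
    and "module K V"
  shows "(\<exists>\<Delta> \<kappa>. connected_hopf_algebra K (augmentation K (free_dn K V) (free_dn_op K V)) \<Delta> \<kappa>) \<and>
    (\<exists>\<Delta> \<kappa>. connected_hopf_algebra K
      (augmentation K (free_comm_dn K V) (free_comm_dn_op K V)) \<Delta> \<kappa>)"
  proof
  interpret V: module K V by fact
  have K: "cring K" by (rule V.R.is_cring)
  show "\<exists>\<Delta> \<kappa>. connected_hopf_algebra K (augmentation K (free_dn K V) (free_dn_op K V)) \<Delta> \<kappa>"
  proof -
    note free = dn_algebra_free_dn[OF assms(3)]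
    interpret F: dn_algebra K "free_dn K V" "free_dn_op K V" by (rule free)
    let ?i = "free_dn_gen K V"
    obtain \<delta> where \<delta>: "\<delta> \<in> op_hom K UNIV (free_dn K V) (free_dn_op K V) F.Q F.qop"
        "\<forall>v\<in>carrier V. \<delta> (?i v) = (?i v, F.tD \<one>\<^bsub>F.H\<^esub> (?i v))"
      using free_dn_universal(1)[OF assms(3) F.dn_algebra_Q F.gen_coproduct_lin[OF free(2)]] by blast
    have "dn_coalgebra K (free_dn K V) (free_dn_op K V) (?i ` carrier V) \<delta>"
    proof (intro dn_coalgebra.intro dn_coalgebra_axioms.intro F.dn_algebra_axioms \<delta>(1))
      show "?i ` carrier V \<subseteq> carrier (free_dn K V)"
        using lin_hom_closed[OF free(2)] by blast
      show "carrier (free_dn K V) \<subseteq> W"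
        if "submodule W K (free_dn K V)" "?i ` carrier V \<subseteq> W"
          "\<And>p x y. \<lbrakk>x \<in> W; y \<in> W\<rbrakk> \<Longrightarrow> free_dn_op K V p x y \<in> W" for W
        using that unfolding free_dn_def free_dn_op_def free_dn_gen_def
        by (intro presented_generate[OF K]) auto
    qed (use \<delta>(2) in blast)
    then show ?thesis
      using dn_coalgebra.connected_hopf_algebra_H by blast
  qed
  show "\<exists>\<Delta> \<kappa>. connected_hopf_algebra K (augmentation K (free_comm_dn K V) (free_comm_dn_op K V)) \<Delta> \<kappa>"
  proof -
    note free = comm_dn_algebra_free_comm_dn[OF assms(3)]
    interpret F: comm_dn_algebra K "free_comm_dn K V" "free_comm_dn_op K V" by (rule free)
    let ?i = "free_comm_dn_gen K V"
    \<comment> \<open>The universal property now admits commutative targets only, hence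
      \<open>comm_dn_algebra_Q\<close>.\<close>
    obtain \<delta> where \<delta>: "\<delta> \<in> op_hom K UNIV (free_comm_dn K V) (free_comm_dn_op K V) F.Q F.qop"
        "\<forall>v\<in>carrier V. \<delta> (?i v) = (?i v, F.tD \<one>\<^bsub>F.H\<^esub> (?i v))"
      using free_comm_dn_universal(1)[OF assms(3) F.comm_dn_algebra_Q F.gen_coproduct_lin[OF free(2)]] by blast
    have "dn_coalgebra K (free_comm_dn K V) (free_comm_dn_op K V) (?i ` carrier V) \<delta>"
    proof (intro dn_coalgebra.intro dn_coalgebra_axioms.intro F.dn_algebra_axioms \<delta>(1))
      show "?i ` carrier V \<subseteq> carrier (free_comm_dn K V)"
        using lin_hom_closed[OF free(2)] by blast
      show "carrier (free_comm_dn K V) \<subseteq> W"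
        if "submodule W K (free_comm_dn K V)" "?i ` carrier V \<subseteq> W"
          "\<And>p x y. \<lbrakk>x \<in> W; y \<in> W\<rbrakk> \<Longrightarrow> free_comm_dn_op K V p x y \<in> W" for W
        using that unfolding free_comm_dn_def free_comm_dn_op_def free_comm_dn_gen_def
        by (intro presented_generate[OF K]) auto
    qed (use \<delta>(2) in blast)
    then show ?thesis
      using dn_coalgebra.connected_hopf_algebra_H by blast
  qed
qed

end
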